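(* In the graph setting of the context (with $\Omega\neq\emptyset$ and $\partial\Omega\neq\emptyset$), let $a>0$, $b\ge 0$, and let $f:\mathbb{R}\to\mathbb{R}$ satisfy: (i) $f$ is continuous and there are $C_0>0$ and $p\in[4,+\infty)$ with $|f(t)|\le C_0(1+|t|^{p-1})$ for all $t\in\mathbb{R}$; (ii) $f(t)=o(t)$ as $|t|\to 0$; (iii) $f(t)=lt^3+f_\infty(t)$, where $l>0$, $f_\infty(t)=o(t^3)$ as $|t|\to\infty$, and there is $\theta_0\in(0,1)$ such that for all $t>0$ and $\tau\in\mathbb{R}\setminus\{0\}$, $$\left[\frac{f_\infty(\tau)}{\tau^3}-\frac{f_\infty(t\tau)}{(t\tau)^3}\right]\operatorname{sign}(1-t)+\frac{a\theta_0\lambda_1|1-t^2|}{(t\tau)^2}\ge 0;$$ (iv) $l>b\mu_0$. Then the problem $$-\left(a+b\int_{\Omega\cup\partial\Omega}|\nabla u|^2\,d\mu\right)\Delta u=f(u)\ \text{ in }\Omega,\qquad u=0\ \text{ on }\partial\Omega,$$ has a sign-changing solution $\tilde u\in\mathcal{M}$ and a constant-sign solution $\bar u\in\mathcal{N}$ such that $$I(\tilde u)=\inf_{\mathcal{M}}I=:m,\qquad I(\bar u)=\inf_{\mathcal{N}}I=:c.$$ Moreover, $m>2c$.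
   Context: Setting. $G=(V,E)$ is a locally finite graph (every vertex has finitely many neighbours; $y\sim x$ means $xy\in E$), with edge weights $w_{xy}=w_{yx}>0$ and a function $\mu:V\to(0,\infty)$. $d(x,y)$ is the minimal number of edges of a path joining $x$ and $y$. For $\Omega\subset V$, $\partial\Omega=\{y\in V\setminus\Omega:\exists x\in\Omega,\ xy\in E\}$; the interior $\Omega^\circ=\Omega\setminus\partial\Omega$ equals $\Omega$. $\Omega\cup\partial\Omega$ is a bounded domain, i.e. $d$ is uniformly bounded on it. Notation. $\int_{A}\psi\,d\mu=\sum_{x\in A}\mu(x)\psi(x)$; $\Gamma(\psi_1,\psi_2)(x)=\nabla\psi_1\cdot\nabla\psi_2(x)=\frac{1}{2\mu(x)}\sum_{y\sim x}w_{xy}(\psi_1(y)-\psi_1(x))(\psi_2(y)-\psi_2(x))$; $|\nabla\psi|^2=\Gamma(\psi,\psi)$; $\Delta\psi(x)=\frac{1}{\mu(x)}\sum_{y\sim x}w_{xy}(\psi(y)-\psi(x))$. $\mathcal{H}_0^{1,2}(\Omega)$ is the space of real functions on $\Omega$ with $u=0$ on $\partial\Omega$ (extended by $0$ outside $\Omega$), with norm $\|u\|=(\int_{\Omega\cup\partial\Omega}|\nabla u|^2d\mu)^{1/2}$. $u^+=\max\{u,0\}$, $u^-=\min\{u,0\}$. $\lambda_1$ is the first eigenvalue of $(-\Delta,\mathcal{H}_0^{1,2}(\Omega))$, so $\lambda_1\int_\Omega|u|^2d\mu\le\|u\|^2$. $$\mu_0=\inf_{\substack{u\in \mathcal{H}_0^{1,2}(\Omega)\\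 u^+\neq0,\,u^-\neq0}}\max\left\{\frac{\|u\|^2\int_{\Omega\cup\partial\Omega}\Gamma(u,u^+)d\mu}{\int_{\Omega}|u^+|^4d\mu},\ \frac{\|u\|^2\int_{\Omega\cup\partial\Omega}\Gamma(u,u^-)d\mu}{\int_{\Omega}|u^-|^4d\mu}\right\}.$$ With $F(u)=\int_0^u f(t)dt$, $I:\mathcal{H}_0^{1,2}(\Omega)\to\mathbb{R}$ is $I(u)=\frac a2\|u\|^2+\frac b4\|u\|^4-\int_\Omega F(u)d\mu$, with $\langle I'(u),v\rangle=(a+b\|u\|^2)\int_{\Omega\cup\partial\Omega}\Gamma(u,v)d\mu-\int_\Omega f(u)v\,d\mu$. $\mathcal{M}=\{u\in\mathcal{H}_0^{1,2}(\Omega):u^\pm\ne0,\ \langle I'(u),u^+\rangle=\langle I'(u),u^-\rangle=0\}$ and $\mathcal{N}=\{u\in\mathcal{H}_0^{1,2}(\Omega):u\neq0,\ \langle I'(u),u\rangle=0\}$. A solution $u$ is sign-changing if $u^+\not\equiv0$ and $u^-\not\equiv0$; constant-sign means that $u\ge0$ on $\Omega$ or $u\le0$ on $\Omega$.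
   Formalization: The claim m>2c is stated only when b>0 or Ω is connected (for b=0 and disconnected Ω equality m=2c can occur), and μ_0<∞ is assumed, which only excludes b=0 with a one-vertex Ω, where no sign-changing function exists. *)

theory Defs
  imports "HOL-Analysis.Analysis" "HOL-Library.Landau_Symbols" "HOL-Library.Extended_Nat"
begin

section \<open>Weighted graphs\<close>

record 'v wgraph =
  verts :: "'v set"
  edges :: "'v set set"
  weight :: "'v \<Rightarrow> 'v \<Rightarrow> real"
  meas :: "'v \<Rightarrow> real"

definition nbrs :: "'v wgraph \<Rightarrow> 'v \<Rightarrow> 'v set" where
  "nbrs G x = {y. {x, y} \<in> edges G}"

text \<open>Loops are not excluded: they contribute to none of the operators below.
  Weights are only constrained (and only ever used) on edges, the measure only on vertices.\<close>

definition locally_finite_wgraph :: "'v wgraph \<Rightarrow> bool" where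
  "locally_finite_wgraph G \<longleftrightarrow>
     edges G \<subseteq> {{x, y} | x y. x \<in> verts G \<and> y \<in> verts G} \<and>
     (\<forall>x\<in>verts G. finite (nbrs G x)) \<and>
     (\<forall>x y. {x, y} \<in> edges G \<longrightarrow> weight G x y = weight G y x \<and> weight G x y > 0) \<and>
     (\<forall>x\<in>verts G. meas G x > 0)"

text \<open>The relational power counts the edges of a walk, and shortest walks are paths;
  the distance is infinite when no path exists.\<close>

definition gdist :: "'v wgraph \<Rightarrow> 'v \<Rightarrow> 'v \<Rightarrow> enat" where
  "gdist G x y = Inf (enat ` {n. (x, y) \<in> {(u, v). {u, v} \<in> edges G} ^^ n})"

definition bdry :: "'v wgraph \<Rightarrow> 'v set \<Rightarrow> 'v set" where
  "bdry G \<Omega> = {y \<in> verts G - \<Omega>. \<exists>x\<in>\<Omega>. {x, y} \<in> edges G}"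

definition bounded_in :: "'v wgraph \<Rightarrow> 'v set \<Rightarrow> bool" where
  "bounded_in G A \<longleftrightarrow> (\<exists>N::nat. \<forall>x\<in>A. \<forall>y\<in>A. gdist G x y \<le> enat N)"

definition connected_in :: "'v wgraph \<Rightarrow> 'v set \<Rightarrow> bool" where
  "connected_in G A \<longleftrightarrow>
     (\<forall>x\<in>A. \<forall>y\<in>A. (x, y) \<in> {(u, v). u \<in> A \<and> v \<in> A \<and> {u, v} \<in> edges G}\<^sup>*)"

section \<open>Calculus on graphs\<close>

text \<open>For locally finite graphs, bounded sets are finite, so finite sums suffice.\<close>

definition gint :: "'v wgraph \<Rightarrow> 'v set \<Rightarrow> ('v \<Rightarrow> real) \<Rightarrow> real" where
  "gint G A \<psi> = (\<Sum>x\<in>A. meas G x * \<psi> x)"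

definition Gam :: "'v wgraph \<Rightarrow> ('v \<Rightarrow> real) \<Rightarrow> ('v \<Rightarrow> real) \<Rightarrow> 'v \<Rightarrow> real" where
  "Gam G \<psi>1 \<psi>2 x =
     1 / (2 * meas G x) * (\<Sum>y\<in>nbrs G x. weight G x y * (\<psi>1 y - \<psi>1 x) * (\<psi>2 y - \<psi>2 x))"

definition lap :: "'v wgraph \<Rightarrow> ('v \<Rightarrow> real) \<Rightarrow> 'v \<Rightarrow> real" where
  "lap G \<psi> x = 1 / meas G x * (\<Sum>y\<in>nbrs G x. weight G x y * (\<psi> y - \<psi> x))"

text \<open>Elements of the Dirichlet space are represented by their extension by zero.\<close>

definition H0 :: "'v set \<Rightarrow> ('v \<Rightarrow> real) set" where
  "H0 \<Omega> = {u. \<forall>x. x \<notin> \<Omega> \<longrightarrow> u x = 0}"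

definition Hnorm :: "'v wgraph \<Rightarrow> 'v set \<Rightarrow> ('v \<Rightarrow> real) \<Rightarrow> real" where
  "Hnorm G \<Omega> u = sqrt (gint G (\<Omega> \<union> bdry G \<Omega>) (Gam G u u))"

definition pos_part :: "('v \<Rightarrow> real) \<Rightarrow> 'v \<Rightarrow> real" where
  "pos_part u = (\<lambda>x. max (u x) 0)"

text \<open>The negative part is nonpositive, so that a function is the sum of its two parts.\<close>

definition neg_part :: "('v \<Rightarrow> real) \<Rightarrow> 'v \<Rightarrow> real" where
  "neg_part u = (\<lambda>x. min (u x) 0)"

definition sign_changing :: "('v \<Rightarrow> real) \<Rightarrow> bool" where
  "sign_changing u \<longleftrightarrow> pos_part u \<noteq> (\<lambda>_. 0) \<and> neg_part u \<noteq> (\<lambda>_. 0)"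

definition constant_sign :: "'v set \<Rightarrow> ('v \<Rightarrow> real) \<Rightarrow> bool" where
  "constant_sign \<Omega> u \<longleftrightarrow> (\<forall>x\<in>\<Omega>. u x \<ge> 0) \<or> (\<forall>x\<in>\<Omega>. u x \<le> 0)"

definition dirichlet_eigenvalue :: "'v wgraph \<Rightarrow> 'v set \<Rightarrow> real \<Rightarrow> bool" where
  "dirichlet_eigenvalue G \<Omega> ev \<longleftrightarrow>
     (\<exists>u\<in>H0 \<Omega>. u \<noteq> (\<lambda>_. 0) \<and> (\<forall>x\<in>\<Omega>. - lap G u x = ev * u x))"

definition lambda1 :: "'v wgraph \<Rightarrow> 'v set \<Rightarrow> real" where
  "lambda1 G \<Omega> = (LEAST ev. dirichlet_eigenvalue G \<Omega> ev)"

text \<open>Infima are taken in the extended reals; \<open>mu0\<close> is infinite precisely when there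
  is no sign-changing function, that is, when \<open>\<Omega>\<close> has fewer than two vertices.\<close>

definition mu0 :: "'v wgraph \<Rightarrow> 'v set \<Rightarrow> ereal" where
  "mu0 G \<Omega> =
     (INF u \<in> {u \<in> H0 \<Omega>. sign_changing u}.
        ereal (max
          ((Hnorm G \<Omega> u)\<^sup>2 * gint G (\<Omega> \<union> bdry G \<Omega>) (Gam G u (pos_part u))
             / gint G \<Omega> (\<lambda>x. \<bar>pos_part u x\<bar> ^ 4))
          ((Hnorm G \<Omega> u)\<^sup>2 * gint G (\<Omega> \<union> bdry G \<Omega>) (Gam G u (neg_part u))
             / gint G \<Omega> (\<lambda>x. \<bar>neg_part u x\<bar> ^ 4))))"

section \<open>The Kirchhoff problem\<close>

text \<open>The interval integral is oriented, hence correct for negative \<open>s\<close> as well.\<close>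

definition prim :: "(real \<Rightarrow> real) \<Rightarrow> real \<Rightarrow> real" where
  "prim f s = (LBINT t=ereal 0..ereal s. f t)"

definition energy ::
  "'v wgraph \<Rightarrow> 'v set \<Rightarrow> real \<Rightarrow> real \<Rightarrow> (real \<Rightarrow> real) \<Rightarrow> ('v \<Rightarrow> real) \<Rightarrow> real" where
  "energy G \<Omega> a b f u =
     a / 2 * (Hnorm G \<Omega> u)\<^sup>2 + b / 4 * (Hnorm G \<Omega> u) ^ 4 - gint G \<Omega> (\<lambda>x. prim f (u x))"

definition denergy ::
  "'v wgraph \<Rightarrow> 'v set \<Rightarrow> real \<Rightarrow> real \<Rightarrow> (real \<Rightarrow> real) \<Rightarrow>
   ('v \<Rightarrow> real) \<Rightarrow> ('v \<Rightarrow> real) \<Rightarrow> real" where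
  "denergy G \<Omega> a b f u v =
     (a + b * (Hnorm G \<Omega> u)\<^sup>2) * gint G (\<Omega> \<union> bdry G \<Omega>) (Gam G u v)
       - gint G \<Omega> (\<lambda>x. f (u x) * v x)"

definition nodal_nehari ::
  "'v wgraph \<Rightarrow> 'v set \<Rightarrow> real \<Rightarrow> real \<Rightarrow> (real \<Rightarrow> real) \<Rightarrow> ('v \<Rightarrow> real) set" where
  "nodal_nehari G \<Omega> a b f =
     {u \<in> H0 \<Omega>. pos_part u \<noteq> (\<lambda>_. 0) \<and> neg_part u \<noteq> (\<lambda>_. 0) \<and>
        denergy G \<Omega> a b f u (pos_part u) = 0 \<and> denergy G \<Omega> a b f u (neg_part u) = 0}"

definition nehari ::
  "'v wgraph \<Rightarrow> 'v set \<Rightarrow> real \<Rightarrow> real \<Rightarrow> (real \<Rightarrow> real) \<Rightarrow> ('v \<Rightarrow> real) set" where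
  "nehari G \<Omega> a b f = {u \<in> H0 \<Omega>. u \<noteq> (\<lambda>_. 0) \<and> denergy G \<Omega> a b f u u = 0}"

definition nodal_level ::
  "'v wgraph \<Rightarrow> 'v set \<Rightarrow> real \<Rightarrow> real \<Rightarrow> (real \<Rightarrow> real) \<Rightarrow> ereal" where
  "nodal_level G \<Omega> a b f = (INF u \<in> nodal_nehari G \<Omega> a b f. ereal (energy G \<Omega> a b f u))"

definition ground_level ::
  "'v wgraph \<Rightarrow> 'v set \<Rightarrow> real \<Rightarrow> real \<Rightarrow> (real \<Rightarrow> real) \<Rightarrow> ereal" where
  "ground_level G \<Omega> a b f = (INF u \<in> nehari G \<Omega> a b f. ereal (energy G \<Omega> a b f u))"

definition kirchhoff_solution ::
  "'v wgraph \<Rightarrow> 'v set \<Rightarrow> real \<Rightarrow> real \<Rightarrow> (real \<Rightarrow> real) \<Rightarrow> ('v \<Rightarrow> real) \<Rightarrow> bool" where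
  "kirchhoff_solution G \<Omega> a b f u \<longleftrightarrow>
     u \<in> H0 \<Omega> \<and>
     (\<forall>x\<in>\<Omega>. - (a + b * gint G (\<Omega> \<union> bdry G \<Omega>) (Gam G u u)) * lap G u x = f (u x))"

end

theory Submission imports Defs begin

text \<open>
  Why the theorem holds. A bounded set in a locally finite graph is finite, so the Dirichlet space
  is a finite-dimensional space of functions and Green's formula turns \<open>\<integral>\<Gamma>(u, v) d\<mu>\<close> into a quadratic
  form with nonpositive off-diagonal coefficients, positive definite because every vertex of the
  domain has a walk to the boundary. The hypothesis on \<open>finf\<close> allows a defect of size
  \<open>K = a * \<theta>0 * lambda1\<close>. This is exactly what a linear term contributes: with
  \<open>g t = f t - K * t\<close> the quotient \<open>g \<tau> / \<tau> ^ 3\<close> is monotone on each half-line, while moving \<open>K \<integral>u\<^sup>2 d\<mu>\<close>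
  to the quadratic part leaves a form \<open>Q\<close> that is still coercive, as \<open>\<theta>0 < 1\<close>. The problem becomes
  the study of \<open>J u = Q(u, u) / 2 + b / 4 * E(u, u)\<^sup>2 - \<integral>Gp(u) d\<mu>\<close> on a finite set.

  Everything rests on one explicit estimate (\<open>nodal_fibre\<close>): for \<open>u\<close> in the nodal set \<open>M\<close>,
  \<open>J(s u\<^sup>+ + t u\<^sup>-)\<close> lies below \<open>J u\<close> by at least \<open>Q(u\<^sup>+, u\<^sup>+) (s\<^sup>2 - 1)\<^sup>2 / 4 + Q(u\<^sup>-, u\<^sup>-) (t\<^sup>2 - 1)\<^sup>2 / 4\<close>, and
  similarly along rays on the Nehari set \<open>N\<close>. It bounds \<open>J\<close> below by \<open>Q / 4\<close>, so minimizing
  sequences are bounded, and as \<open>g\<close> is small at zero the constraint sets are closed: minimizers exist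
  once \<open>M\<close> is nonempty. For that, maximize \<open>J(s u\<^sup>+ + t u\<^sup>-)\<close> over the quadrant, for \<open>u\<close> almost attaining
  \<open>mu0\<close>: the condition \<open>b * mu0 < l\<close> makes the quartic terms negative, and the maximum is
  interior, hence in \<open>M\<close>.

  As \<open>g\<close> is merely continuous, \<open>M\<close> need not be a manifold and Lagrange multipliers are not available.
  Instead (\<open>perturbed_max\<close>), if the derivative at a minimizer \<open>u\<close> were nonzero in the direction of a
  vertex \<open>x\<close>, change the value at \<open>x\<close> slightly so as to lower \<open>J\<close>. The strict estimate above
  forces the scaled perturbations near \<open>(s, t) = (1, 1)\<close> to have an interior maximum; there both
  partial derivatives vanish, so the maximizer belongs to \<open>M\<close>, yet its energy is below that of \<open>u\<close>.
  A vertex where \<open>u\<close> vanishes causes no trouble, because the new value joins the part that has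
  its sign.

  Finally let \<open>m\<close> and \<open>c\<close> be the two levels. Projecting the two parts of a nodal minimizer to \<open>N\<close>
  and using the fibre estimate gives \<open>2 c \<le> m\<close>. A sign-changing ground state would lie in \<open>M\<close> and
  give \<open>c \<ge> m \<ge> 2 c > 0\<close>; so ground states have constant sign. The gap is strict
  if \<open>b > 0\<close>, since the nonlocal term couples the two parts; on a connected domain equality would make
  the positive part of the nodal minimizer, suitably scaled, a ground state with zeros, contradicting
  the maximum principle.
\<close>

section \<open>Quadratic forms with nonpositive off-diagonal coefficients\<close>

definition qform :: "'v set \<Rightarrow> ('v \<Rightarrow> 'v \<Rightarrow> real) \<Rightarrow> ('v \<Rightarrow> real) \<Rightarrow> ('v \<Rightarrow> real) \<Rightarrow> real" where
  "qform S A u v = (\<Sum>x\<in>S. \<Sum>y\<in>S. A x y * u x * v y)"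

lemma qform_add_left: "qform S A (\<lambda>x. u x + v x) w = qform S A u w + qform S A v w"
  by (simp add: qform_def algebra_simps sum.distrib)

lemma qform_add_right: "qform S A w (\<lambda>x. u x + v x) = qform S A w u + qform S A w v"
  by (simp add: qform_def algebra_simps sum.distrib)

lemma qform_scale_left: "qform S A (\<lambda>x. c * u x) w = c * qform S A u w"
  by (simp add: qform_def algebra_simps sum_distrib_left)

lemma qform_scale_right: "qform S A w (\<lambda>x. c * u x) = c * qform S A w u"
  by (simp add: qform_def algebra_simps sum_distrib_left)

lemmas qform_linear = qform_add_left qform_add_right qform_scale_left qform_scale_right

lemma qform_commute:
  assumes "\<And>x y. x \<in> S \<Longrightarrow> y \<in> S \<Longrightarrow> A x y = A y x"
  shows "qform S A u v = qform S A v u"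
proof -
  have "qform S A u v = (\<Sum>y\<in>S. \<Sum>x\<in>S. A x y * u x * v y)"
    unfolding qform_def by (rule sum.swap)
  also have "\<dots> = qform S A v u"
    unfolding qform_def by (intro sum.cong refl) (simp add: assms mult_ac)
  finally show ?thesis .
qed

lemma continuous_on_qform [continuous_intros]:
  fixes Z V :: "'p::topological_space \<Rightarrow> 'v \<Rightarrow> real"
  assumes "\<And>x. continuous_on T (\<lambda>p. Z p x)" "\<And>x. continuous_on T (\<lambda>p. V p x)"
  shows "continuous_on T (\<lambda>p. qform S A (Z p) (V p))"
  unfolding qform_def by (intro continuous_intros assms)

text \<open>Diagonal terms vanish for functions with disjoint supports; in each remaining term both the
  coefficient and the product of the values are nonpositive.\<close>

lemma qform_nonneg_of_opposite_signs:
  assumes "\<And>x y. x \<in> S \<Longrightarrow> y \<in> S \<Longrightarrow> x \<noteq> y \<Longrightarrow> A x y \<le> 0"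
    and "\<And>x. U x \<ge> 0" "\<And>x. W x \<le> 0" "\<And>x. U x = 0 \<or> W x = 0"
  shows "qform S A U W \<ge> 0"
  unfolding qform_def
proof (intro sum_nonneg)
  fix x y assume "x \<in> S" "y \<in> S"
  show "A x y * U x * W y \<ge> 0"
  proof (cases "x = y")
    case True
    then show ?thesis using assms(4)[of y] by auto
  next
    case False
    then have "A x y * U x \<le> 0"
      using assms(1)[OF \<open>x \<in> S\<close> \<open>y \<in> S\<close>] assms(2)[of x] by (simp add: mult_nonpos_nonneg)
    then show ?thesis using assms(3)[of y] by (simp add: mult_nonpos_nonpos)
  qed
qed

lemma closed_Collect_bex:
  assumes "finite A" "\<And>x. closed {u. P x u}"
  shows "closed {u. \<exists>x\<in>A. P x u}"
proof -
  have "{u. \<exists>x\<in>A. P x u} = (\<Union>x\<in>A. {u. P x u})" by auto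
  then show ?thesis using assms by (simp add: closed_UN)
qed

lemma compact_box:
  fixes C :: "'v \<Rightarrow> real set"
  assumes "\<And>x. compact (C x)"
  shows "compact {u. \<forall>x. u x \<in> C x}"
proof -
  have "compactin (product_topology (\<lambda>_. euclidean) UNIV) (PiE UNIV C)"
    using assms by (subst compactin_PiE) auto
  moreover have "PiE UNIV C = {u. \<forall>x. u x \<in> C x}"
    by (auto simp: PiE_def Pi_def)
  ultimately show ?thesis
    by (simp add: euclidean_product_topology flip: compactin_euclidean_iff)
qed

lemma closed_H0: "closed (H0 \<Omega>)"
proof -
  have eq: "H0 \<Omega> = (\<Inter>x\<in>-\<Omega>. {u. u x = 0})" by (auto simp: H0_def)
  show ?thesis unfolding eq
    by (intro closed_INT ballI closed_Collect_eq continuous_intros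
        continuous_on_product_coordinates)
qed

lemma compact_of_bounded_squares:
  assumes fin: "finite \<Omega>" and X: "closed X" "X \<subseteq> H0 \<Omega>"
    and bnd: "\<And>u. u \<in> X \<Longrightarrow> (\<Sum>x\<in>\<Omega>. (u x)\<^sup>2) \<le> C"
  shows "compact X"
proof -
  define R where "R = 1 + \<bar>C\<bar>"
  have R: "1 \<le> R" by (simp add: R_def)
  have box: "u x \<in> {-R..R}" if u: "u \<in> X" for u x
  proof (cases "x \<in> \<Omega>")
    case True
    have "(u x)\<^sup>2 \<le> (\<Sum>x\<in>\<Omega>. (u x)\<^sup>2)"
      using member_le_sum[OF True, of "\<lambda>x. (u x)\<^sup>2"] fin by simp
    also have "\<dots> \<le> C" by (rule bnd[OF u])
    also have "\<dots> \<le> R" by (simp add: R_def)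
    also have "R \<le> R\<^sup>2" by (rule self_le_power[OF R]) (rule pos2)
    finally have "\<bar>u x\<bar> \<le> R"
      by (metis R abs_le_square_iff abs_of_nonneg order_trans zero_le_one)
    then show ?thesis by (simp add: abs_le_iff minus_le_iff)
  next
    case False
    then have "u x = 0" using X(2) u by (auto simp: H0_def)
    then show ?thesis using R by simp
  qed
  have "X \<subseteq> {u. \<forall>x. u x \<in> {-R..R}}" by (intro subsetI CollectI allI) (rule box)
  then have "{u. \<forall>x. u x \<in> {-R..R}} \<inter> X = X" by (rule Int_absorb1)
  moreover have "compact ({u. \<forall>x. u x \<in> {-R..R}} \<inter> X)"
    by (intro compact_Int_closed compact_box X(1)) (rule compact_Icc)
  ultimately show ?thesis by (simp only:)
qed

definition unit_at :: "'v \<Rightarrow> 'v \<Rightarrow> real" where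
  "unit_at x = (\<lambda>y. if y = x then 1 else 0)"

lemma qform_unit:
  assumes "finite S" "x \<in> S" shows "qform S A u (unit_at x) = (\<Sum>y\<in>S. A y x * u y)"
proof -
  have "(\<Sum>z\<in>S. A y z * u y * unit_at x z) = A y x * u y" for y
    using assms by (simp add: unit_at_def if_distrib[of "\<lambda>c. _ * c"] cong: if_cong)
  then show ?thesis by (simp add: qform_def)
qed

lemma parts_simps:
  "pos_part u x + neg_part u x = u x" "pos_part u x \<ge> 0" "neg_part u x \<le> 0"
  "pos_part u x = 0 \<or> neg_part u x = 0" "u x = 0 \<Longrightarrow> pos_part u x = 0"
  "u x = 0 \<Longrightarrow> neg_part u x = 0"
  by (auto simp: pos_part_def neg_part_def)

lemma parts_unique:
  assumes "\<And>x. U x \<ge> 0" "\<And>x. W x \<le> 0" "\<And>x. U x = 0 \<or> W x = 0"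
  shows "pos_part (\<lambda>x. U x + W x) = U" "neg_part (\<lambda>x. U x + W x) = W"
proof -
  have "max (U x + W x) 0 = U x \<and> min (U x + W x) 0 = W x" for x
    using assms(1)[of x] assms(2)[of x] assms(3)[of x] by auto
  then show "pos_part (\<lambda>x. U x + W x) = U" "neg_part (\<lambda>x. U x + W x) = W"
    by (auto simp: pos_part_def neg_part_def)
qed

section \<open>Quartic inequalities\<close>

text \<open>A weighted Cauchy--Schwarz inequality: it lets the nonlocal quartic term be compared
  separately on each of the two parts.\<close>

lemma quartic_split:
  fixes p n c s t :: real
  assumes "p \<ge> 0" "n \<ge> 0" "c \<ge> 0" "s \<ge> 0" "t \<ge> 0"
  shows "(s\<^sup>2 * p + t\<^sup>2 * n + 2 * s * t * c)\<^sup>2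
    \<le> (p + n + 2 * c) * (s ^ 4 * (p + c) + t ^ 4 * (n + c))"
proof -
  have "2 * s * t * c \<le> (s\<^sup>2 + t\<^sup>2) * c"
    using sum_squares_bound[of s t] assms(3) by (simp add: mult_right_mono)
  then have "s\<^sup>2 * p + t\<^sup>2 * n + 2 * s * t * c \<le> s\<^sup>2 * (p + c) + t\<^sup>2 * (n + c)"
    by (simp add: algebra_simps)
  then have "(s\<^sup>2 * p + t\<^sup>2 * n + 2 * s * t * c)\<^sup>2 \<le> (s\<^sup>2 * (p + c) + t\<^sup>2 * (n + c))\<^sup>2"
    using assms by (intro power_mono) auto
  also have "\<dots> = (p + n + 2 * c) * (s ^ 4 * (p + c) + t ^ 4 * (n + c))
      - (p + c) * (n + c) * (s\<^sup>2 - t\<^sup>2)\<^sup>2"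
    by (simp add: algebra_simps power2_eq_square power4_eq_xxxx)
  also have "\<dots> \<le> (p + n + 2 * c) * (s ^ 4 * (p + c) + t ^ 4 * (n + c))"
    using assms by simp
  finally show ?thesis .
qed

text \<open>The following two facts control one variable far out and the other one everywhere.\<close>

lemma quartic_below:
  fixes k \<eta> D :: real
  assumes "\<eta> > 0"
  shows "\<exists>R>0. \<forall>s>R. k * s\<^sup>2 - \<eta> * s ^ 4 < - D"
proof -
  define R where "R = max 1 ((\<bar>k\<bar> + \<bar>D\<bar> + 1) / \<eta>)"
  have "k * s\<^sup>2 - \<eta> * s ^ 4 < - D" if "s > R" for s
  proof -
    have s: "s \<ge> 1" "s \<ge> (\<bar>k\<bar> + \<bar>D\<bar> + 1) / \<eta>" using that by (auto simp: R_def)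
    define y where "y = s\<^sup>2"
    have y: "y \<ge> s" using s(1) by (simp add: y_def power2_eq_square)
    have "\<eta> * y \<ge> \<eta> * s" using y assms by simp
    moreover have "\<eta> * s \<ge> \<bar>k\<bar> + \<bar>D\<bar> + 1" using s(2) assms by (simp add: field_simps)
    ultimately have "k - \<eta> * y \<le> - (\<bar>D\<bar> + 1)" by linarith
    then have "y * (k - \<eta> * y) \<le> y * (- (\<bar>D\<bar> + 1))" using y s by (intro mult_left_mono) auto
    also have "\<dots> \<le> 1 * (- (\<bar>D\<bar> + 1))" using y s by (intro mult_right_mono_neg) auto
    also have "\<dots> < - D" using abs_ge_self[of D] by (simp add: less_diff_eq)
    finally have "y * (k - \<eta> * y) < - D" .
    then show ?thesis by (simp add: y_def algebra_simps power4_eq_xxxx power2_eq_square)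
  qed
  then show ?thesis by (intro exI[of _ R]) (auto simp: R_def)
qed

lemma quartic_bounded:
  fixes k \<eta> :: real
  assumes "\<eta> > 0"
  shows "k * s\<^sup>2 - \<eta> * s ^ 4 \<le> k\<^sup>2 / (4 * \<eta>)"
proof -
  have "(2 * \<eta> * s\<^sup>2 - k)\<^sup>2 \<ge> 0" by simp
  then have "4 * \<eta> * (k * s\<^sup>2 - \<eta> * s ^ 4) \<le> k\<^sup>2"
    by (simp add: power2_eq_square power4_eq_xxxx algebra_simps)
  then show ?thesis using assms by (simp add: field_simps)
qed

section \<open>An abstract Kirchhoff functional on a finite set\<close>

text \<open>The coefficients \<open>EM\<close> give the Dirichlet form, which enters the nonlocal term, and \<open>QM\<close> the
  coercive quadratic part that remains after the linear shift of the nonlinearity. The condition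
  \<open>g_cubic_mono\<close> states that \<open>g \<tau> / \<tau> ^ 3\<close> is nondecreasing in \<open>\<bar>\<tau>\<bar>\<close> on each half-line, in a form
  without division.\<close>

locale kirchhoff_functional =
  fixes \<Omega> :: "'v set" and QM EM :: "'v \<Rightarrow> 'v \<Rightarrow> real" and \<mu> :: "'v \<Rightarrow> real"
    and b l :: real and g Gp :: "real \<Rightarrow> real"
  assumes finite_domain: "finite \<Omega>"
    and QM_sym: "\<And>x y. x \<in> \<Omega> \<Longrightarrow> y \<in> \<Omega> \<Longrightarrow> QM x y = QM y x"
    and EM_sym: "\<And>x y. x \<in> \<Omega> \<Longrightarrow> y \<in> \<Omega> \<Longrightarrow> EM x y = EM y x"
    and QM_offdiag: "\<And>x y. x \<in> \<Omega> \<Longrightarrow> y \<in> \<Omega> \<Longrightarrow> x \<noteq> y \<Longrightarrow> QM x y \<le> 0"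
    and EM_offdiag: "\<And>x y. x \<in> \<Omega> \<Longrightarrow> y \<in> \<Omega> \<Longrightarrow> x \<noteq> y \<Longrightarrow> EM x y \<le> 0"
    and \<mu>_pos: "\<And>x. x \<in> \<Omega> \<Longrightarrow> \<mu> x > 0"
    and b_nonneg: "b \<ge> 0"
    and Q_coercive: "\<exists>\<kappa>>0. \<forall>u\<in>H0 \<Omega>. \<kappa> * (\<Sum>x\<in>\<Omega>. (u x)\<^sup>2) \<le> qform \<Omega> QM u u"
    and E_pos: "\<And>u. u \<in> H0 \<Omega> \<Longrightarrow> u \<noteq> (\<lambda>_. 0) \<Longrightarrow> qform \<Omega> EM u u > 0"
    and g_cont: "continuous_on UNIV g"
    and g_0: "g 0 = 0"
    and Gp_deriv: "\<And>t. (Gp has_real_derivative g t) (at t)"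
    and Gp_0: "Gp 0 = 0"
    and g_cubic_mono: "\<And>t \<tau>. 0 < t \<Longrightarrow> t \<le> 1 \<Longrightarrow> g (t * \<tau>) * \<tau> \<le> t ^ 3 * (g \<tau> * \<tau>)"
    and g_small: "\<And>\<epsilon>. \<epsilon> > 0 \<Longrightarrow> \<exists>\<delta>>0. \<forall>\<tau>. \<bar>\<tau>\<bar> \<le> \<delta> \<longrightarrow> g \<tau> * \<tau> \<le> \<epsilon> * \<tau>\<^sup>2"
    and g_large: "\<And>\<epsilon>. \<epsilon> > 0 \<Longrightarrow> \<exists>R>0. \<forall>\<tau>. \<bar>\<tau>\<bar> \<ge> R \<longrightarrow> \<bar>g \<tau> * \<tau> - l * \<tau> ^ 4\<bar> \<le> \<epsilon> * \<tau> ^ 4"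
begin

abbreviation "Q \<equiv> qform \<Omega> QM"
abbreviation "E \<equiv> qform \<Omega> EM"

definition J :: "('v \<Rightarrow> real) \<Rightarrow> real" where
  "J u = Q u u / 2 + b / 4 * (E u u)\<^sup>2 - (\<Sum>x\<in>\<Omega>. \<mu> x * Gp (u x))"

definition dJ :: "('v \<Rightarrow> real) \<Rightarrow> ('v \<Rightarrow> real) \<Rightarrow> real" where
  "dJ u v = Q u v + b * E u u * E u v - (\<Sum>x\<in>\<Omega>. \<mu> x * (g (u x) * v x))"

definition N :: "('v \<Rightarrow> real) set" where
  "N = {u \<in> H0 \<Omega>. u \<noteq> (\<lambda>_. 0) \<and> dJ u u = 0}"

definition M :: "('v \<Rightarrow> real) set" where
  "M = {u \<in> H0 \<Omega>. pos_part u \<noteq> (\<lambda>_. 0) \<and> neg_part u \<noteq> (\<lambda>_. 0) \<and>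
          dJ u (pos_part u) = 0 \<and> dJ u (neg_part u) = 0}"

lemma Q_commute: "Q u v = Q v u"
  by (rule qform_commute) (rule QM_sym)

lemma E_commute: "E u v = E v u"
  by (rule qform_commute) (rule EM_sym)

lemma dJ_add: "dJ u (\<lambda>x. v x + w x) = dJ u v + dJ u w"
  by (simp add: dJ_def qform_linear algebra_simps sum.distrib)

lemma dJ_scale: "dJ u (\<lambda>x. c * v x) = c * dJ u v"
  by (simp add: dJ_def qform_linear algebra_simps sum_distrib_left)

lemma Gp_cont: "continuous_on UNIV Gp"
  using Gp_deriv DERIV_isCont by (metis continuous_at_imp_continuous_on)

lemma continuous_on_J [continuous_intros]:
  fixes Z :: "'p::topological_space \<Rightarrow> 'v \<Rightarrow> real"
  assumes "\<And>x. continuous_on T (\<lambda>p. Z p x)"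
  shows "continuous_on T (\<lambda>p. J (Z p))"
  unfolding J_def
  by (intro continuous_intros assms continuous_on_compose2[OF Gp_cont]) auto

lemma continuous_on_dJ [continuous_intros]:
  fixes Z V :: "'p::topological_space \<Rightarrow> 'v \<Rightarrow> real"
  assumes "\<And>x. continuous_on T (\<lambda>p. Z p x)" "\<And>x. continuous_on T (\<lambda>p. V p x)"
  shows "continuous_on T (\<lambda>p. dJ (Z p) (V p))"
  unfolding dJ_def
  by (intro continuous_intros assms continuous_on_compose2[OF g_cont]) auto

lemma H0_comb:
  assumes "u \<in> H0 \<Omega>" "v \<in> H0 \<Omega>" shows "(\<lambda>x. s * u x + t * v x) \<in> H0 \<Omega>"
  using assms by (auto simp: H0_def)

lemma H0_scale: "u \<in> H0 \<Omega> \<Longrightarrow> (\<lambda>x. s * u x) \<in> H0 \<Omega>"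
  by (auto simp: H0_def)

lemma H0_parts: "u \<in> H0 \<Omega> \<Longrightarrow> pos_part u \<in> H0 \<Omega>" "u \<in> H0 \<Omega> \<Longrightarrow> neg_part u \<in> H0 \<Omega>"
  by (auto simp: H0_def parts_simps)

lemma sum_squares_pos:
  assumes "u \<in> H0 \<Omega>" "u \<noteq> (\<lambda>_. 0)" shows "(\<Sum>x\<in>\<Omega>. (u x)\<^sup>2) > 0"
proof -
  obtain x where "u x \<noteq> 0" using assms(2) by auto
  moreover then have "x \<in> \<Omega>" using assms(1) by (auto simp: H0_def)
  ultimately show ?thesis
    by (intro sum_pos2[OF finite_domain \<open>x \<in> \<Omega>\<close>]) auto
qed

lemma sum_fourth_pos:
  assumes "u \<in> H0 \<Omega>" "u \<noteq> (\<lambda>_. 0)" shows "(\<Sum>x\<in>\<Omega>. \<mu> x * (u x) ^ 4) > 0"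
proof -
  obtain x where "u x \<noteq> 0" using assms(2) by auto
  moreover then have "x \<in> \<Omega>" using assms(1) by (auto simp: H0_def)
  ultimately show ?thesis
    by (intro sum_pos2[OF finite_domain \<open>x \<in> \<Omega>\<close>]) (auto simp: \<mu>_pos less_imp_le)
qed

lemma Q_pos: assumes "u \<in> H0 \<Omega>" "u \<noteq> (\<lambda>_. 0)" shows "Q u u > 0"
proof -
  obtain \<kappa> where "\<kappa> > 0" "\<kappa> * (\<Sum>x\<in>\<Omega>. (u x)\<^sup>2) \<le> Q u u"
    using Q_coercive assms(1) by auto
  then show ?thesis using sum_squares_pos[OF assms] by (smt (verit) mult_pos_pos)
qed

lemma E_nonneg: "u \<in> H0 \<Omega> \<Longrightarrow> E u u \<ge> 0"
  using E_pos[of u] by (cases "u = (\<lambda>_. 0)") (auto simp: qform_def)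

lemma Q_parts: "Q (pos_part u) (neg_part u) \<ge> 0"
  by (intro qform_nonneg_of_opposite_signs QM_offdiag parts_simps) auto

lemma E_parts: "E (pos_part u) (neg_part u) \<ge> 0"
  by (intro qform_nonneg_of_opposite_signs EM_offdiag parts_simps) auto

lemma Q_comb: "Q (\<lambda>x. s * U x + t * W x) (\<lambda>x. s * U x + t * W x)
    = s\<^sup>2 * Q U U + t\<^sup>2 * Q W W + 2 * s * t * Q U W"
  using Q_commute[of W U] by (simp add: qform_linear power2_eq_square algebra_simps)

lemma E_comb: "E (\<lambda>x. s * U x + t * W x) (\<lambda>x. s * U x + t * W x)
    = s\<^sup>2 * E U U + t\<^sup>2 * E W W + 2 * s * t * E U W"
  using E_commute[of W U] by (simp add: qform_linear power2_eq_square algebra_simps)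

lemma DERIV_J_line:
  "((\<lambda>r. J (\<lambda>x. z x + r * w x)) has_real_derivative dJ (\<lambda>x. z x + r * w x) w) (at r)"
proof -
  have q: "Q (\<lambda>x. z x + r * w x) (\<lambda>x. z x + r * w x) = Q z z + 2 * r * Q z w + r\<^sup>2 * Q w w"
    and e: "E (\<lambda>x. z x + r * w x) (\<lambda>x. z x + r * w x) = E z z + 2 * r * E z w + r\<^sup>2 * E w w" for r
    using Q_commute[of w z] E_commute[of w z]
    by (auto simp: qform_linear power2_eq_square algebra_simps)
  have G: "((\<lambda>r. \<Sum>x\<in>\<Omega>. \<mu> x * Gp (z x + r * w x)) has_real_derivative
      (\<Sum>x\<in>\<Omega>. \<mu> x * (g (z x + r * w x) * w x))) (at r)"
    by (auto intro!: derivative_eq_intros DERIV_chain2[OF Gp_deriv] simp: mult_ac)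
  have QE: "((\<lambda>r. (Q z z + 2 * r * Q z w + r\<^sup>2 * Q w w) / 2
        + b / 4 * (E z z + 2 * r * E z w + r\<^sup>2 * E w w)\<^sup>2) has_real_derivative
      Q z w + r * Q w w + b * (E z z + 2 * r * E z w + r\<^sup>2 * E w w) * (E z w + r * E w w)) (at r)"
    by (auto intro!: derivative_eq_intros simp: field_simps power2_eq_square)
  have "dJ (\<lambda>x. z x + r * w x) w = Q z w + r * Q w w
      + b * (E z z + 2 * r * E z w + r\<^sup>2 * E w w) * (E z w + r * E w w)
      - (\<Sum>x\<in>\<Omega>. \<mu> x * (g (z x + r * w x) * w x))"
    unfolding dJ_def e by (simp add: qform_linear)
  then show ?thesis
    using DERIV_diff[OF QE G] unfolding J_def q e by simp
qed

section \<open>Fibres\<close>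

text \<open>The quotient \<open>g (s \<tau>) * \<tau> / s ^ 3\<close> is nondecreasing in \<open>s > 0\<close>, so \<open>Gp (s \<tau>) - s ^ 4 / 4 * g \<tau> * \<tau>\<close>
  decreases up to \<open>s = 1\<close> and increases afterwards.\<close>

lemma Gp_scale_ge:
  assumes "s \<ge> 0"
  shows "Gp (s * \<tau>) - Gp \<tau> \<ge> (s ^ 4 - 1) / 4 * (g \<tau> * \<tau>)"
proof -
  define k where "k s = Gp (s * \<tau>) - s ^ 4 / 4 * (g \<tau> * \<tau>)" for s
  have d: "(k has_real_derivative g (s * \<tau>) * \<tau> - s ^ 3 * (g \<tau> * \<tau>)) (at s)" for s
    unfolding k_def
    by (auto intro!: derivative_eq_intros DERIV_chain2[OF Gp_deriv])
  then have c: "continuous_on A k" for A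
    by (meson DERIV_isCont continuous_at_imp_continuous_on)
  have "k 1 \<le> k s"
  proof (cases "s \<le> 1")
    case True
    show ?thesis
    proof (rule DERIV_nonpos_imp_decreasing_open[OF True _ c])
      fix x assume "s < x" "x < 1"
      then have "g (x * \<tau>) * \<tau> - x ^ 3 * (g \<tau> * \<tau>) \<le> 0"
        using g_cubic_mono[of x \<tau>] assms by auto
      then show "\<exists>y. DERIV k x :> y \<and> y \<le> 0" using d by blast
    qed
  next
    case False
    then have "1 \<le> s" by simp
    show ?thesis
    proof (rule DERIV_nonneg_imp_increasing_open[OF \<open>1 \<le> s\<close> _ c])
      fix x :: real assume x: "1 < x" "x < s"
      have "g (1 / x * (x * \<tau>)) * (x * \<tau>) \<le> (1 / x) ^ 3 * (g (x * \<tau>) * (x * \<tau>))"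
        using x by (intro g_cubic_mono) auto
      then have "x ^ 3 * (g \<tau> * (x * \<tau>)) \<le> g (x * \<tau>) * (x * \<tau>)"
        using x by (simp add: field_simps)
      then have "x * (x ^ 3 * (g \<tau> * \<tau>)) \<le> x * (g (x * \<tau>) * \<tau>)"
        by (simp add: algebra_simps)
      then have "x ^ 3 * (g \<tau> * \<tau>) \<le> g (x * \<tau>) * \<tau>"
        using x by (simp only: mult_le_cancel_left_pos)
      then show "\<exists>y. DERIV k x :> y \<and> y \<ge> 0" using d by force
    qed
  qed
  then show ?thesis by (simp add: k_def algebra_simps add_divide_distrib diff_divide_distrib)
qed

lemma sum_Gp_scale_ge:
  assumes "s \<ge> 0"
  shows "(\<Sum>x\<in>\<Omega>. \<mu> x * Gp (s * u x)) - (\<Sum>x\<in>\<Omega>. \<mu> x * Gp (u x))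
    \<ge> (s ^ 4 - 1) / 4 * (\<Sum>x\<in>\<Omega>. \<mu> x * (g (u x) * u x))"
proof -
  have "(\<Sum>x\<in>\<Omega>. \<mu> x * ((s ^ 4 - 1) / 4 * (g (u x) * u x)))
      \<le> (\<Sum>x\<in>\<Omega>. \<mu> x * (Gp (s * u x) - Gp (u x)))"
    by (intro sum_mono mult_left_mono Gp_scale_ge assms) (auto simp: \<mu>_pos less_imp_le)
  then show ?thesis
    by (simp add: right_diff_distrib sum_subtractf sum_distrib_left mult.left_commute)
qed

lemma sum_Gp_disjoint:
  assumes "\<And>x. U x = 0 \<or> W x = 0"
  shows "(\<Sum>x\<in>\<Omega>. \<mu> x * Gp (s * U x + t * W x))
    = (\<Sum>x\<in>\<Omega>. \<mu> x * Gp (s * U x)) + (\<Sum>x\<in>\<Omega>. \<mu> x * Gp (t * W x))"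
proof -
  have "\<mu> x * Gp (s * U x + t * W x) = \<mu> x * Gp (s * U x) + \<mu> x * Gp (t * W x)" for x
    using assms[of x] Gp_0 by auto
  then show ?thesis by (simp add: sum.distrib)
qed

lemma J_scale: "J (\<lambda>x. s * u x)
    = s\<^sup>2 * Q u u / 2 + b / 4 * s ^ 4 * (E u u)\<^sup>2 - (\<Sum>x\<in>\<Omega>. \<mu> x * Gp (s * u x))"
  by (simp add: J_def qform_linear power2_eq_square power4_eq_xxxx algebra_simps)

lemma J_comb:
  assumes "\<And>x. U x = 0 \<or> W x = 0"
  shows "J (\<lambda>x. s * U x + t * W x)
    = (s\<^sup>2 * Q U U + t\<^sup>2 * Q W W + 2 * s * t * Q U W) / 2
      + b / 4 * (s\<^sup>2 * E U U + t\<^sup>2 * E W W + 2 * s * t * E U W)\<^sup>2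
      - (\<Sum>x\<in>\<Omega>. \<mu> x * Gp (s * U x)) - (\<Sum>x\<in>\<Omega>. \<mu> x * Gp (t * W x))"
  by (simp add: J_def Q_comb E_comb sum_Gp_disjoint[OF assms])

text \<open>Restricting to one ray, the quartic terms cancel by the Nehari identity and the quadratic
  ones combine to a perfect square.\<close>

lemma nehari_fibre:
  assumes "u \<in> N" "s \<ge> 0"
  shows "J (\<lambda>x. s * u x) \<le> J u - Q u u * (s\<^sup>2 - 1)\<^sup>2 / 4"
proof -
  have "Q u u + b * E u u * E u u = (\<Sum>x\<in>\<Omega>. \<mu> x * (g (u x) * u x))"
    using assms(1) by (simp add: N_def dJ_def)
  then have "(\<Sum>x\<in>\<Omega>. \<mu> x * Gp (s * u x)) - (\<Sum>x\<in>\<Omega>. \<mu> x * Gp (u x))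
    \<ge> (s ^ 4 - 1) / 4 * (Q u u + b * E u u * E u u)"
    using sum_Gp_scale_ge[OF assms(2), of u] by simp
  moreover have "J (\<lambda>x. s * u x) = s\<^sup>2 * Q u u / 2 + b / 4 * s ^ 4 * (E u u)\<^sup>2
      - (\<Sum>x\<in>\<Omega>. \<mu> x * Gp (s * u x))" by (rule J_scale)
  moreover have "J u = Q u u / 2 + b / 4 * (E u u)\<^sup>2 - (\<Sum>x\<in>\<Omega>. \<mu> x * Gp (u x))"
    by (rule J_def)
  moreover have "(s ^ 4 - 1) / 4 * (Q u u + b * E u u * E u u) - Q u u * (s\<^sup>2 - 1)\<^sup>2 / 4
      = s\<^sup>2 * Q u u / 2 + b / 4 * s ^ 4 * (E u u)\<^sup>2 - (Q u u / 2 + b / 4 * (E u u)\<^sup>2)"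
    by (simp add: field_simps power2_eq_square power4_eq_xxxx)
  ultimately show ?thesis by linarith
qed

text \<open>The nonlinear term sees each part by itself, so the two parts are coupled only through the
  quadratic forms.\<close>

lemma nodal_identities:
  assumes "u \<in> M"
  shows "Q (pos_part u) (pos_part u) + Q (pos_part u) (neg_part u)
      + b * E u u * (E (pos_part u) (pos_part u) + E (pos_part u) (neg_part u))
      = (\<Sum>x\<in>\<Omega>. \<mu> x * (g (pos_part u x) * pos_part u x))"
    "Q (neg_part u) (neg_part u) + Q (pos_part u) (neg_part u)
      + b * E u u * (E (neg_part u) (neg_part u) + E (pos_part u) (neg_part u))
      = (\<Sum>x\<in>\<Omega>. \<mu> x * (g (neg_part u x) * neg_part u x))"
    "E u u = E (pos_part u) (pos_part u) + E (neg_part u) (neg_part u)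
      + 2 * E (pos_part u) (neg_part u)"
proof -
  have u: "u = (\<lambda>x. pos_part u x + neg_part u x)" by (simp add: parts_simps)
  have g: "g (u x) * pos_part u x = g (pos_part u x) * pos_part u x"
    "g (u x) * neg_part u x = g (neg_part u x) * neg_part u x" for x
    by (auto simp: pos_part_def neg_part_def max_def min_def)
  have "Q u v = Q (pos_part u) v + Q (neg_part u) v"
    "E u v = E (pos_part u) v + E (neg_part u) v" for v
    by (subst u, simp add: qform_linear)+
  moreover have "dJ u (pos_part u) = 0" "dJ u (neg_part u) = 0" using assms by (auto simp: M_def)
  ultimately show
    "Q (pos_part u) (pos_part u) + Q (pos_part u) (neg_part u)
      + b * E u u * (E (pos_part u) (pos_part u) + E (pos_part u) (neg_part u))
      = (\<Sum>x\<in>\<Omega>. \<mu> x * (g (pos_part u x) * pos_part u x))"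
    "Q (neg_part u) (neg_part u) + Q (pos_part u) (neg_part u)
      + b * E u u * (E (neg_part u) (neg_part u) + E (pos_part u) (neg_part u))
      = (\<Sum>x\<in>\<Omega>. \<mu> x * (g (neg_part u x) * neg_part u x))"
    unfolding dJ_def g
    using Q_commute[of "neg_part u" "pos_part u"] E_commute[of "neg_part u" "pos_part u"]
    by (simp_all add: algebra_simps)
  show "E u u = E (pos_part u) (pos_part u) + E (neg_part u) (neg_part u)
      + 2 * E (pos_part u) (neg_part u)"
    by (subst (1 2) u) (use E_comb[of 1 "pos_part u" 1 "neg_part u"] in simp)
qed

text \<open>On the nodal set both parts satisfy a Nehari identity, and the interaction terms favour
  equal scaling of the two parts: the quadratic one by the inequality of arithmetic and
  geometric means, the quartic one by the weighted Cauchy--Schwarz inequality.\<close>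

lemma nodal_fibre:
  assumes "u \<in> M" "s \<ge> 0" "t \<ge> 0"
  shows "J (\<lambda>x. s * pos_part u x + t * neg_part u x)
    \<le> J u - Q (pos_part u) (pos_part u) * (s\<^sup>2 - 1)\<^sup>2 / 4
          - Q (neg_part u) (neg_part u) * (t\<^sup>2 - 1)\<^sup>2 / 4"
proof -
  define U W where "U = pos_part u" and "W = neg_part u"
  define p n c where "p = E U U" and "n = E W W" and "c = E U W"
  define qp qn qc where "qp = Q U U" and "qn = Q W W" and "qc = Q U W"
  define A B where "A = (\<Sum>x\<in>\<Omega>. \<mu> x * (g (U x) * U x))" and "B = (\<Sum>x\<in>\<Omega>. \<mu> x * (g (W x) * W x))"
  define GU GW where "GU s = (\<Sum>x\<in>\<Omega>. \<mu> x * Gp (s * U x))" and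
    "GW s = (\<Sum>x\<in>\<Omega>. \<mu> x * Gp (s * W x))" for s
  have H: "U \<in> H0 \<Omega>" "W \<in> H0 \<Omega>" using assms(1) by (auto simp: M_def U_def W_def H0_parts)
  have pos: "p \<ge> 0" "n \<ge> 0" "c \<ge> 0" "qc \<ge> 0"
    using E_nonneg[OF H(1)] E_nonneg[OF H(2)] Q_parts[of u] E_parts[of u]
    by (auto simp: p_def n_def c_def qc_def U_def W_def)
  define T where "T = p + n + 2 * c"
  note folds = U_def[symmetric] W_def[symmetric] p_def[symmetric] n_def[symmetric] c_def[symmetric]
    qp_def[symmetric] qn_def[symmetric] qc_def[symmetric] A_def[symmetric] B_def[symmetric]
    GU_def[symmetric] GW_def[symmetric]
  have id: "qp + qc + b * T * (p + c) = A" "qn + qc + b * T * (n + c) = B"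
    using nodal_identities[OF assms(1)] by (simp_all add: folds T_def)
  have disj: "U x = 0 \<or> W x = 0" for x by (auto simp: U_def W_def parts_simps)
  have Js: "J (\<lambda>x. s * U x + t * W x) = (s\<^sup>2 * qp + t\<^sup>2 * qn + 2 * s * t * qc) / 2
      + b / 4 * (s\<^sup>2 * p + t\<^sup>2 * n + 2 * s * t * c)\<^sup>2 - GU s - GW t" for s t
    using J_comb[OF disj, where s=s and t=t] by (simp add: folds)
  have "u = (\<lambda>x. 1 * U x + 1 * W x)" by (simp add: U_def W_def parts_simps)
  with Js[of 1 1] have Ju: "J u = (qp + qn + 2 * qc) / 2 + b / 4 * T\<^sup>2 - GU 1 - GW 1"
    by (simp add: T_def power2_eq_square)
  have G: "GU s - GU 1 \<ge> (s ^ 4 - 1) / 4 * A" "GW t - GW 1 \<ge> (t ^ 4 - 1) / 4 * B"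
    using sum_Gp_scale_ge[OF assms(2), of U] sum_Gp_scale_ge[OF assms(3), of W]
    by (auto simp: GU_def GW_def A_def B_def)
  have quart: "b / 4 * (s\<^sup>2 * p + t\<^sup>2 * n + 2 * s * t * c)\<^sup>2
      \<le> b / 4 * (T * (s ^ 4 * (p + c) + t ^ 4 * (n + c)))"
    unfolding T_def by (intro mult_left_mono quartic_split) (use pos assms b_nonneg in auto)
  have "(s ^ 4 + t ^ 4 + 2) - 4 * s * t = (s\<^sup>2 - 1)\<^sup>2 + (t\<^sup>2 - 1)\<^sup>2 + 2 * (s - t)\<^sup>2"
    by (simp add: power2_eq_square power4_eq_xxxx algebra_simps)
  then have am: "qc * ((s ^ 4 + t ^ 4 + 2) - 4 * s * t) \<ge> 0" using pos by simp
  have alg: "(s ^ 4 - 1) / 4 * A + (t ^ 4 - 1) / 4 * B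
      = (s\<^sup>2 * qp + t\<^sup>2 * qn + 2 * s * t * qc) / 2 - (qp + qn + 2 * qc) / 2
        + qp * (s\<^sup>2 - 1)\<^sup>2 / 4 + qn * (t\<^sup>2 - 1)\<^sup>2 / 4
        + qc * ((s ^ 4 + t ^ 4 + 2) - 4 * s * t) / 4
        + b / 4 * (T * (s ^ 4 * (p + c) + t ^ 4 * (n + c))) - b / 4 * T\<^sup>2"
    unfolding id[symmetric] T_def
    by (simp add: field_simps power2_eq_square power4_eq_xxxx)
  have "J (\<lambda>x. s * U x + t * W x) \<le> J u - qp * (s\<^sup>2 - 1)\<^sup>2 / 4 - qn * (t\<^sup>2 - 1)\<^sup>2 / 4"
    using Js[of s t] Ju G quart am alg by argo
  then show ?thesis by (simp only: folds)
qed

section \<open>Growth of the nonlinearity\<close>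

text \<open>Monotonicity of \<open>g \<tau> / \<tau> ^ 3\<close> along rays bounds it by its limit \<open>l\<close> at infinity.\<close>

lemma g_le_cubic: "g \<tau> * \<tau> \<le> l * \<tau> ^ 4"
proof (cases "\<tau> = 0")
  case False
  show ?thesis
  proof (rule field_le_epsilon)
    fix e :: real assume "e > 0"
    then have "e / \<tau> ^ 4 > 0" using False by simp
    then obtain R where R: "R > 0" "\<And>\<sigma>. \<bar>\<sigma>\<bar> \<ge> R \<Longrightarrow> \<bar>g \<sigma> * \<sigma> - l * \<sigma> ^ 4\<bar> \<le> e / \<tau> ^ 4 * \<sigma> ^ 4"
      using g_large by blast
    define t where "t = min 1 (\<bar>\<tau>\<bar> / R)"
    have t: "0 < t" "t \<le> 1" "t * R \<le> \<bar>\<tau>\<bar>"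
      using False R(1) by (auto simp: t_def min_def field_simps)
    define \<sigma> where "\<sigma> = \<tau> / t"
    have \<tau>: "\<tau> = t * \<sigma>" using t by (simp add: \<sigma>_def)
    have "\<bar>\<sigma>\<bar> \<ge> R" using t by (simp add: \<sigma>_def field_simps)
    from R(2)[OF this] have "g \<sigma> * \<sigma> \<le> (l + e / \<tau> ^ 4) * \<sigma> ^ 4"
      by (simp add: algebra_simps)
    then have "t ^ 3 * (g \<sigma> * \<sigma>) \<le> t ^ 3 * ((l + e / \<tau> ^ 4) * \<sigma> ^ 4)"
      using t by (intro mult_left_mono) auto
    with g_cubic_mono[OF t(1,2), of \<sigma>]
    have "g \<tau> * \<sigma> \<le> t ^ 3 * ((l + e / \<tau> ^ 4) * \<sigma> ^ 4)" using \<tau> by simp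
    then have "t * (g \<tau> * \<sigma>) \<le> t * (t ^ 3 * ((l + e / \<tau> ^ 4) * \<sigma> ^ 4))"
      using t by (intro mult_left_mono) auto
    also have "\<dots> = (l + e / \<tau> ^ 4) * (t * \<sigma>) ^ 4"
      by (simp add: power_mult_distrib power4_eq_xxxx power3_eq_cube)
    also have "\<dots> = l * \<tau> ^ 4 + e"
      by (subst \<tau>[symmetric]) (use False in \<open>simp add: field_simps\<close>)
    finally show "g \<tau> * \<tau> \<le> l * \<tau> ^ 4 + e" by (simp add: \<tau> mult_ac)
  qed
qed auto

lemma Gp_le: "Gp \<tau> \<le> g \<tau> * \<tau> / 4"
  using Gp_scale_ge[of 0 \<tau>] Gp_0 by simp

text \<open>Outside a bounded interval the derivative of \<open>Gp \<tau> - (l - \<epsilon>) / 4 * \<tau> ^ 4\<close> has the sign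
  of \<open>\<tau>\<close>, so this function is bounded below.\<close>

lemma Gp_ge_quartic:
  assumes "\<epsilon> > 0"
  shows "\<exists>C. \<forall>\<tau>. Gp \<tau> \<ge> (l - \<epsilon>) / 4 * \<tau> ^ 4 - C"
proof -
  obtain R where R: "R > 0" "\<And>\<tau>. \<bar>\<tau>\<bar> \<ge> R \<Longrightarrow> \<bar>g \<tau> * \<tau> - l * \<tau> ^ 4\<bar> \<le> \<epsilon> * \<tau> ^ 4"
    using g_large[OF assms] by blast
  define k where "k \<tau> = Gp \<tau> - (l - \<epsilon>) / 4 * \<tau> ^ 4" for \<tau>
  have d: "(k has_real_derivative g \<tau> - (l - \<epsilon>) * \<tau> ^ 3) (at \<tau>)" for \<tau>
    unfolding k_def by (auto intro!: derivative_eq_intros Gp_deriv)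
  then have "continuous_on {-R..R} k"
    by (meson DERIV_isCont continuous_at_imp_continuous_on)
  then have "\<exists>z\<in>{-R..R}. \<forall>\<tau>\<in>{-R..R}. k z \<le> k \<tau>"
    using R(1) by (intro continuous_attains_inf) auto
  then obtain z where z: "\<And>\<tau>. \<tau> \<in> {-R..R} \<Longrightarrow> k z \<le> k \<tau>" by blast
  have sgn: "\<tau> * (g \<tau> - (l - \<epsilon>) * \<tau> ^ 3) \<ge> 0" if "\<bar>\<tau>\<bar> \<ge> R" for \<tau>
    using R(2)[OF that] by (simp add: algebra_simps power4_eq_xxxx power3_eq_cube)
  have "k z \<le> k \<tau>" for \<tau>
  proof -
    consider "\<tau> \<in> {-R..R}" | "\<tau> > R" | "\<tau> < -R" by force
    then show ?thesis
    proof cases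
      case 2
      have "k R \<le> k \<tau>"
      proof (rule DERIV_nonneg_imp_nondecreasing[where f=k])
        fix x assume "R \<le> x" "x \<le> \<tau>"
        then show "\<exists>y. DERIV k x :> y \<and> y \<ge> 0"
          using d[of x] sgn[of x] R(1) by (auto simp: zero_le_mult_iff)
      qed (use 2 in auto)
      then show ?thesis using z[of R] R(1) by auto
    next
      case 3
      have "k \<tau> \<ge> k (-R)"
      proof (rule DERIV_nonpos_imp_nonincreasing[where f=k])
        fix x assume "\<tau> \<le> x" "x \<le> -R"
        then show "\<exists>y. DERIV k x :> y \<and> y \<le> 0"
          using d[of x] sgn[of x] R(1) by (auto simp: zero_le_mult_iff)
      qed (use 3 in auto)
      then show ?thesis using z[of "-R"] R(1) by auto
    qed (use z in auto)
  qed
  then have "\<forall>\<tau>. Gp \<tau> \<ge> (l - \<epsilon>) / 4 * \<tau> ^ 4 - (- k z)"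
    by (simp add: k_def algebra_simps)
  then show ?thesis by blast
qed

lemma sum_Gp_ge_quartic:
  assumes "\<epsilon> > 0"
  shows "\<exists>C. \<forall>u. (\<Sum>x\<in>\<Omega>. \<mu> x * Gp (u x)) \<ge> (l - \<epsilon>) / 4 * (\<Sum>x\<in>\<Omega>. \<mu> x * (u x) ^ 4) - C"
proof -
  obtain C where C: "\<And>\<tau>. Gp \<tau> \<ge> (l - \<epsilon>) / 4 * \<tau> ^ 4 - C"
    using Gp_ge_quartic[OF assms] by blast
  have "(\<Sum>x\<in>\<Omega>. \<mu> x * Gp (u x)) \<ge> (l - \<epsilon>) / 4 * (\<Sum>x\<in>\<Omega>. \<mu> x * (u x) ^ 4) - (\<Sum>x\<in>\<Omega>. \<mu> x * C)" for u
  proof -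
    have "(\<Sum>x\<in>\<Omega>. \<mu> x * ((l - \<epsilon>) / 4 * (u x) ^ 4 - C)) \<le> (\<Sum>x\<in>\<Omega>. \<mu> x * Gp (u x))"
      by (intro sum_mono mult_left_mono C) (auto simp: \<mu>_pos less_imp_le)
    then show ?thesis
      by (simp add: right_diff_distrib sum_subtractf sum_distrib_left mult.left_commute)
  qed
  then show ?thesis by blast
qed

text \<open>By the monotonicity \<open>Gp\<close> is at most a quarter of \<open>g \<tau> * \<tau>\<close>, which is \<open>o(\<tau>\<^sup>2)\<close> from above.\<close>

lemma sum_Gp_scale_small:
  assumes v: "v \<in> H0 \<Omega>" "v \<noteq> (\<lambda>_. 0)"
  shows "\<exists>d>0. \<forall>s. 0 < s \<and> s < d \<longrightarrow> (\<Sum>x\<in>\<Omega>. \<mu> x * Gp (s * v x)) < s\<^sup>2 * Q v v / 2"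
proof -
  define V where "V = (\<Sum>x\<in>\<Omega>. \<mu> x * (v x)\<^sup>2)"
  have "V \<ge> 0" unfolding V_def by (intro sum_nonneg) (auto simp: \<mu>_pos less_imp_le)
  define \<epsilon> where "\<epsilon> = Q v v / (1 + V)"
  have Q: "Q v v > 0" using Q_pos[OF v] .
  have \<epsilon>: "\<epsilon> > 0" "\<epsilon> * V \<le> Q v v"
    using Q \<open>V \<ge> 0\<close> by (auto simp: \<epsilon>_def field_simps)
  obtain \<delta> where \<delta>: "\<delta> > 0" "\<And>\<tau>. \<bar>\<tau>\<bar> \<le> \<delta> \<Longrightarrow> g \<tau> * \<tau> \<le> \<epsilon> * \<tau>\<^sup>2"
    using g_small[OF \<epsilon>(1)] by blast
  define B where "B = 1 + (\<Sum>x\<in>\<Omega>. \<bar>v x\<bar>)"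
  have B: "B > 0" by (simp add: B_def add_pos_nonneg sum_nonneg)
  have vB: "\<bar>v x\<bar> \<le> B" if "x \<in> \<Omega>" for x
    using member_le_sum[OF that, of "\<lambda>x. \<bar>v x\<bar>"] finite_domain by (simp add: B_def)
  show ?thesis
  proof (intro exI[of _ "\<delta> / B"] conjI allI impI)
    fix s assume s: "0 < s \<and> s < \<delta> / B"
    have "(\<Sum>x\<in>\<Omega>. \<mu> x * Gp (s * v x)) \<le> (\<Sum>x\<in>\<Omega>. \<mu> x * (\<epsilon> / 4 * s\<^sup>2 * (v x)\<^sup>2))"
    proof (intro sum_mono mult_left_mono)
      fix x assume x: "x \<in> \<Omega>"
      have "\<bar>s * v x\<bar> \<le> s * B" using vB[OF x] s by (simp add: abs_mult)
      also have "\<dots> \<le> \<delta>" using s B by (simp add: field_simps)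
      finally show "Gp (s * v x) \<le> \<epsilon> / 4 * s\<^sup>2 * (v x)\<^sup>2"
        using \<delta>(2)[of "s * v x"] Gp_le[of "s * v x"] by (simp add: power_mult_distrib)
    qed (auto simp: \<mu>_pos less_imp_le)
    also have "\<dots> = s\<^sup>2 * (\<epsilon> * V) / 4" by (simp add: V_def sum_distrib_left sum_distrib_right mult_ac)
    also have "\<dots> \<le> s\<^sup>2 * Q v v / 4" using \<epsilon>(2) by (intro divide_right_mono mult_left_mono) auto
    also have "\<dots> < s\<^sup>2 * Q v v / 2" using s Q by simp
    finally show "(\<Sum>x\<in>\<Omega>. \<mu> x * Gp (s * v x)) < s\<^sup>2 * Q v v / 2" .
  qed (use \<delta> B in auto)
qed

section \<open>Existence of minimizers\<close>

text \<open>Since \<open>g\<close> is small near zero, the Nehari inequality excludes functions whose values are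
  all small. This keeps the constraint sets closed.\<close>

lemma nehari_away_from_zero:
  "\<exists>\<delta>>0. \<forall>v\<in>H0 \<Omega>. v \<noteq> (\<lambda>_. 0) \<and> Q v v \<le> (\<Sum>x\<in>\<Omega>. \<mu> x * (g (v x) * v x))
      \<longrightarrow> (\<exists>x\<in>\<Omega>. \<bar>v x\<bar> \<ge> \<delta>)"
proof -
  obtain \<kappa> where \<kappa>: "\<kappa> > 0" "\<And>u. u \<in> H0 \<Omega> \<Longrightarrow> \<kappa> * (\<Sum>x\<in>\<Omega>. (u x)\<^sup>2) \<le> Q u u"
    using Q_coercive by auto
  define m where "m = 1 + sum \<mu> \<Omega>"
  have m: "m > 0" by (simp add: m_def add_pos_nonneg sum_nonneg \<mu>_pos less_imp_le)
  have \<mu>m: "\<mu> x \<le> m" if "x \<in> \<Omega>" for x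
    using member_le_sum[OF that, of \<mu>] finite_domain by (simp add: m_def \<mu>_pos less_imp_le)
  obtain \<delta> where \<delta>: "\<delta> > 0" "\<And>\<tau>. \<bar>\<tau>\<bar> \<le> \<delta> \<Longrightarrow> g \<tau> * \<tau> \<le> \<kappa> / (2 * m) * \<tau>\<^sup>2"
    using g_small[of "\<kappa> / (2 * m)"] \<kappa> m by auto
  show ?thesis
  proof (intro exI[of _ \<delta>] conjI ballI impI)
    fix v assume v: "v \<in> H0 \<Omega>" "v \<noteq> (\<lambda>_. 0) \<and> Q v v \<le> (\<Sum>x\<in>\<Omega>. \<mu> x * (g (v x) * v x))"
    show "\<exists>x\<in>\<Omega>. \<bar>v x\<bar> \<ge> \<delta>"
    proof (rule ccontr)
      assume "\<not> ?thesis"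
      then have small: "\<bar>v x\<bar> \<le> \<delta>" if "x \<in> \<Omega>" for x using that by force
      have "\<kappa> * (\<Sum>x\<in>\<Omega>. (v x)\<^sup>2) \<le> (\<Sum>x\<in>\<Omega>. \<mu> x * (g (v x) * v x))"
        using \<kappa>(2)[OF v(1)] v(2) by simp
      also have "\<dots> \<le> (\<Sum>x\<in>\<Omega>. \<mu> x * (\<kappa> / (2 * m) * (v x)\<^sup>2))"
        by (intro sum_mono mult_left_mono \<delta> small) (auto simp: \<mu>_pos less_imp_le)
      also have "\<dots> \<le> (\<Sum>x\<in>\<Omega>. m * (\<kappa> / (2 * m) * (v x)\<^sup>2))"
        using \<kappa> m by (intro sum_mono mult_right_mono \<mu>m) auto
      also have "\<dots> = \<kappa> / 2 * (\<Sum>x\<in>\<Omega>. (v x)\<^sup>2)"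
        using m by (simp add: sum_distrib_left)
      finally show False using sum_squares_pos[of v] v \<kappa>(1) by simp
    qed
  qed (use \<delta> in auto)
qed

lemma closed_away: "closed {u. \<exists>x\<in>\<Omega>. \<bar>u x\<bar> \<ge> (\<delta>::real)}"
  by (intro closed_Collect_bex finite_domain closed_Collect_le continuous_intros
      continuous_on_product_coordinates)

lemma continuous_parts:
  "continuous_on UNIV (\<lambda>u. pos_part u x)" "continuous_on UNIV (\<lambda>u. neg_part u x)"
  unfolding pos_part_def neg_part_def
  by (intro continuous_intros continuous_on_product_coordinates)+

text \<open>The fibre estimate at \<open>s = 0\<close>.\<close>

lemma N_energy:
  assumes "u \<in> N" shows "Q u u \<le> 4 * J u"
  using nehari_fibre[OF assms, of 0] by (simp add: J_def qform_def Gp_0)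

lemma M_subset_N: "M \<subseteq> N"
proof
  fix u assume u: "u \<in> M"
  have "dJ u (\<lambda>x. pos_part u x + neg_part u x) = 0"
    using u by (simp only: dJ_add) (simp add: M_def)
  then have "dJ u u = 0" by (simp add: parts_simps)
  moreover have "u \<noteq> (\<lambda>_. 0)" using u by (auto simp: M_def pos_part_def)
  ultimately show "u \<in> N" using u by (auto simp: M_def N_def)
qed

text \<open>The condition of being nonzero is not closed by itself; on the constraint sets it is replaced
  by a uniform lower bound at some vertex.\<close>

lemma closed_N: "closed N"
proof -
  obtain \<delta> where \<delta>: "\<delta> > 0" "\<And>v. v \<in> H0 \<Omega> \<Longrightarrow> v \<noteq> (\<lambda>_. 0) \<Longrightarrow>
      Q v v \<le> (\<Sum>x\<in>\<Omega>. \<mu> x * (g (v x) * v x)) \<Longrightarrow> \<exists>x\<in>\<Omega>. \<bar>v x\<bar> \<ge> \<delta>"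
    using nehari_away_from_zero by blast
  have eq: "N = H0 \<Omega> \<inter> {u. \<exists>x\<in>\<Omega>. \<bar>u x\<bar> \<ge> \<delta>} \<inter> {u. dJ u u = 0}"
  proof (intro equalityI subsetI)
    fix u assume u: "u \<in> N"
    then have "Q u u + b * E u u * E u u = (\<Sum>x\<in>\<Omega>. \<mu> x * (g (u x) * u x))"
      by (simp add: N_def dJ_def)
    moreover have "b * E u u * E u u \<ge> 0" using b_nonneg by (simp add: mult.assoc)
    ultimately show "u \<in> H0 \<Omega> \<inter> {u. \<exists>x\<in>\<Omega>. \<bar>u x\<bar> \<ge> \<delta>} \<inter> {u. dJ u u = 0}"
      using \<delta>(2)[of u] u by (auto simp: N_def)
  qed (use \<delta>(1) in \<open>auto simp: N_def\<close>)
  have "closed {u. dJ u u = 0}"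
    by (intro closed_Collect_eq continuous_intros continuous_on_product_coordinates)
  then show ?thesis unfolding eq by (intro closed_Int closed_H0 closed_away)
qed

lemma closed_M: "closed M"
proof -
  obtain \<delta> where \<delta>: "\<delta> > 0" "\<And>v. v \<in> H0 \<Omega> \<Longrightarrow> v \<noteq> (\<lambda>_. 0) \<Longrightarrow>
      Q v v \<le> (\<Sum>x\<in>\<Omega>. \<mu> x * (g (v x) * v x)) \<Longrightarrow> \<exists>x\<in>\<Omega>. \<bar>v x\<bar> \<ge> \<delta>"
    using nehari_away_from_zero by blast
  have eq: "M = H0 \<Omega> \<inter> {u. \<exists>x\<in>\<Omega>. \<bar>pos_part u x\<bar> \<ge> \<delta>} \<inter> {u. \<exists>x\<in>\<Omega>. \<bar>neg_part u x\<bar> \<ge> \<delta>}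
      \<inter> {u. dJ u (pos_part u) = 0} \<inter> {u. dJ u (neg_part u) = 0}" (is "_ = ?R")
  proof (intro equalityI subsetI)
    fix u assume u: "u \<in> M"
    then have H: "u \<in> H0 \<Omega>" by (simp add: M_def)
    have "b * E u u * (E (pos_part u) (pos_part u) + E (pos_part u) (neg_part u)) \<ge> 0"
      "b * E u u * (E (neg_part u) (neg_part u) + E (pos_part u) (neg_part u)) \<ge> 0"
      using b_nonneg E_nonneg[OF H] E_nonneg[OF H0_parts(1)[OF H]] E_nonneg[OF H0_parts(2)[OF H]]
        E_parts[of u] by auto
    then have "Q (pos_part u) (pos_part u) \<le> (\<Sum>x\<in>\<Omega>. \<mu> x * (g (pos_part u x) * pos_part u x))"
      "Q (neg_part u) (neg_part u) \<le> (\<Sum>x\<in>\<Omega>. \<mu> x * (g (neg_part u x) * neg_part u x))"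
      using nodal_identities(1,2)[OF u] Q_parts[of u] by linarith+
    then show "u \<in> ?R"
      using \<delta>(2)[of "pos_part u"] \<delta>(2)[of "neg_part u"] u H0_parts[OF H] by (auto simp: M_def)
  qed (use \<delta>(1) in \<open>auto simp: M_def\<close>)
  have "closed {u. \<exists>x\<in>\<Omega>. \<bar>pos_part u x\<bar> \<ge> \<delta>}" "closed {u. \<exists>x\<in>\<Omega>. \<bar>neg_part u x\<bar> \<ge> \<delta>}"
    by (intro closed_Collect_bex finite_domain closed_Collect_le continuous_intros
        continuous_parts)+
  moreover have "closed {u. dJ u (pos_part u) = 0}" "closed {u. dJ u (neg_part u) = 0}"
    by (intro closed_Collect_eq continuous_intros continuous_on_product_coordinates
        continuous_parts)+
  ultimately show ?thesis unfolding eq by (intro closed_Int closed_H0)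
qed

text \<open>The bound of the energy from below by the quadratic form makes sublevel sets compact.\<close>

lemma minimizer_exists:
  assumes X: "closed X" "X \<subseteq> N" "X \<noteq> {}"
  shows "\<exists>u\<in>X. \<forall>v\<in>X. J u \<le> J v"
proof -
  obtain \<kappa> where \<kappa>: "\<kappa> > 0" "\<And>u. u \<in> H0 \<Omega> \<Longrightarrow> \<kappa> * (\<Sum>x\<in>\<Omega>. (u x)\<^sup>2) \<le> Q u u"
    using Q_coercive by auto
  obtain u0 where u0: "u0 \<in> X" using X by auto
  define K where "K = X \<inter> {u. J u \<le> J u0}"
  have "closed K" unfolding K_def
    using X(1) by (intro closed_Int closed_Collect_le continuous_intros
        continuous_on_product_coordinates)
  moreover have "K \<subseteq> H0 \<Omega>" using X(2) by (auto simp: K_def N_def)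
  moreover have "(\<Sum>x\<in>\<Omega>. (v x)\<^sup>2) \<le> 4 * J u0 / \<kappa>" if v: "v \<in> K" for v
  proof -
    have "v \<in> N" "J v \<le> J u0" using v X(2) by (auto simp: K_def)
    then have "\<kappa> * (\<Sum>x\<in>\<Omega>. (v x)\<^sup>2) \<le> 4 * J u0"
      using \<kappa>(2)[of v] N_energy[of v] by (simp add: N_def)
    then show ?thesis using \<kappa>(1) by (simp add: field_simps)
  qed
  ultimately have "compact K" by (rule compact_of_bounded_squares[OF finite_domain])
  moreover have "K \<noteq> {}" using u0 by (auto simp: K_def)
  moreover have "continuous_on K J"
    by (intro continuous_intros continuous_on_subset[OF continuous_on_product_coordinates]) auto
  ultimately have "\<exists>u\<in>K. \<forall>v\<in>K. J u \<le> J v" by (intro continuous_attains_inf)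
  then obtain u where u: "u \<in> K" "\<And>v. v \<in> K \<Longrightarrow> J u \<le> J v" by blast
  have "J u \<le> J v" if "v \<in> X" for v
    using u(1) u(2)[of v] that by (cases "J v \<le> J u0") (auto simp: K_def)
  then show ?thesis using u by (auto simp: K_def)
qed

section \<open>Projection onto the constraint sets\<close>

text \<open>Along a ray the functional starts increasing, because the quadratic term dominates near zero,
  and tends to minus infinity by the gap condition on the quartic coefficients.\<close>

lemma nehari_projection:
  assumes v: "v \<in> H0 \<Omega>" "v \<noteq> (\<lambda>_. 0)"
    and gap: "b * (E v v)\<^sup>2 < l * (\<Sum>x\<in>\<Omega>. \<mu> x * (v x) ^ 4)"
  shows "\<exists>s>0. (\<lambda>x. s * v x) \<in> N"
proof -
  define A where "A = (\<Sum>x\<in>\<Omega>. \<mu> x * (v x) ^ 4)"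
  have A: "A > 0" unfolding A_def by (rule sum_fourth_pos[OF v])
  define \<epsilon> where "\<epsilon> = (l * A - b * (E v v)\<^sup>2) / (2 * A)"
  have \<epsilon>: "\<epsilon> > 0" using gap A by (simp add: \<epsilon>_def A_def)
  define \<eta> where "\<eta> = ((l - \<epsilon>) * A - b * (E v v)\<^sup>2) / 4"
  have \<eta>: "\<eta> > 0" using gap A by (simp add: \<eta>_def \<epsilon>_def field_simps A_def)
  obtain C where C: "\<And>u. (\<Sum>x\<in>\<Omega>. \<mu> x * Gp (u x)) \<ge> (l - \<epsilon>) / 4 * (\<Sum>x\<in>\<Omega>. \<mu> x * (u x) ^ 4) - C"
    using sum_Gp_ge_quartic[OF \<epsilon>] by blast
  have up: "J (\<lambda>x. s * v x) \<le> Q v v / 2 * s\<^sup>2 - \<eta> * s ^ 4 + C" for s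
  proof -
    have "(\<Sum>x\<in>\<Omega>. \<mu> x * (s * v x) ^ 4) = s ^ 4 * A"
      by (simp add: A_def sum_distrib_left power_mult_distrib mult_ac)
    with C[of "\<lambda>x. s * v x"] show ?thesis
      by (simp add: J_scale \<eta>_def field_simps)
  qed
  obtain R where R: "R > 0" "\<And>s. s > R \<Longrightarrow> Q v v / 2 * s\<^sup>2 - \<eta> * s ^ 4 < - C"
    using quartic_below[OF \<eta>] by blast
  have "continuous_on {0..R + 1} (\<lambda>s. J (\<lambda>x. s * v x))" by (intro continuous_intros)
  then obtain s where s: "s \<in> {0..R + 1}"
      "\<And>t. t \<in> {0..R + 1} \<Longrightarrow> J (\<lambda>x. t * v x) \<le> J (\<lambda>x. s * v x)"
    using continuous_attains_sup[of "{0..R + 1}" "\<lambda>s. J (\<lambda>x. s * v x)"] R(1)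
    by (metis atLeastatMost_empty_iff compact_Icc add_nonneg_nonneg less_imp_le zero_le_one)
  have J0: "J (\<lambda>x. 0 * v x) = 0" by (simp add: J_def qform_def Gp_0)
  have "s \<le> R"
  proof (rule ccontr)
    assume "\<not> s \<le> R"
    then have "J (\<lambda>x. s * v x) < 0" using up[of s] R(2)[of s] by simp
    then show False using s(2)[of 0] J0 R(1) by simp
  qed
  obtain d where d: "d > 0" "\<And>s. 0 < s \<Longrightarrow> s < d \<Longrightarrow> (\<Sum>x\<in>\<Omega>. \<mu> x * Gp (s * v x)) < s\<^sup>2 * Q v v / 2"
    using sum_Gp_scale_small[OF v] by blast
  define s' where "s' = min (d / 2) R"
  have s': "0 < s'" "s' < d" "s' \<le> R" using d(1) R(1) by (auto simp: s'_def)
  have "b / 4 * s' ^ 4 * (E v v)\<^sup>2 \<ge> 0" using b_nonneg by simp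
  then have "J (\<lambda>x. s' * v x) > 0"
    using d(2)[OF s'(1,2)] unfolding J_scale by linarith
  then have "s \<noteq> 0" using s(2)[of s'] s' J0 by force
  then have "s > 0" using s(1) by auto
  have "dJ (\<lambda>x. 0 + s * v x) v = 0"
  proof (rule DERIV_local_max[OF DERIV_J_line])
    show "min s 1 > 0" using \<open>s > 0\<close> by simp
    show "\<forall>y. \<bar>s - y\<bar> < min s 1 \<longrightarrow> J (\<lambda>x. 0 + y * v x) \<le> J (\<lambda>x. 0 + s * v x)"
      using s(2) \<open>s \<le> R\<close> by (simp add: abs_less_iff)
  qed
  then have "dJ (\<lambda>x. s * v x) (\<lambda>x. s * v x) = 0" by (simp add: dJ_scale)
  then show ?thesis
    using \<open>s > 0\<close> v by (intro exI[of _ s]) (auto simp: N_def H0_scale fun_eq_iff)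
qed

text \<open>Switching on a small multiple of one part raises the functional, because the quadratic
  term dominates and the interaction terms have the right sign. Hence a maximum over the
  quadrant is not attained on its boundary.\<close>

lemma small_part_increases:
  assumes U: "U \<in> H0 \<Omega>" "U \<noteq> (\<lambda>_. 0)" and W: "W \<in> H0 \<Omega>"
    and disj: "\<And>x. U x = 0 \<or> W x = 0" and inter: "Q U W \<ge> 0" "E U W \<ge> 0" and "t \<ge> 0"
  shows "\<exists>d>0. \<forall>s. 0 < s \<and> s < d \<longrightarrow> J (\<lambda>x. 0 * U x + t * W x) < J (\<lambda>x. s * U x + t * W x)"
proof -
  obtain d where d: "d > 0" "\<And>s. 0 < s \<Longrightarrow> s < d \<Longrightarrow> (\<Sum>x\<in>\<Omega>. \<mu> x * Gp (s * U x)) < s\<^sup>2 * Q U U / 2"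
    using sum_Gp_scale_small[OF U] by blast
  have "J (\<lambda>x. 0 * U x + t * W x) < J (\<lambda>x. s * U x + t * W x)" if s: "0 < s" "s < d" for s
  proof -
    have "(t\<^sup>2 * E W W)\<^sup>2 \<le> (s\<^sup>2 * E U U + t\<^sup>2 * E W W + 2 * s * t * E U W)\<^sup>2"
      using E_nonneg[OF U(1)] E_nonneg[OF W] inter s \<open>t \<ge> 0\<close> by (intro power_mono) auto
    then have "b / 4 * (t\<^sup>2 * E W W)\<^sup>2
        \<le> b / 4 * (s\<^sup>2 * E U U + t\<^sup>2 * E W W + 2 * s * t * E U W)\<^sup>2"
      using b_nonneg by (intro mult_left_mono) auto
    moreover have "2 * s * t * Q U W \<ge> 0" using s \<open>t \<ge> 0\<close> inter by simp
    moreover have "J (\<lambda>x. 0 * U x + t * W x)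
        = t\<^sup>2 * Q W W / 2 + b / 4 * (t\<^sup>2 * E W W)\<^sup>2 - (\<Sum>x\<in>\<Omega>. \<mu> x * Gp (t * W x))"
      using J_comb[of U W 0 t] disj by (simp add: Gp_0)
    moreover have "s\<^sup>2 * Q U U > 0" using Q_pos[OF U] s by simp
    ultimately show ?thesis
      using d(2)[OF s] J_comb[of U W s t, OF disj] by argo
  qed
  then show ?thesis using d(1) by blast
qed

text \<open>Splitting the nonlocal term by the weighted Cauchy--Schwarz inequality, the two gap conditions
  make the functional tend to minus infinity on the quadrant spanned by the two parts. The critical
  point found there is an interior maximum.\<close>

lemma nodal_projection:
  assumes u: "u \<in> H0 \<Omega>" "pos_part u \<noteq> (\<lambda>_. 0)" "neg_part u \<noteq> (\<lambda>_. 0)"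
    and gap: "b * E u u * E u (pos_part u) < l * (\<Sum>x\<in>\<Omega>. \<mu> x * (pos_part u x) ^ 4)"
      "b * E u u * E u (neg_part u) < l * (\<Sum>x\<in>\<Omega>. \<mu> x * (neg_part u x) ^ 4)"
  shows "M \<noteq> {}"
proof -
  define U W where "U = pos_part u" and "W = neg_part u"
  have HU: "U \<in> H0 \<Omega>" "U \<noteq> (\<lambda>_. 0)" and HW: "W \<in> H0 \<Omega>" "W \<noteq> (\<lambda>_. 0)"
    using u by (auto simp: U_def W_def H0_parts)
  have disj: "U x = 0 \<or> W x = 0" "W x = 0 \<or> U x = 0"
    and sgn: "U x \<ge> 0" "W x \<le> 0" for x
    using parts_simps(2-4)[of u x] by (auto simp: U_def W_def)
  have inter: "Q U W \<ge> 0" "E U W \<ge> 0" "Q W U \<ge> 0" "E W U \<ge> 0"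
    using Q_parts[of u] E_parts[of u] Q_commute[of W U] E_commute[of W U]
    by (auto simp: U_def W_def)
  define p n c where "p = E U U" and "n = E W W" and "c = E U W"
  have pos: "p \<ge> 0" "n \<ge> 0" "c \<ge> 0" using E_nonneg[OF HU(1)] E_nonneg[OF HW(1)] inter
    by (auto simp: p_def n_def c_def)
  define T where "T = p + n + 2 * c"
  define A B where "A = (\<Sum>x\<in>\<Omega>. \<mu> x * (U x) ^ 4)" and "B = (\<Sum>x\<in>\<Omega>. \<mu> x * (W x) ^ 4)"
  have AB: "A > 0" "B > 0" unfolding A_def B_def by (rule sum_fourth_pos; fact HU HW)+
  have "u = (\<lambda>x. 1 * U x + 1 * W x)" by (simp add: U_def W_def parts_simps)
  then have "E u u = T" "E u U = p + c" "E u W = n + c"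
    using E_comb[of 1 U 1 W] E_commute[of W U]
    by (simp_all add: T_def p_def n_def c_def qform_linear)
  then have gap': "b * T * (p + c) < l * A" "b * T * (n + c) < l * B"
    using gap by (simp_all add: A_def B_def U_def W_def)
  define gp where "gp = min (l * A - b * T * (p + c)) (l * B - b * T * (n + c))"
  have gp: "gp > 0" using gap' by (simp add: gp_def)
  (* Half of the gap pays for replacing l by l - \<epsilon> in the quartic lower bound on the integral
     of Gp. *)
  define \<epsilon> where "\<epsilon> = gp / (2 * (A + B))"
  have \<epsilon>: "\<epsilon> > 0" "\<epsilon> * A \<le> gp / 2" "\<epsilon> * B \<le> gp / 2"
    using gp AB by (auto simp: \<epsilon>_def field_simps)
  define \<eta> where "\<eta> = gp / 8"
  have \<eta>: "\<eta> > 0" "4 * \<eta> \<le> (l - \<epsilon>) * A - b * T * (p + c)" "4 * \<eta> \<le> (l - \<epsilon>) * B - b * T * (n + c)"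
  proof -
    have "gp \<le> l * A - b * T * (p + c)" "gp \<le> l * B - b * T * (n + c)"
      by (simp_all add: gp_def)
    then show "4 * \<eta> \<le> (l - \<epsilon>) * A - b * T * (p + c)" "4 * \<eta> \<le> (l - \<epsilon>) * B - b * T * (n + c)"
      using \<epsilon> by (simp_all add: \<eta>_def left_diff_distrib)
  qed (use gp in \<open>simp add: \<eta>_def\<close>)
  obtain C where C: "\<And>u. (\<Sum>x\<in>\<Omega>. \<mu> x * Gp (u x)) \<ge> (l - \<epsilon>) / 4 * (\<Sum>x\<in>\<Omega>. \<mu> x * (u x) ^ 4) - C"
    using sum_Gp_ge_quartic[OF \<epsilon>(1)] by blast
  define k where "k = (Q U U + Q W W + 2 * Q U W) / 2"
  define F where "F = (\<lambda>q. J (\<lambda>x. fst q * U x + snd q * W x))"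
  have qpos: "Q U U > 0" "Q W W > 0" using Q_pos HU HW by auto
  have up: "F (s, t) \<le> (k * s\<^sup>2 - \<eta> * s ^ 4) + (k * t\<^sup>2 - \<eta> * t ^ 4) + 2 * C"
    if "s \<ge> 0" "t \<ge> 0" for s t
  proof -
    have "(\<Sum>x\<in>\<Omega>. \<mu> x * (s * U x) ^ 4) = s ^ 4 * A" "(\<Sum>x\<in>\<Omega>. \<mu> x * (t * W x) ^ 4) = t ^ 4 * B"
      by (simp_all add: A_def B_def sum_distrib_left power_mult_distrib mult_ac)
    then have G: "(\<Sum>x\<in>\<Omega>. \<mu> x * Gp (s * U x)) \<ge> (l - \<epsilon>) / 4 * (s ^ 4 * A) - C"
      "(\<Sum>x\<in>\<Omega>. \<mu> x * Gp (t * W x)) \<ge> (l - \<epsilon>) / 4 * (t ^ 4 * B) - C"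
      using C[of "\<lambda>x. s * U x"] C[of "\<lambda>x. t * W x"] by simp_all
    have quart: "b / 4 * (s\<^sup>2 * p + t\<^sup>2 * n + 2 * s * t * c)\<^sup>2
        \<le> b / 4 * (T * (s ^ 4 * (p + c) + t ^ 4 * (n + c)))"
      unfolding T_def by (intro mult_left_mono quartic_split) (use pos that b_nonneg in auto)
    have "s ^ 4 * (4 * \<eta>) \<le> s ^ 4 * ((l - \<epsilon>) * A - b * T * (p + c))"
      "t ^ 4 * (4 * \<eta>) \<le> t ^ 4 * ((l - \<epsilon>) * B - b * T * (n + c))"
      using \<eta> by (auto intro!: mult_left_mono)
    then have h: "b / 4 * (T * (s ^ 4 * (p + c) + t ^ 4 * (n + c)))
        - (l - \<epsilon>) / 4 * (s ^ 4 * A) - (l - \<epsilon>) / 4 * (t ^ 4 * B) \<le> - \<eta> * s ^ 4 - \<eta> * t ^ 4"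
      by (simp add: field_simps)
    have "2 * s * t \<le> s\<^sup>2 + t\<^sup>2" by (rule sum_squares_bound)
    then have "2 * s * t * Q U W \<le> (s\<^sup>2 + t\<^sup>2) * Q U W" using inter by (intro mult_right_mono) auto
    moreover have "s\<^sup>2 * Q W W \<ge> 0" "t\<^sup>2 * Q U U \<ge> 0" "(s\<^sup>2 + t\<^sup>2) * Q U W \<ge> 0" using qpos inter by auto
    ultimately have q: "(s\<^sup>2 * Q U U + t\<^sup>2 * Q W W + 2 * s * t * Q U W) / 2 \<le> k * s\<^sup>2 + k * t\<^sup>2"
      by (simp add: k_def field_simps)
    have "F (s, t) = (s\<^sup>2 * Q U U + t\<^sup>2 * Q W W + 2 * s * t * Q U W) / 2
      + b / 4 * (s\<^sup>2 * p + t\<^sup>2 * n + 2 * s * t * c)\<^sup>2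
      - (\<Sum>x\<in>\<Omega>. \<mu> x * Gp (s * U x)) - (\<Sum>x\<in>\<Omega>. \<mu> x * Gp (t * W x))"
      using J_comb[OF disj(1), where s=s and t=t] by (simp add: F_def p_def n_def c_def)
    then show ?thesis using G quart h q by linarith
  qed
  obtain R where R: "R > 0" "\<And>s. s > R \<Longrightarrow> k * s\<^sup>2 - \<eta> * s ^ 4 < - (k\<^sup>2 / (4 * \<eta>) + 2 * C)"
    using quartic_below[OF \<eta>(1)] by blast
  have far: "F (s, t) < 0" if "s \<ge> 0" "t \<ge> 0" "s > R \<or> t > R" for s t
    using up[OF that(1,2)] R(2)[of s] R(2)[of t] that(3)
      quartic_bounded[OF \<eta>(1), of k s] quartic_bounded[OF \<eta>(1), of k t] by force
  have "continuous_on ({0..R + 1} \<times> {0..R + 1}) F" unfolding F_def by (intro continuous_intros)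
  then have "\<exists>q\<in>{0..R + 1} \<times> {0..R + 1}. \<forall>q'\<in>{0..R + 1} \<times> {0..R + 1}. F q' \<le> F q"
    using R(1) by (intro continuous_attains_sup compact_Times) auto
  then obtain s t where st: "s \<in> {0..R + 1}" "t \<in> {0..R + 1}"
      and mx: "\<And>s' t'. s' \<in> {0..R + 1} \<Longrightarrow> t' \<in> {0..R + 1} \<Longrightarrow> F (s', t') \<le> F (s, t)"
    by (metis (no_types, lifting) SigmaE2 SigmaI surj_pair)
  have F0: "F (0, 0) = 0" by (simp add: F_def J_def qform_def Gp_0)
  have le: "s \<le> R" "t \<le> R" using far[of s t] mx[of 0 0] F0 st R(1) by force+
  have "s \<noteq> 0"
  proof
    assume [simp]: "s = 0"
    obtain d where d: "d > 0" "\<And>s. 0 < s \<Longrightarrow> s < d \<Longrightarrow> F (0, t) < F (s, t)"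
      using small_part_increases[OF HU HW(1) disj(1) inter(1,2), of t] st by (auto simp: F_def)
    have "0 < min (d / 2) R" "min (d / 2) R < d" "min (d / 2) R \<le> R + 1"
      using d(1) R(1) by auto
    then show False
      using d(2)[of "min (d / 2) R"] mx[of "min (d / 2) R" t] st R(1) by (simp del: min_less_iff_conj)
  qed
  moreover have "t \<noteq> 0"
  proof
    assume [simp]: "t = 0"
    obtain d where d: "d > 0" "\<And>t. 0 < t \<Longrightarrow> t < d \<Longrightarrow> F (s, 0) < F (s, t)"
      using small_part_increases[OF HW HU(1) disj(2) inter(3,4), of s] st
      by (auto simp: F_def add.commute)
    have "0 < min (d / 2) R" "min (d / 2) R < d" "min (d / 2) R \<le> R + 1"
      using d(1) R(1) by auto
    then show False
      using d(2)[of "min (d / 2) R"] mx[of s "min (d / 2) R"] st R(1) by (simp del: min_less_iff_conj)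
  qed
  ultimately have st0: "s > 0" "t > 0" using st by auto
  define z where "z = (\<lambda>x. s * U x + t * W x)"
  have "dJ (\<lambda>x. t * W x + s * U x) U = 0"
  proof (rule DERIV_local_max[OF DERIV_J_line])
    show "min s 1 > 0" using st0 by simp
    show "\<forall>y. \<bar>s - y\<bar> < min s 1 \<longrightarrow> J (\<lambda>x. t * W x + y * U x) \<le> J (\<lambda>x. t * W x + s * U x)"
      using mx[of _ t] le st by (simp add: F_def add.commute abs_less_iff)
  qed
  then have "dJ z (\<lambda>x. s * U x) = 0" by (simp add: dJ_scale z_def add.commute)
  moreover have "dJ (\<lambda>x. s * U x + t * W x) W = 0"
  proof (rule DERIV_local_max[OF DERIV_J_line])
    show "min t 1 > 0" using st0 by simp
    show "\<forall>y. \<bar>t - y\<bar> < min t 1 \<longrightarrow> J (\<lambda>x. s * U x + y * W x) \<le> J (\<lambda>x. s * U x + t * W x)"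
      using mx[of s] le st by (simp add: F_def abs_less_iff)
  qed
  then have "dJ z (\<lambda>x. t * W x) = 0" by (simp add: dJ_scale z_def)
  moreover have "pos_part z = (\<lambda>x. s * U x)" "neg_part z = (\<lambda>x. t * W x)"
    unfolding z_def using st0 sgn disj by (intro parts_unique; simp add: mult_nonneg_nonpos)+
  moreover have "z \<in> H0 \<Omega>" unfolding z_def using HU HW by (intro H0_comb)
  moreover have "(\<lambda>x. s * U x) \<noteq> (\<lambda>_. 0)" "(\<lambda>x. t * W x) \<noteq> (\<lambda>_. 0)"
    using HU HW st0 by (auto simp: fun_eq_iff)
  ultimately have "z \<in> M" by (simp add: M_def)
  then show ?thesis by blast
qed

section \<open>Minimizers are critical points\<close>

text \<open>The perturbation changes the first summand, the second one, or both, according to the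
  weights \<open>\<alpha>\<close> and \<open>\<beta>\<close>; the increment is scaled together with the summand it belongs to.\<close>

definition perturbed ::
    "('v \<Rightarrow> real) \<Rightarrow> ('v \<Rightarrow> real) \<Rightarrow> 'v \<Rightarrow> real \<Rightarrow> real \<Rightarrow> real \<Rightarrow> real \<times> real \<Rightarrow> 'v \<Rightarrow> real" where
  "perturbed U W x \<alpha> \<beta> \<epsilon> q = (\<lambda>y. fst q * U y + snd q * W y
      + \<epsilon> * ((\<alpha> * fst q + \<beta> * snd q) * unit_at x y))"

text \<open>A small step against a nonzero coordinate derivative lowers the functional on the whole
  parameter set \<open>S\<close>, so all new values lie below \<open>J u\<close>. On \<open>T\<close>, which plays the part of the boundary
  of \<open>S\<close>, they stay below a bound that was already less than \<open>J u\<close>; at the centre \<open>(1, 1)\<close> the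
  loss tends to zero with the step. Hence the new maximum is attained off \<open>T\<close>. The sets are kept
  general because \<open>S\<close> is a square for the nodal set and a segment for the Nehari set.\<close>

lemma perturbed_max:
  assumes x: "x \<in> \<Omega>" and u: "u = (\<lambda>y. U y + W y)" and D: "dJ u (unit_at x) \<noteq> 0"
    and ab: "\<alpha> \<ge> 0" "\<beta> \<ge> 0" "\<alpha> + \<beta> = 1"
  shows "\<exists>r>0. r < 1 \<and> (\<forall>S T \<epsilon>0. compact S \<and> compact T \<and> T \<subseteq> S \<and> (1, 1) \<in> S - T
      \<and> S \<subseteq> {1 - r..1 + r} \<times> {1 - r..1 + r}
      \<and> (\<forall>q\<in>S. J (perturbed U W x \<alpha> \<beta> 0 q) \<le> J u) \<and> (\<forall>q\<in>T. J (perturbed U W x \<alpha> \<beta> 0 q) < J u)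
      \<and> \<epsilon>0 > 0
    \<longrightarrow> (\<exists>\<epsilon> q. \<bar>\<epsilon>\<bar> < \<epsilon>0 \<and> \<epsilon> * dJ u (unit_at x) < 0 \<and> q \<in> S - T
        \<and> J (perturbed U W x \<alpha> \<beta> \<epsilon> q) < J u
        \<and> (\<forall>q'\<in>S. J (perturbed U W x \<alpha> \<beta> \<epsilon> q') \<le> J (perturbed U W x \<alpha> \<beta> \<epsilon> q))))"
proof -
  define D where "D = dJ u (unit_at x)"
  have D0: "D \<noteq> 0" using D by (simp add: D_def)
  define z where "z = perturbed U W x \<alpha> \<beta>"
  have z0: "z 0 (1, 1) = u" by (simp add: z_def perturbed_def u)
  have cont: "continuous_on UNIV (\<lambda>p. dJ (z (fst p) (snd p)) (unit_at x) * D)"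
    unfolding z_def perturbed_def by (intro continuous_intros)
  have "open {p. 0 < dJ (z (fst p) (snd p)) (unit_at x) * D}"
    by (intro open_Collect_less cont continuous_intros)
  moreover have "(0, 1, 1) \<in> {p. 0 < dJ (z (fst p) (snd p)) (unit_at x) * D}"
    using D0 by (auto simp: z0 D_def[symmetric] zero_less_mult_iff linorder_neq_iff)
  ultimately obtain e where e: "e > 0"
    "\<And>p. dist p (0, 1, 1) < e \<Longrightarrow> 0 < dJ (z (fst p) (snd p)) (unit_at x) * D"
    unfolding open_dist by blast
  define r where "r = min (1 / 2) (e / 4)"
  have r: "r > 0" "r < 1" "4 * r \<le> e" using e(1) by (auto simp: r_def)
  have pos: "0 < dJ (z \<epsilon> q) (unit_at x) * D"
    if "\<bar>\<epsilon>\<bar> \<le> r" "q \<in> {1 - r..1 + r} \<times> {1 - r..1 + r}" for \<epsilon> q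
  proof -
    have "dist (\<epsilon>, q) (0, 1, 1) \<le> dist \<epsilon> 0 + dist q (1, 1)"
      unfolding dist_Pair_Pair by (rule sqrt_sum_squares_le_sum) auto
    also have "dist q (1, 1) \<le> dist (fst q) 1 + dist (snd q) 1"
      by (cases q) (auto simp: dist_Pair_Pair intro: sqrt_sum_squares_le_sum)
    also have "dist \<epsilon> 0 + (dist (fst q) 1 + dist (snd q) 1) \<le> r + (r + r)"
      using that by (intro add_mono) (auto simp: dist_real_def abs_le_iff)
    also have "\<dots> < e" using r by simp
    finally show ?thesis using e(2)[of "(\<epsilon>, q)"] by simp
  qed
  have main: "\<exists>\<epsilon> q. \<bar>\<epsilon>\<bar> < \<epsilon>0 \<and> \<epsilon> * D < 0 \<and> q \<in> S - T \<and> J (z \<epsilon> q) < J u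
        \<and> (\<forall>q'\<in>S. J (z \<epsilon> q') \<le> J (z \<epsilon> q))"
    if A: "compact S \<and> compact T \<and> T \<subseteq> S \<and> (1, 1) \<in> S - T
      \<and> S \<subseteq> {1 - r..1 + r} \<times> {1 - r..1 + r}
      \<and> (\<forall>q\<in>S. J (z 0 q) \<le> J u) \<and> (\<forall>q\<in>T. J (z 0 q) < J u) \<and> \<epsilon>0 > 0"
    for S T and \<epsilon>0 :: real
  proof -
    (* Stepping by - D * h lowers J whatever the sign of D. *)
    have descent: "J (z (- D * h) q) < J (z 0 q)" if h: "0 < h" "\<bar>D * h\<bar> \<le> r" and q: "q \<in> S" for h q
    proof -
      define k where "k = \<alpha> * fst q + \<beta> * snd q"
      have "fst q \<ge> 1 - r" "snd q \<ge> 1 - r" using A q by auto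
      then have "\<alpha> * (1 - r) + \<beta> * (1 - r) \<le> k"
        unfolding k_def using ab by (intro add_mono mult_left_mono) auto
      then have "1 - r \<le> k" using ab(3) by (metis distrib_right mult_1)
      then have k: "k > 0" using r by linarith
      define w where "w = (\<lambda>y. (- D * k) * unit_at x y)"
      have zw: "(\<lambda>y. z 0 q y + h' * w y) = z (- D * h') q" for h'
        by (simp add: z_def perturbed_def w_def k_def algebra_simps)
      have "J (\<lambda>y. z 0 q y + h * w y) < J (\<lambda>y. z 0 q y + 0 * w y)"
      proof (rule DERIV_neg_imp_decreasing[where f="\<lambda>h. J (\<lambda>y. z 0 q y + h * w y)"])
        fix h' assume h': "0 \<le> h'" "h' \<le> h"
        have "\<bar>D * h'\<bar> \<le> \<bar>D * h\<bar>" using h' by (simp add: abs_mult mult_left_mono)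
        then have "0 < dJ (z (- D * h') q) (unit_at x) * D"
          using h(2) A q by (intro pos) auto
        then have "0 < k * (dJ (z (- D * h') q) (unit_at x) * D)" using k by simp
        moreover have "dJ (z (- D * h') q) w = (- D * k) * dJ (z (- D * h') q) (unit_at x)"
          unfolding w_def by (rule dJ_scale)
        ultimately have "dJ (\<lambda>y. z 0 q y + h' * w y) w < 0"
          unfolding zw by (simp add: algebra_simps)
        then show "\<exists>y. ((\<lambda>h. J (\<lambda>y. z 0 q y + h * w y)) has_real_derivative y) (at h') \<and> y < 0"
          using DERIV_J_line by blast
      qed (use h in auto)
      then show ?thesis by (simp only: zw) simp
    qed
    obtain \<eta> where \<eta>: "\<eta> < J u" "\<And>q. q \<in> T \<Longrightarrow> J (z 0 q) \<le> \<eta>"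
    proof (cases "T = {}")
      case True
      then show ?thesis using that[of "J u - 1"] by simp
    next
      case False
      have "continuous_on T (\<lambda>q. J (z 0 q))"
        unfolding z_def perturbed_def by (intro continuous_intros)
      then have "\<exists>q\<in>T. \<forall>q'\<in>T. J (z 0 q') \<le> J (z 0 q)"
        using A False by (intro continuous_attains_sup) auto
      then obtain q where "q \<in> T" "\<forall>q'\<in>T. J (z 0 q') \<le> J (z 0 q)" by blast
      then show ?thesis using that[of "J (z 0 q)"] A by auto
    qed
    have "continuous_on UNIV (\<lambda>h. J (z (- D * h) (1, 1)))"
      unfolding z_def perturbed_def by (intro continuous_intros)
    then have "open {h. \<eta> < J (z (- D * h) (1, 1))}"
      by (intro open_Collect_less continuous_on_const)
    moreover have "0 \<in> {h. \<eta> < J (z (- D * h) (1, 1))}" using \<eta>(1) by (simp add: z0)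
    ultimately obtain h0 where h0: "h0 > 0" "\<And>h. dist h 0 < h0 \<Longrightarrow> \<eta> < J (z (- D * h) (1, 1))"
      unfolding open_dist by blast
    define m where "m = min r (\<epsilon>0 / 2)"
    define h where "h = min (h0 / 2) (m / \<bar>D\<bar>)"
    have m: "m > 0" "m \<le> r" "m < \<epsilon>0" using r(1) A by (auto simp: m_def)
    have h: "0 < h" "h < h0" "\<bar>D * h\<bar> \<le> m"
      using h0(1) m(1) D0 by (auto simp: h_def abs_mult min_def field_simps)
    have "continuous_on S (\<lambda>q. J (z (- D * h) q))"
      unfolding z_def perturbed_def by (intro continuous_intros)
    then have "\<exists>q\<in>S. \<forall>q'\<in>S. J (z (- D * h) q') \<le> J (z (- D * h) q)"
      using A by (intro continuous_attains_sup) auto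
    then obtain q where q: "q \<in> S" "\<And>q'. q' \<in> S \<Longrightarrow> J (z (- D * h) q') \<le> J (z (- D * h) q)"
      by blast
    have desc: "J (z (- D * h) q) < J (z 0 q)" using h m q(1) by (intro descent) auto
    have "\<eta> < J (z (- D * h) (1, 1))" using h0(2)[of h] h by (simp add: dist_real_def)
    also have "\<dots> \<le> J (z (- D * h) q)" using q(2) A by blast
    finally have "q \<notin> T" using \<eta>(2)[of q] desc by auto
    moreover have "J (z (- D * h) q) < J u" using desc A q(1) by force
    moreover have "\<bar>- D * h\<bar> < \<epsilon>0" using h m by simp
    moreover have "(- D * h) * D < 0" using h(1) D0
      by (auto simp: mult_less_0_iff zero_less_mult_iff linorder_neq_iff)
    ultimately show ?thesis using q by blast
  qed
  show ?thesis
    by (rule exI[of _ r], intro conjI allI impI, rule r(1), rule r(2),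
        rule main[unfolded z_def D_def])
qed

lemma H0_unit: "x \<in> \<Omega> \<Longrightarrow> unit_at x \<in> H0 \<Omega>"
  by (auto simp: H0_def unit_at_def)

text \<open>Here only the common scaling of the function varies: the second summand is zero and \<open>S\<close> is
  a segment with end points \<open>T\<close>.\<close>

lemma nehari_minimizer_critical:
  assumes u: "u \<in> N" and min: "\<And>v. v \<in> N \<Longrightarrow> J u \<le> J v" and x: "x \<in> \<Omega>"
  shows "dJ u (unit_at x) = 0"
proof (rule ccontr)
  assume D: "dJ u (unit_at x) \<noteq> 0"
  have H: "u \<in> H0 \<Omega>" "u \<noteq> (\<lambda>_. 0)" using u by (auto simp: N_def)
  define W :: "'v \<Rightarrow> real" where "W = (\<lambda>_. 0)"
  define z where "z = perturbed u W x 1 0"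
  have z: "z \<epsilon> (s, t) = (\<lambda>y. s * (u y + \<epsilon> * unit_at x y))" for \<epsilon> s t
    by (simp add: z_def perturbed_def W_def algebra_simps)
  obtain r where r: "0 < r" "r < 1" and R: "\<And>S T \<epsilon>0. compact S \<Longrightarrow> compact T \<Longrightarrow> T \<subseteq> S \<Longrightarrow>
      (1, 1) \<in> S - T \<Longrightarrow> S \<subseteq> {1 - r..1 + r} \<times> {1 - r..1 + r} \<Longrightarrow> (\<forall>q\<in>S. J (z 0 q) \<le> J u) \<Longrightarrow>
      (\<forall>q\<in>T. J (z 0 q) < J u) \<Longrightarrow> \<epsilon>0 > 0 \<Longrightarrow>
      (\<exists>\<epsilon> q. \<bar>\<epsilon>\<bar> < \<epsilon>0 \<and> \<epsilon> * dJ u (unit_at x) < 0 \<and> q \<in> S - T \<and> J (z \<epsilon> q) < J u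
        \<and> (\<forall>q'\<in>S. J (z \<epsilon> q') \<le> J (z \<epsilon> q)))"
    using perturbed_max[OF x _ D, of u W 1 0] unfolding z_def[symmetric] by (auto simp: W_def)
  define S T where "S = {1 - r..1 + r} \<times> {1::real}" and "T = {(1 - r, 1), (1 + r, 1::real)}"
  (* A step below \<bar>u x\<bar> cannot turn a nonzero value into zero. *)
  define \<epsilon>0 where "\<epsilon>0 = (if u x = 0 then 1 else \<bar>u x\<bar>)"
  have Qu: "Q u u > 0" using Q_pos[OF H] .
  have le: "J (z 0 (s, t)) \<le> J u - Q u u * (s\<^sup>2 - 1)\<^sup>2 / 4" if "s \<ge> 0" for s t
    using nehari_fibre[OF u that] by (simp add: z)
  have lt: "J (z 0 (s, t)) < J u" if "s \<ge> 0" "s \<noteq> 1" for s t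
  proof -
    have "s\<^sup>2 \<noteq> 1" using that by (auto simp: power2_eq_1_iff)
    then have "Q u u * (s\<^sup>2 - 1)\<^sup>2 / 4 > 0" using Qu by simp
    then show ?thesis using le[OF that(1), of t] by linarith
  qed
  have "\<exists>\<epsilon> q. \<bar>\<epsilon>\<bar> < \<epsilon>0 \<and> \<epsilon> * dJ u (unit_at x) < 0 \<and> q \<in> S - T \<and> J (z \<epsilon> q) < J u
        \<and> (\<forall>q'\<in>S. J (z \<epsilon> q') \<le> J (z \<epsilon> q))"
  proof (rule R)
    show "\<forall>q\<in>S. J (z 0 q) \<le> J u"
    proof
      fix q assume "q \<in> S"
      then obtain s where s: "q = (s, 1)" "s \<ge> 0" using r by (auto simp: S_def)
      have "Q u u * (s\<^sup>2 - 1)\<^sup>2 / 4 \<ge> 0" using Qu by simp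
      then show "J (z 0 q) \<le> J u" using le[OF s(2), of 1] s(1) by simp
    qed
    show "\<forall>q\<in>T. J (z 0 q) < J u" using r lt by (auto simp: T_def)
  qed (use r in \<open>auto simp: S_def T_def \<epsilon>0_def compact_Times\<close>)
  then obtain \<epsilon> q where e: "\<bar>\<epsilon>\<bar> < \<epsilon>0" "J (z \<epsilon> q) < J u"
      and q: "q \<in> S - T" "\<And>q'. q' \<in> S \<Longrightarrow> J (z \<epsilon> q') \<le> J (z \<epsilon> q)"
    by blast
  from q(1) obtain s where qs: "q = (s, 1)" and s: "1 - r < s" "s < 1 + r"
    by (cases q) (auto simp: S_def T_def)
  note e = e[unfolded qs]
  have mx: "J (z \<epsilon> (s', 1)) \<le> J (z \<epsilon> (s, 1))" if "1 - r \<le> s'" "s' \<le> 1 + r" for s'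
    using q(2)[of "(s', 1)"] that by (simp add: qs S_def)
  define v where "v = (\<lambda>y. u y + \<epsilon> * unit_at x y)"
  have s0: "s > 0" using s r by simp
  have "dJ (\<lambda>y. 0 + s * v y) v = 0"
  proof (rule DERIV_local_max[OF DERIV_J_line])
    show "min (1 + r - s) (s - (1 - r)) > 0" using s by simp
    show "\<forall>y. \<bar>s - y\<bar> < min (1 + r - s) (s - (1 - r)) \<longrightarrow>
        J (\<lambda>x. 0 + y * v x) \<le> J (\<lambda>x. 0 + s * v x)"
      using mx by (simp add: z v_def abs_less_iff)
  qed
  then have "dJ (z \<epsilon> (s, 1)) (z \<epsilon> (s, 1)) = 0"
    using dJ_scale[of "z \<epsilon> (s, 1)" s v] by (simp add: z v_def)
  moreover have "z \<epsilon> (s, 1) \<in> H0 \<Omega>"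
    using H(1) H0_unit[OF x] by (auto simp: z H0_def)
  moreover have "z \<epsilon> (s, 1) \<noteq> (\<lambda>_. 0)"
  proof (cases "u x = 0")
    case True
    obtain y where "u y \<noteq> 0" using H(2) by auto
    then have "z \<epsilon> (s, 1) y \<noteq> 0" using True s0 by (auto simp: z unit_at_def)
    then show ?thesis by auto
  next
    case False
    then have "z \<epsilon> (s, 1) x \<noteq> 0" using e(1) s0 by (auto simp: z unit_at_def \<epsilon>0_def)
    then show ?thesis by auto
  qed
  ultimately have "z \<epsilon> (s, 1) \<in> N" by (simp add: N_def)
  from min[OF this] show False using e(2) by simp
qed

text \<open>For a small step the two summands remain the positive and the negative part of their sum,
  so a point of the square where both partial derivatives vanish lies in the nodal set.\<close>

lemma nodal_minimizer_critical:
  assumes u: "u \<in> M" and min: "\<And>v. v \<in> M \<Longrightarrow> J u \<le> J v" and x: "x \<in> \<Omega>"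
  shows "dJ u (unit_at x) = 0"
proof (rule ccontr)
  assume D: "dJ u (unit_at x) \<noteq> 0"
  define U W where "U = pos_part u" and "W = neg_part u"
  have H: "u \<in> H0 \<Omega>" "U \<in> H0 \<Omega>" "W \<in> H0 \<Omega>" "U \<noteq> (\<lambda>_. 0)" "W \<noteq> (\<lambda>_. 0)"
    using u by (auto simp: M_def U_def W_def H0_parts)
  have uUW: "u = (\<lambda>y. U y + W y)" by (simp add: U_def W_def parts_simps)
  have UW: "U y = max (u y) 0" "W y = min (u y) 0" for y
    by (auto simp: U_def W_def pos_part_def neg_part_def)
  (* A vanishing value is moved into the part whose sign agrees with the descent direction. *)
  define \<alpha> :: real where "\<alpha> = (if u x > 0 \<or> u x = 0 \<and> dJ u (unit_at x) < 0 then 1 else 0)"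
  define \<beta> where "\<beta> = 1 - \<alpha>"
  have ab: "\<alpha> \<ge> 0" "\<beta> \<ge> 0" "\<alpha> + \<beta> = 1" by (auto simp: \<alpha>_def \<beta>_def)
  define z where "z = perturbed U W x \<alpha> \<beta>"
  define Ue where "Ue \<epsilon> = (\<lambda>y. U y + \<epsilon> * \<alpha> * unit_at x y)" for \<epsilon>
  define We where "We \<epsilon> = (\<lambda>y. W y + \<epsilon> * \<beta> * unit_at x y)" for \<epsilon>
  have z: "z \<epsilon> (s, t) = (\<lambda>y. s * Ue \<epsilon> y + t * We \<epsilon> y)" for \<epsilon> s t
    by (simp add: z_def perturbed_def Ue_def We_def algebra_simps)
  obtain r where r: "0 < r" "r < 1" and R: "\<And>S T \<epsilon>0. compact S \<Longrightarrow> compact T \<Longrightarrow> T \<subseteq> S \<Longrightarrow>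
      (1, 1) \<in> S - T \<Longrightarrow> S \<subseteq> {1 - r..1 + r} \<times> {1 - r..1 + r} \<Longrightarrow> (\<forall>q\<in>S. J (z 0 q) \<le> J u) \<Longrightarrow>
      (\<forall>q\<in>T. J (z 0 q) < J u) \<Longrightarrow> \<epsilon>0 > 0 \<Longrightarrow>
      (\<exists>\<epsilon> q. \<bar>\<epsilon>\<bar> < \<epsilon>0 \<and> \<epsilon> * dJ u (unit_at x) < 0 \<and> q \<in> S - T \<and> J (z \<epsilon> q) < J u
        \<and> (\<forall>q'\<in>S. J (z \<epsilon> q') \<le> J (z \<epsilon> q)))"
    using perturbed_max[OF x uUW D ab] unfolding z_def[symmetric] by auto
  define S where "S = {1 - r..1 + r} \<times> {1 - r..1 + r}"
  (* T is the boundary of the square S. *)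
  define T where "T = {1 - r, 1 + r} \<times> {1 - r..1 + r} \<union> {1 - r..1 + r} \<times> {1 - r, 1 + r}"
  (* A step below \<bar>u x\<bar> keeps the sign of a nonzero value. *)
  define \<epsilon>0 where "\<epsilon>0 = (if u x = 0 then 1 else \<bar>u x\<bar>)"
  have Qp: "Q U U > 0" "Q W W > 0" using Q_pos H by auto
  have le: "J (z 0 (s, t)) \<le> J u - Q U U * (s\<^sup>2 - 1)\<^sup>2 / 4 - Q W W * (t\<^sup>2 - 1)\<^sup>2 / 4"
    if "s \<ge> 0" "t \<ge> 0" for s t
    using nodal_fibre[OF u that] by (simp add: z Ue_def We_def U_def W_def)
  have nonneg: "Q U U * (s\<^sup>2 - 1)\<^sup>2 / 4 \<ge> 0" "Q W W * (t\<^sup>2 - 1)\<^sup>2 / 4 \<ge> 0" for s t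
    using Qp by simp_all
  have lt: "J (z 0 (s, t)) < J u" if "s \<ge> 0" "t \<ge> 0" "s \<noteq> 1 \<or> t \<noteq> 1" for s t
  proof -
    have "s\<^sup>2 \<noteq> 1 \<or> t\<^sup>2 \<noteq> 1" using that by (auto simp: power2_eq_1_iff)
    then have "Q U U * (s\<^sup>2 - 1)\<^sup>2 / 4 > 0 \<or> Q W W * (t\<^sup>2 - 1)\<^sup>2 / 4 > 0" using Qp by auto
    then show ?thesis using le[OF that(1,2)] nonneg(1)[of s] nonneg(2)[of t] by linarith
  qed
  have "\<exists>\<epsilon> q. \<bar>\<epsilon>\<bar> < \<epsilon>0 \<and> \<epsilon> * dJ u (unit_at x) < 0 \<and> q \<in> S - T \<and> J (z \<epsilon> q) < J u
        \<and> (\<forall>q'\<in>S. J (z \<epsilon> q') \<le> J (z \<epsilon> q))"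
  proof (rule R)
    show "\<forall>q\<in>S. J (z 0 q) \<le> J u"
    proof
      fix q assume "q \<in> S"
      then obtain s t where s: "q = (s, t)" "s \<ge> 0" "t \<ge> 0" using r by (auto simp: S_def)
      then show "J (z 0 q) \<le> J u"
        using le[OF s(2,3)] nonneg(1)[of s] nonneg(2)[of t] by simp
    qed
    show "\<forall>q\<in>T. J (z 0 q) < J u" using r lt by (auto simp: T_def)
    show "compact T" unfolding T_def by (intro compact_Un compact_Times) auto
  qed (use r in \<open>auto simp: S_def T_def \<epsilon>0_def compact_Times\<close>)
  then obtain \<epsilon> q where e: "\<bar>\<epsilon>\<bar> < \<epsilon>0" "\<epsilon> * dJ u (unit_at x) < 0" "J (z \<epsilon> q) < J u"
      and q: "q \<in> S - T" "\<And>q'. q' \<in> S \<Longrightarrow> J (z \<epsilon> q') \<le> J (z \<epsilon> q)"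
    by blast
  from q(1) obtain s t where qs: "q = (s, t)" and st: "1 - r < s" "s < 1 + r" "1 - r < t" "t < 1 + r"
    by (cases q) (force simp: S_def T_def)
  note e = e[unfolded qs]
  have mx: "J (z \<epsilon> (s', t')) \<le> J (z \<epsilon> (s, t))"
    if "1 - r \<le> s'" "s' \<le> 1 + r" "1 - r \<le> t'" "t' \<le> 1 + r" for s' t'
    using q(2)[of "(s', t')"] that by (simp add: qs S_def)
  have st0: "s > 0" "t > 0" using st r by auto
  have off: "Ue \<epsilon> y = U y" "We \<epsilon> y = W y" if "y \<noteq> x" for y
    using that by (auto simp: Ue_def We_def unit_at_def)
  have at: "Ue \<epsilon> x > 0 \<and> We \<epsilon> x = 0 \<and> W x = 0 \<or> Ue \<epsilon> x = 0 \<and> We \<epsilon> x < 0 \<and> U x = 0"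
  proof (cases "u x > 0 \<or> u x = 0 \<and> dJ u (unit_at x) < 0")
    case True
    then have "U x + \<epsilon> > 0"
      using e(1,2) by (auto simp: UW \<epsilon>0_def mult_less_0_iff)
    with True show ?thesis by (auto simp: Ue_def We_def \<alpha>_def \<beta>_def unit_at_def UW)
  next
    case False
    then have "W x + \<epsilon> < 0" "U x = 0"
      using e(1,2) D by (auto simp: UW \<epsilon>0_def mult_less_0_iff split: if_splits)
    with False show ?thesis by (auto simp: Ue_def We_def \<alpha>_def \<beta>_def unit_at_def)
  qed
  have sgn: "Ue \<epsilon> y \<ge> 0" "We \<epsilon> y \<le> 0" "Ue \<epsilon> y = 0 \<or> We \<epsilon> y = 0" for y
    using at off[of y] by (cases "y = x"; auto simp: UW)+
  have nz: "Ue \<epsilon> \<noteq> (\<lambda>_. 0)" "We \<epsilon> \<noteq> (\<lambda>_. 0)"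
  proof -
    obtain y1 y2 where y: "U y1 \<noteq> 0" "W y2 \<noteq> 0" using H(4,5) by (auto simp: fun_eq_iff)
    have "Ue \<epsilon> y1 \<noteq> 0 \<or> Ue \<epsilon> x \<noteq> 0" "We \<epsilon> y2 \<noteq> 0 \<or> We \<epsilon> x \<noteq> 0"
      using y at off[of y1] off[of y2] by (cases "y1 = x"; cases "y2 = x"; auto)+
    then show "Ue \<epsilon> \<noteq> (\<lambda>_. 0)" "We \<epsilon> \<noteq> (\<lambda>_. 0)" by (auto simp: fun_eq_iff)
  qed
  define v where "v = z \<epsilon> (s, t)"
  have v: "v = (\<lambda>y. s * Ue \<epsilon> y + t * We \<epsilon> y)" by (simp add: v_def z)
  have "dJ (\<lambda>y. t * We \<epsilon> y + s * Ue \<epsilon> y) (Ue \<epsilon>) = 0"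
  proof (rule DERIV_local_max[OF DERIV_J_line])
    show "min (1 + r - s) (s - (1 - r)) > 0" using st by simp
    show "\<forall>y. \<bar>s - y\<bar> < min (1 + r - s) (s - (1 - r)) \<longrightarrow>
        J (\<lambda>x. t * We \<epsilon> x + y * Ue \<epsilon> x) \<le> J (\<lambda>x. t * We \<epsilon> x + s * Ue \<epsilon> x)"
      using mx[of _ t] st by (simp add: z add.commute abs_less_iff)
  qed
  then have "dJ v (\<lambda>y. s * Ue \<epsilon> y) = 0" by (simp add: dJ_scale v add.commute)
  moreover have "dJ (\<lambda>y. s * Ue \<epsilon> y + t * We \<epsilon> y) (We \<epsilon>) = 0"
  proof (rule DERIV_local_max[OF DERIV_J_line])
    show "min (1 + r - t) (t - (1 - r)) > 0" using st by simp
    show "\<forall>y. \<bar>t - y\<bar> < min (1 + r - t) (t - (1 - r)) \<longrightarrow>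
        J (\<lambda>x. s * Ue \<epsilon> x + y * We \<epsilon> x) \<le> J (\<lambda>x. s * Ue \<epsilon> x + t * We \<epsilon> x)"
      using mx[of s] st by (simp add: z abs_less_iff)
  qed
  then have "dJ v (\<lambda>y. t * We \<epsilon> y) = 0" by (simp add: dJ_scale v)
  moreover have "pos_part v = (\<lambda>y. s * Ue \<epsilon> y)" "neg_part v = (\<lambda>y. t * We \<epsilon> y)"
    unfolding v using st0 sgn by (intro parts_unique; simp add: mult_nonneg_nonpos)+
  moreover have "v \<in> H0 \<Omega>"
    using H(2,3) H0_unit[OF x] by (auto simp: v Ue_def We_def H0_def)
  moreover have "(\<lambda>y. s * Ue \<epsilon> y) \<noteq> (\<lambda>_. 0)" "(\<lambda>y. t * We \<epsilon> y) \<noteq> (\<lambda>_. 0)"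
    using nz st0 by (auto simp: fun_eq_iff)
  ultimately have "v \<in> M" by (simp add: M_def)
  from min[OF this] show False using e(3) by (simp add: v_def)
qed

section \<open>Comparison of the two levels\<close>

lemma dJ_unit:
  assumes "x \<in> \<Omega>"
  shows "dJ u (unit_at x) = (\<Sum>y\<in>\<Omega>. QM y x * u y) + b * E u u * (\<Sum>y\<in>\<Omega>. EM y x * u y)
    - \<mu> x * g (u x)"
proof -
  have "(\<Sum>y\<in>\<Omega>. \<mu> y * (g (u y) * unit_at x y)) = \<mu> x * g (u x)"
    using assms finite_domain
    by (simp add: unit_at_def if_distrib[of "\<lambda>c. _ * c"] cong: if_cong)
  then show ?thesis using assms finite_domain by (simp add: dJ_def qform_unit)
qed

lemma dJ_expand: "dJ u w = (\<Sum>x\<in>\<Omega>. w x * dJ u (unit_at x))"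
proof -
  have q: "qform \<Omega> A u w = (\<Sum>x\<in>\<Omega>. w x * (\<Sum>y\<in>\<Omega>. A y x * u y))" for A
    unfolding qform_def by (subst sum.swap) (simp add: sum_distrib_left mult_ac)
  have "(\<Sum>x\<in>\<Omega>. w x * dJ u (unit_at x)) = (\<Sum>x\<in>\<Omega>. w x * (\<Sum>y\<in>\<Omega>. QM y x * u y)
      + b * E u u * (w x * (\<Sum>y\<in>\<Omega>. EM y x * u y)) - \<mu> x * (g (u x) * w x))"
    by (intro sum.cong refl) (simp add: dJ_unit algebra_simps)
  also have "\<dots> = dJ u w"
    by (simp add: dJ_def q sum.distrib sum_subtractf sum_distrib_left)
  finally show ?thesis by simp
qed

text \<open>Each part of a nodal function satisfies the strict inequality under which its ray meets
  the Nehari set, because the mutual interaction only helps. Comparing along the fibre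
  bounds the nodal energy from below by the sum of the two energies and the nonlocal interaction.\<close>

lemma nodal_energy_ge_split:
  assumes u: "u \<in> M"
  defines "U \<equiv> pos_part u" and "W \<equiv> neg_part u"
  shows "\<exists>s>0. \<exists>t>0. (\<lambda>x. s * U x) \<in> N \<and> (\<lambda>x. t * W x) \<in> N
    \<and> J (\<lambda>x. s * U x) + J (\<lambda>x. t * W x) + b / 2 * (s\<^sup>2 * t\<^sup>2 * (E U U * E W W)) \<le> J u"
proof -
  have H: "U \<in> H0 \<Omega>" "W \<in> H0 \<Omega>" "U \<noteq> (\<lambda>_. 0)" "W \<noteq> (\<lambda>_. 0)"
    using u by (auto simp: M_def U_def W_def H0_parts)
  have disj: "U x = 0 \<or> W x = 0" for x by (simp add: U_def W_def parts_simps)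
  note E = E_pos[OF H(1,3)] E_pos[OF H(2,4)] and Q = Q_pos[OF H(1,3)] Q_pos[OF H(2,4)]
  have inter: "Q U W \<ge> 0" "E U W \<ge> 0" using Q_parts E_parts by (auto simp: U_def W_def)
  note ids = nodal_identities[OF u, folded U_def W_def]
  have gap: "b * (E v v)\<^sup>2 < l * (\<Sum>x\<in>\<Omega>. \<mu> x * (v x) ^ 4)"
    if "Q v v + Q U W + b * E u u * (E v v + E U W) = (\<Sum>x\<in>\<Omega>. \<mu> x * (g (v x) * v x))"
      "Q v v > 0" "E v v > 0" "E v v \<le> E u u" for v
  proof -
    have "(E v v)\<^sup>2 \<le> E u u * (E v v + E U W)"
      unfolding power2_eq_square using that(3,4) inter by (intro mult_mono) auto
    then have "b * (E v v)\<^sup>2 \<le> b * E u u * (E v v + E U W)"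
      using b_nonneg by (simp add: mult.assoc mult_left_mono)
    also have "\<dots> < (\<Sum>x\<in>\<Omega>. \<mu> x * (g (v x) * v x))" using that(1,2) inter by linarith
    also have "\<dots> \<le> (\<Sum>x\<in>\<Omega>. \<mu> x * (l * v x ^ 4))"
      by (intro sum_mono mult_left_mono g_le_cubic) (auto simp: \<mu>_pos less_imp_le)
    also have "\<dots> = l * (\<Sum>x\<in>\<Omega>. \<mu> x * (v x) ^ 4)" by (simp add: sum_distrib_left mult_ac)
    finally show ?thesis .
  qed
  obtain s t where st: "s > 0" "t > 0" "(\<lambda>x. s * U x) \<in> N" "(\<lambda>x. t * W x) \<in> N"
    using nehari_projection[OF H(1,3) gap[OF ids(1)]] nehari_projection[OF H(2,4) gap[OF ids(2)]]
      E Q inter ids(3) by auto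
  have "J (\<lambda>x. s * U x + t * W x) \<le> J u - Q U U * (s\<^sup>2 - 1)\<^sup>2 / 4 - Q W W * (t\<^sup>2 - 1)\<^sup>2 / 4"
    using nodal_fibre[OF u, of s t] st by (simp add: U_def W_def)
  also have "\<dots> \<le> J u"
  proof -
    have "Q U U * (s\<^sup>2 - 1)\<^sup>2 / 4 \<ge> 0" "Q W W * (t\<^sup>2 - 1)\<^sup>2 / 4 \<ge> 0" using Q by simp_all
    then show ?thesis by linarith
  qed
  finally have le: "J (\<lambda>x. s * U x + t * W x) \<le> J u" .
  have c: "s * t * Q U W \<ge> 0" "s * t * E U W \<ge> 0" using st inter by simp_all
  have "(s\<^sup>2 * E U U + t\<^sup>2 * E W W)\<^sup>2 \<le> (s\<^sup>2 * E U U + t\<^sup>2 * E W W + 2 * s * t * E U W)\<^sup>2"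
    using E c by (intro power_mono) auto
  then have "b / 4 * (s\<^sup>2 * E U U + t\<^sup>2 * E W W)\<^sup>2
      \<le> b / 4 * (s\<^sup>2 * E U U + t\<^sup>2 * E W W + 2 * s * t * E U W)\<^sup>2"
    using b_nonneg by (intro mult_left_mono) auto
  moreover have "b / 4 * (s\<^sup>2 * E U U + t\<^sup>2 * E W W)\<^sup>2 = b / 4 * s ^ 4 * (E U U)\<^sup>2
      + b / 4 * t ^ 4 * (E W W)\<^sup>2 + b / 2 * (s\<^sup>2 * t\<^sup>2 * (E U U * E W W))"
    by (simp add: power2_eq_square power4_eq_xxxx field_simps)
  moreover have "(s\<^sup>2 * Q U U + t\<^sup>2 * Q W W + 2 * s * t * Q U W) / 2
      = s\<^sup>2 * Q U U / 2 + t\<^sup>2 * Q W W / 2 + s * t * Q U W" by (simp add: field_simps)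
  ultimately have "J (\<lambda>x. s * U x) + J (\<lambda>x. t * W x) + b / 2 * (s\<^sup>2 * t\<^sup>2 * (E U U * E W W))
      \<le> J (\<lambda>x. s * U x + t * W x)"
    using c(1) J_comb[of U W s t, OF disj] J_scale[of s U] J_scale[of t W] by argo
  with le st show ?thesis by (intro exI[of _ s] conjI exI[of _ t]) auto
qed

text \<open>At a zero of a nonnegative function the diagonal terms and the nonlinearity vanish, and what
  remains is nonpositive, strictly negative next to a positive value. So a nonzero
  nonnegative critical point on a connected domain has no zeros.\<close>

lemma strong_maximum_principle:
  assumes U: "U \<in> H0 \<Omega>" "\<And>x. U x \<ge> 0" and x: "x \<in> \<Omega>" "U x = 0"
    and y: "y \<in> \<Omega>" "U y > 0" "QM y x < 0"
  shows "dJ U (unit_at x) < 0"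
proof -
  have nonpos: "QM z x * U z \<le> 0" "EM z x * U z \<le> 0" if "z \<in> \<Omega>" for z
    using QM_offdiag[of z x] EM_offdiag[of z x] U(2)[of z] x that
    by (cases "z = x"; simp add: mult_nonpos_nonneg)+
  have "QM y x * U y < 0" using y by (simp add: mult_neg_pos)
  then have "(\<Sum>z\<in>\<Omega>. QM z x * U z) < (\<Sum>z\<in>\<Omega>. 0)"
    using nonpos y(1) finite_domain by (intro sum_strict_mono_ex1) auto
  moreover have "(\<Sum>z\<in>\<Omega>. EM z x * U z) \<le> 0" by (intro sum_nonpos nonpos)
  then have "b * E U U * (\<Sum>z\<in>\<Omega>. EM z x * U z) \<le> 0"
    using b_nonneg E_nonneg[OF U(1)] by (intro mult_nonneg_nonpos) auto
  ultimately show ?thesis by (simp add: dJ_unit[OF x(1)] x(2) g_0)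
qed

text \<open>A sign-changing ground state would lie in the nodal set and hence have at least twice its
  own positive energy. The alternative to \<open>b > 0\<close> in the last clause is the connectedness of the
  domain in the form used by the maximum principle.\<close>

theorem minimizers_exist:
  assumes "M \<noteq> {}"
  shows "\<exists>u v. u \<in> M \<and> (\<forall>w\<in>M. J u \<le> J w) \<and> (\<forall>x\<in>\<Omega>. dJ u (unit_at x) = 0)
    \<and> v \<in> N \<and> (\<forall>w\<in>N. J v \<le> J w) \<and> (\<forall>x\<in>\<Omega>. dJ v (unit_at x) = 0) \<and> constant_sign \<Omega> v
    \<and> ((b > 0 \<or> (\<forall>U\<in>H0 \<Omega>. (\<forall>x. U x \<ge> 0) \<longrightarrow> U \<noteq> (\<lambda>_. 0) \<longrightarrow> (\<exists>x\<in>\<Omega>. U x = 0) \<longrightarrow>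
          (\<exists>x\<in>\<Omega>. \<exists>y\<in>\<Omega>. U x = 0 \<and> U y > 0 \<and> QM y x < 0))) \<longrightarrow> 2 * J v < J u)"
proof -
  obtain u where u: "u \<in> M" "\<And>w. w \<in> M \<Longrightarrow> J u \<le> J w"
    using minimizer_exists[OF closed_M M_subset_N assms] by blast
  have "N \<noteq> {}" using assms M_subset_N by auto
  then obtain v where v: "v \<in> N" "\<And>w. w \<in> N \<Longrightarrow> J v \<le> J w"
    using minimizer_exists[OF closed_N] by blast
  have cu: "dJ u (unit_at x) = 0" and cv: "dJ v (unit_at x) = 0" if "x \<in> \<Omega>" for x
    using nodal_minimizer_critical[OF u that] nehari_minimizer_critical[OF v that] by auto
  have Jv: "J v > 0" using N_energy[OF v(1)] Q_pos[of v] v(1) by (auto simp: N_def)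
  define U W where "U = pos_part u" and "W = neg_part u"
  have H: "U \<in> H0 \<Omega>" "W \<in> H0 \<Omega>" "U \<noteq> (\<lambda>_. 0)" "W \<noteq> (\<lambda>_. 0)"
    using u by (auto simp: M_def U_def W_def H0_parts)
  obtain s t where st: "s > 0" "t > 0" "(\<lambda>x. s * U x) \<in> N" "(\<lambda>x. t * W x) \<in> N"
    and split: "J (\<lambda>x. s * U x) + J (\<lambda>x. t * W x) + b / 2 * (s\<^sup>2 * t\<^sup>2 * (E U U * E W W)) \<le> J u"
    using nodal_energy_ge_split[OF u(1)] by (auto simp: U_def W_def)
  note E = E_pos[OF H(1,3)] E_pos[OF H(2,4)]
  have extra: "b / 2 * (s\<^sup>2 * t\<^sup>2 * (E U U * E W W)) \<ge> 0" using b_nonneg E by simp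
  have ge: "2 * J v \<le> J u" using split extra v(2)[OF st(3)] v(2)[OF st(4)] by linarith
  have cs: "constant_sign \<Omega> v"
  proof (rule ccontr)
    assume "\<not> constant_sign \<Omega> v"
    then obtain x y where "v x < 0" "v y > 0" by (auto simp: constant_sign_def not_le)
    then have "pos_part v y \<noteq> 0" "neg_part v x \<noteq> 0" by (auto simp: pos_part_def neg_part_def)
    then have "pos_part v \<noteq> (\<lambda>_. 0)" "neg_part v \<noteq> (\<lambda>_. 0)" by auto
    moreover have "dJ v w = 0" for w by (simp add: dJ_expand[of v w] cv)
    ultimately have "v \<in> M" using v(1) by (simp add: M_def N_def)
    from u(2)[OF this] ge Jv show False by simp
  qed
  have "2 * J v < J u" if "b > 0"
  proof -
    have "b / 2 * (s\<^sup>2 * t\<^sup>2 * (E U U * E W W)) > 0" using that E st by simp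
    then show ?thesis using split v(2)[OF st(3)] v(2)[OF st(4)] by linarith
  qed
  moreover have "2 * J v < J u"
    if irr: "\<forall>U\<in>H0 \<Omega>. (\<forall>x. U x \<ge> 0) \<longrightarrow> U \<noteq> (\<lambda>_. 0) \<longrightarrow> (\<exists>x\<in>\<Omega>. U x = 0) \<longrightarrow>
          (\<exists>x\<in>\<Omega>. \<exists>y\<in>\<Omega>. U x = 0 \<and> U y > 0 \<and> QM y x < 0)"
  proof (rule ccontr)
    assume "\<not> 2 * J v < J u"
    then have "J (\<lambda>x. s * U x) \<le> J v"
      using split extra v(2)[OF st(4)] by linarith
    then have min: "J (\<lambda>x. s * U x) \<le> J w" if "w \<in> N" for w using v(2)[OF that] by linarith
    obtain x0 where x0: "W x0 \<noteq> 0" using H(4) by (auto simp: fun_eq_iff)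
    then have "x0 \<in> \<Omega>" "U x0 = 0"
      using H(2) parts_simps(4)[of u x0] by (auto simp: H0_def U_def W_def)
    moreover have sU: "(\<lambda>x. s * U x) \<in> H0 \<Omega>" "\<And>x. s * U x \<ge> 0" "(\<lambda>x. s * U x) \<noteq> (\<lambda>_. 0)"
      using st H by (auto simp: H0_scale U_def parts_simps N_def)
    ultimately obtain x y where "x \<in> \<Omega>" "y \<in> \<Omega>" "s * U x = 0" "s * U y > 0" "QM y x < 0"
      using irr by fastforce
    then have "dJ (\<lambda>x. s * U x) (unit_at x) < 0"
      by (intro strong_maximum_principle[OF sU(1,2)])
    moreover have "dJ (\<lambda>x. s * U x) (unit_at x) = 0"
      by (rule nehari_minimizer_critical[OF st(3) min \<open>x \<in> \<Omega>\<close>])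
    ultimately show False by simp
  qed
  ultimately show ?thesis using u v cu cv cs by blast
qed

end

section \<open>The Dirichlet form of a graph domain\<close>

lemma gdist_le_imp_walk:
  assumes "gdist G x y \<le> enat n"
  shows "\<exists>k. (x, y) \<in> {(u, v). {u, v} \<in> edges G} ^^ k \<and> k \<le> n"
proof -
  let ?S = "{k. (x, y) \<in> {(u, v). {u, v} \<in> edges G} ^^ k}"
  have "enat ` ?S \<noteq> {}"
    by (rule ccontr) (use assms in \<open>simp add: gdist_def Inf_enat_def\<close>)
  then have "Inf (enat ` ?S) \<in> enat ` ?S"
    unfolding Inf_enat_def by (auto intro: LeastI)
  then show ?thesis using assms by (auto simp: gdist_def)
qed

lemma edge_verts:
  assumes "locally_finite_wgraph G" "{x, y} \<in> edges G"
  shows "x \<in> verts G" "y \<in> verts G"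
  using assms by (auto simp: locally_finite_wgraph_def doubleton_eq_iff)

lemma finite_walk_ends:
  assumes G: "locally_finite_wgraph G" and x: "x \<in> verts G"
  shows "finite {y. (x, y) \<in> {(u, v). {u, v} \<in> edges G} ^^ n}
    \<and> {y. (x, y) \<in> {(u, v). {u, v} \<in> edges G} ^^ n} \<subseteq> verts G"
proof (induction n)
  case 0
  then show ?case using x by simp
next
  case (Suc n)
  let ?R = "{(u, v). {u, v} \<in> edges G}"
  have "{y. (x, y) \<in> ?R ^^ Suc n} = (\<Union>z\<in>{z. (x, z) \<in> ?R ^^ n}. nbrs G z)"
    by (auto simp: nbrs_def)
  moreover have "finite (nbrs G z)" "nbrs G z \<subseteq> verts G" if "(x, z) \<in> ?R ^^ n" for z
    using G that Suc edge_verts[OF G] by (auto simp: locally_finite_wgraph_def nbrs_def)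
  ultimately show ?case using Suc by auto
qed

text \<open>By local finiteness only finitely many vertices are reached by walks of bounded length.\<close>

lemma finite_of_bounded_in:
  assumes G: "locally_finite_wgraph G" and A: "A \<subseteq> verts G" "bounded_in G A"
  shows "finite A"
proof (cases "A = {}")
  case False
  then obtain x where x: "x \<in> A" by auto
  obtain n where n: "\<And>y. y \<in> A \<Longrightarrow> gdist G x y \<le> enat n"
    using A(2) x by (auto simp: bounded_in_def)
  have "A \<subseteq> (\<Union>k\<in>{..n}. {y. (x, y) \<in> {(u, v). {u, v} \<in> edges G} ^^ k})"
    using gdist_le_imp_walk[OF n] by blast
  moreover have "finite (\<Union>k\<in>{..n}. {y. (x, y) \<in> {(u, v). {u, v} \<in> edges G} ^^ k})"
    using finite_walk_ends[OF G] x A(1) by auto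
  ultimately show ?thesis by (rule finite_subset)
qed simp

text \<open>The matrix of \<open>- \<mu> \<Delta>\<close>. A loop contributes to both terms on the diagonal and cancels.\<close>

definition stiffness :: "'v wgraph \<Rightarrow> 'v \<Rightarrow> 'v \<Rightarrow> real" where
  "stiffness G x y = (if x = y then \<Sum>z\<in>nbrs G x. weight G x z else 0)
     - (if y \<in> nbrs G x then weight G x y else 0)"

locale graph_domain =
  fixes G :: "'v wgraph" and \<Omega> :: "'v set"
  assumes G: "locally_finite_wgraph G" and \<Omega>: "\<Omega> \<subseteq> verts G" "\<Omega> \<noteq> {}"
    and bdry: "bdry G \<Omega> \<noteq> {}" and bounded: "bounded_in G (\<Omega> \<union> bdry G \<Omega>)"
begin

abbreviation "\<mu> \<equiv> meas G"
abbreviation "E \<equiv> qform \<Omega> (stiffness G)"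

lemma finite_closure: "finite (\<Omega> \<union> bdry G \<Omega>)"
  using finite_of_bounded_in[OF G _ bounded] \<Omega>(1) by (auto simp: bdry_def)

lemma finite_\<Omega>: "finite \<Omega>" using finite_closure by simp

lemma closure_verts: "x \<in> \<Omega> \<union> bdry G \<Omega> \<Longrightarrow> x \<in> verts G"
  using \<Omega>(1) by (auto simp: bdry_def)

lemma finite_nbrs: "x \<in> verts G \<Longrightarrow> finite (nbrs G x)"
  using G by (auto simp: locally_finite_wgraph_def)

lemma nbrs_sym: "y \<in> nbrs G x \<longleftrightarrow> x \<in> nbrs G y"
  by (simp add: nbrs_def insert_commute)

lemma weight_nbrs: "y \<in> nbrs G x \<Longrightarrow> weight G x y = weight G y x \<and> weight G x y > 0"
  using G by (auto simp: locally_finite_wgraph_def nbrs_def)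

lemma meas_pos: "x \<in> verts G \<Longrightarrow> \<mu> x > 0"
  using G by (auto simp: locally_finite_wgraph_def)

lemma nbrs_closure: "x \<in> \<Omega> \<Longrightarrow> nbrs G x \<subseteq> \<Omega> \<union> bdry G \<Omega>"
  using edge_verts[OF G] by (auto simp: bdry_def nbrs_def)

lemma stiffness_sym: "stiffness G x y = stiffness G y x"
  using nbrs_sym[of x y] weight_nbrs by (auto simp: stiffness_def)

lemma stiffness_offdiag: "x \<noteq> y \<Longrightarrow> stiffness G x y \<le> 0"
  using weight_nbrs[of y x] by (auto simp: stiffness_def)

lemma sum_stiffness:
  assumes "u \<in> H0 \<Omega>" "x \<in> \<Omega>"
  shows "(\<Sum>y\<in>\<Omega>. stiffness G x y * u y) = - (\<Sum>y\<in>nbrs G x. weight G x y * (u y - u x))"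
proof -
  have fin: "finite (nbrs G x)" using finite_nbrs \<Omega>(1) assms(2) by auto
  have "(\<Sum>y\<in>nbrs G x. weight G x y * u y) = (\<Sum>y\<in>\<Omega> \<inter> nbrs G x. weight G x y * u y)"
    using assms(1) fin by (intro sum.mono_neutral_right) (auto simp: H0_def)
  also have "\<dots> = (\<Sum>y\<in>\<Omega>. if y \<in> nbrs G x then weight G x y * u y else 0)"
    by (rule sum.inter_restrict[OF finite_\<Omega>])
  finally have 1: "(\<Sum>y\<in>nbrs G x. weight G x y * u y)
      = (\<Sum>y\<in>\<Omega>. (if y \<in> nbrs G x then weight G x y else 0) * u y)"
    by (simp add: if_distrib[of "\<lambda>c. c * _"] cong: if_cong)
  have 2: "(\<Sum>y\<in>\<Omega>. (if x = y then \<Sum>z\<in>nbrs G x. weight G x z else 0) * u y)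
      = (\<Sum>z\<in>nbrs G x. weight G x z) * u x"
    using assms(2) finite_\<Omega> by (simp add: if_distrib[of "\<lambda>c. c * _"] cong: if_cong)
  have "(\<Sum>y\<in>\<Omega>. stiffness G x y * u y)
      = (\<Sum>z\<in>nbrs G x. weight G x z) * u x - (\<Sum>y\<in>nbrs G x. weight G x y * u y)"
    unfolding stiffness_def left_diff_distrib sum_subtractf 1 2 ..
  then show ?thesis by (simp add: right_diff_distrib sum_subtractf sum_distrib_right)
qed

lemma sum_stiffness_lap:
  assumes "u \<in> H0 \<Omega>" "x \<in> \<Omega>"
  shows "(\<Sum>y\<in>\<Omega>. stiffness G x y * u y) = \<mu> x * - lap G u x"
proof -
  have "\<mu> x > 0" using meas_pos \<Omega>(1) assms(2) by auto
  then show ?thesis by (simp add: sum_stiffness[OF assms] lap_def)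
qed

lemma gint_Gam_eq_double_sum:
  "gint G (\<Omega> \<union> bdry G \<Omega>) (Gam G u v)
    = (\<Sum>x\<in>\<Omega> \<union> bdry G \<Omega>. \<Sum>y\<in>nbrs G x. weight G x y * (u y - u x) * (v y - v x)) / 2"
proof -
  have "\<mu> x * Gam G u v x = (\<Sum>y\<in>nbrs G x. weight G x y * (u y - u x) * (v y - v x)) / 2"
    if "x \<in> \<Omega> \<union> bdry G \<Omega>" for x
    using meas_pos[OF closure_verts[OF that]] by (simp add: Gam_def)
  then show ?thesis by (simp add: gint_def sum_divide_distrib)
qed

text \<open>This is Green's formula. Edges leaving the closure contribute nothing because both ends carry the
  value zero; on the others, exchanging the two ends collects all terms with \<open>v x\<close>.\<close>

lemma gint_Gam_eq_qform:
  assumes u: "u \<in> H0 \<Omega>" and v: "v \<in> H0 \<Omega>"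
  shows "gint G (\<Omega> \<union> bdry G \<Omega>) (Gam G u v) = E u v"
proof -
  define B where "B = \<Omega> \<union> bdry G \<Omega>"
  have B: "finite B" "\<Omega> \<subseteq> B" using finite_closure by (auto simp: B_def)
  define c where "c x y = (if y \<in> nbrs G x then weight G x y else 0)" for x y
  have c_sym: "c x y = c y x" for x y
    using nbrs_sym[of x y] weight_nbrs by (auto simp: c_def)
  have inner: "(\<Sum>y\<in>nbrs G x. weight G x y * (u y - u x) * h y)
      = (\<Sum>y\<in>B. c x y * (u y - u x) * h y)" if x: "x \<in> B" for x and h :: "'v \<Rightarrow> real"
  proof -
    have "weight G x y * (u y - u x) * h y = 0" if "y \<in> nbrs G x" "y \<notin> B" for y
    proof -
      have "x \<notin> \<Omega>" using that nbrs_closure[of x] by (auto simp: B_def)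
      then show ?thesis using u that B(2) by (auto simp: H0_def)
    qed
    then have "(\<Sum>y\<in>nbrs G x. weight G x y * (u y - u x) * h y)
        = (\<Sum>y\<in>B \<inter> nbrs G x. weight G x y * (u y - u x) * h y)"
      using finite_nbrs[OF closure_verts] x by (intro sum.mono_neutral_right) (auto simp: B_def)
    also have "\<dots> = (\<Sum>y\<in>B. if y \<in> nbrs G x then weight G x y * (u y - u x) * h y else 0)"
      by (rule sum.inter_restrict[OF B(1)])
    also have "\<dots> = (\<Sum>y\<in>B. c x y * (u y - u x) * h y)"
      by (intro sum.cong) (auto simp: c_def)
    finally show ?thesis .
  qed
  define S where "S = (\<Sum>x\<in>B. \<Sum>y\<in>B. c x y * (u y - u x) * v x)"
  have "(\<Sum>x\<in>B. \<Sum>y\<in>B. c x y * (u y - u x) * v y) = (\<Sum>y\<in>B. \<Sum>x\<in>B. c x y * (u y - u x) * v y)"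
    by (rule sum.swap)
  also have "\<dots> = (\<Sum>y\<in>B. \<Sum>x\<in>B. - (c y x * (u x - u y) * v y))"
    by (intro sum.cong refl) (use c_sym in \<open>simp add: algebra_simps\<close>)
  also have "\<dots> = - S" by (simp add: S_def sum_negf)
  finally have swap: "(\<Sum>x\<in>B. \<Sum>y\<in>B. c x y * (u y - u x) * v y) = - S" .
  have "gint G B (Gam G u v) = (\<Sum>x\<in>B. \<Sum>y\<in>B. c x y * (u y - u x) * (v y - v x)) / 2"
    unfolding B_def gint_Gam_eq_double_sum using inner by (simp add: B_def[symmetric])
  also have "\<dots> = - S"
    using swap unfolding S_def right_diff_distrib[of _ "v _" "v _"] sum_subtractf by simp
  also have "S = (\<Sum>x\<in>B. v x * (\<Sum>y\<in>nbrs G x. weight G x y * (u y - u x)))"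
    unfolding S_def using inner[of _ "\<lambda>_. 1"]
    by (intro sum.cong refl) (simp add: sum_distrib_left mult.commute)
  also have "\<dots> = (\<Sum>x\<in>\<Omega>. v x * (\<Sum>y\<in>nbrs G x. weight G x y * (u y - u x)))"
    using B v by (intro sum.mono_neutral_right) (auto simp: H0_def)
  also have "- \<dots> = (\<Sum>x\<in>\<Omega>. v x * (\<Sum>y\<in>\<Omega>. stiffness G x y * u y))"
    by (simp add: sum_stiffness[OF u] sum_negf)
  also have "\<dots> = E v u" by (simp add: qform_def sum_distrib_left mult_ac)
  also have "\<dots> = E u v" by (rule qform_commute) (rule stiffness_sym)
  finally show ?thesis by (simp add: B_def)
qed

text \<open>Where the form vanishes the function is constant along edges, and a walk to the boundary
  carries the boundary value back into the domain.\<close>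

lemma E_pos:
  assumes u: "u \<in> H0 \<Omega>" "u \<noteq> (\<lambda>_. 0)"
  shows "E u u > 0"
proof (rule ccontr)
  assume "\<not> E u u > 0"
  let ?B = "\<Omega> \<union> bdry G \<Omega>"
  let ?t = "\<lambda>x. \<Sum>y\<in>nbrs G x. weight G x y * (u y - u x) * (u y - u x)"
  have nonneg: "weight G x y * (u y - u x) * (u y - u x) \<ge> 0" if "y \<in> nbrs G x" for x y
    using weight_nbrs[OF that] by (simp add: mult.assoc)
  have "(\<Sum>x\<in>?B. ?t x) \<le> 0"
    using \<open>\<not> E u u > 0\<close> gint_Gam_eq_qform[OF u(1) u(1)] gint_Gam_eq_double_sum[of u u] by simp
  moreover have "(\<Sum>x\<in>?B. ?t x) \<ge> 0" by (intro sum_nonneg nonneg)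
  ultimately have t_sum: "(\<Sum>x\<in>?B. ?t x) = 0" by (rule antisym)
  have t_nonneg: "?t x \<ge> 0" for x by (intro sum_nonneg nonneg)
  have t_zero: "\<forall>x\<in>?B. ?t x = 0"
    by (rule iffD1[OF sum_nonneg_eq_0_iff[OF finite_closure t_nonneg] t_sum])
  have eq: "u y = u x" if x: "x \<in> ?B" and y: "y \<in> nbrs G x" for x y
  proof -
    have "\<forall>y\<in>nbrs G x. weight G x y * (u y - u x) * (u y - u x) = 0"
      by (rule iffD1[OF sum_nonneg_eq_0_iff[OF finite_nbrs[OF closure_verts[OF x]] nonneg]
            bspec[OF t_zero x]])
    then have "weight G x y * (u y - u x) * (u y - u x) = 0" using y by blast
    then show ?thesis using weight_nbrs[OF y] by auto
  qed
  obtain z where z: "z \<in> bdry G \<Omega>" using bdry by auto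
  have walk: "u x = 0" if "x \<in> \<Omega>" "(x, z) \<in> {(u, v). {u, v} \<in> edges G} ^^ n" for x n
    using that
  proof (induction n arbitrary: x)
    case 0
    then show ?case using z by (auto simp: bdry_def)
  next
    case (Suc n)
    obtain y where y: "{x, y} \<in> edges G" "(y, z) \<in> {(u, v). {u, v} \<in> edges G} ^^ n"
      using relpow_Suc_D2[OF Suc.prems(2)] by blast
    have "u y = 0" using Suc.IH[OF _ y(2)] u(1) by (cases "y \<in> \<Omega>") (auto simp: H0_def)
    then show ?case using eq[of x y] Suc.prems(1) y(1) by (auto simp: nbrs_def)
  qed
  have "u x = 0" for x
  proof (cases "x \<in> \<Omega>")
    case True
    obtain n where n: "gdist G x z \<le> enat n" using bounded True z by (auto simp: bounded_in_def)
    from gdist_le_imp_walk[OF n] obtain k where "(x, z) \<in> {(u, v). {u, v} \<in> edges G} ^^ k"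
      by (elim exE conjE) (rule that)
    then show ?thesis by (rule walk[OF True])
  qed (use u in \<open>auto simp: H0_def\<close>)
  then show False using u(2) by auto
qed

section \<open>The first eigenvalue\<close>

text \<open>The Rayleigh quotient attains its minimum by compactness of the unit sphere, and a
  minimizer is an eigenfunction.\<close>

lemma rayleigh_minimizer:
  "\<exists>ev>0. \<exists>u\<in>H0 \<Omega>. u \<noteq> (\<lambda>_. 0) \<and> (\<forall>x\<in>\<Omega>. (\<Sum>y\<in>\<Omega>. stiffness G x y * u y) = ev * (\<mu> x * u x))
    \<and> (\<forall>v\<in>H0 \<Omega>. ev * (\<Sum>x\<in>\<Omega>. \<mu> x * (v x)\<^sup>2) \<le> E v v)"
proof -
  have \<mu>p: "\<mu> x > 0" if "x \<in> \<Omega>" for x using meas_pos \<Omega>(1) that by auto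
  define K where "K = H0 \<Omega> \<inter> {u. (\<Sum>x\<in>\<Omega>. \<mu> x * (u x)\<^sup>2) = 1}"
  have "compact K"
  proof (rule compact_of_bounded_squares[OF finite_\<Omega>])
    show "closed K" unfolding K_def
      by (intro closed_Int closed_H0 closed_Collect_eq continuous_intros
          continuous_on_product_coordinates)
    show "(\<Sum>x\<in>\<Omega>. (u x)\<^sup>2) \<le> (\<Sum>x\<in>\<Omega>. 1 / \<mu> x)" if u: "u \<in> K" for u
    proof (rule sum_mono)
      fix x assume x: "x \<in> \<Omega>"
      have "\<mu> x * (u x)\<^sup>2 \<le> (\<Sum>x\<in>\<Omega>. \<mu> x * (u x)\<^sup>2)"
        using x finite_\<Omega> \<mu>p by (intro member_le_sum) (auto simp: less_imp_le)
      then show "(u x)\<^sup>2 \<le> 1 / \<mu> x" using u \<mu>p[OF x] by (simp add: K_def field_simps)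
    qed
  qed (auto simp: K_def)
  have normalise: "(\<lambda>x. 1 / sqrt (\<Sum>x\<in>\<Omega>. \<mu> x * (v x)\<^sup>2) * v x) \<in> K \<and> (\<Sum>x\<in>\<Omega>. \<mu> x * (v x)\<^sup>2) > 0"
    if v: "v \<in> H0 \<Omega>" "v \<noteq> (\<lambda>_. 0)" for v
  proof -
    define s where "s = (\<Sum>x\<in>\<Omega>. \<mu> x * (v x)\<^sup>2)"
    obtain x where "v x \<noteq> 0" using v by auto
    moreover then have "x \<in> \<Omega>" using v by (auto simp: H0_def)
    ultimately have "s > 0" unfolding s_def using \<mu>p finite_\<Omega>
      by (intro sum_pos2[of _ x]) (auto simp: less_imp_le)
    moreover have "\<mu> x * (1 / sqrt s * v x)\<^sup>2 = \<mu> x * (v x)\<^sup>2 / s" for x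
      using \<open>s > 0\<close> by (simp add: power_divide power_mult_distrib)
    then have "(\<Sum>x\<in>\<Omega>. \<mu> x * (1 / sqrt s * v x)\<^sup>2) = s / s"
      by (simp only: s_def sum_divide_distrib)
    ultimately show ?thesis using v unfolding s_def[symmetric] by (simp add: K_def H0_def)
  qed
  obtain x where x: "x \<in> \<Omega>" using \<Omega>(2) by auto
  have "unit_at x \<in> H0 \<Omega>" "unit_at x \<noteq> (\<lambda>_. 0)"
    using x by (auto simp: H0_def unit_at_def fun_eq_iff)
  then have "K \<noteq> {}" using normalise by blast
  moreover have "continuous_on K (\<lambda>u. E u u)"
    by (intro continuous_intros continuous_on_subset[OF continuous_on_product_coordinates]) auto
  ultimately have "\<exists>u\<in>K. \<forall>v\<in>K. E u u \<le> E v v"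
    using \<open>compact K\<close> by (intro continuous_attains_inf)
  then obtain u where u: "u \<in> K" "\<And>v. v \<in> K \<Longrightarrow> E u u \<le> E v v" by blast
  define ev where "ev = E u u"
  have uH: "u \<in> H0 \<Omega>" "u \<noteq> (\<lambda>_. 0)" using u(1) by (auto simp: K_def)
  have le: "ev * (\<Sum>x\<in>\<Omega>. \<mu> x * (v x)\<^sup>2) \<le> E v v" if v: "v \<in> H0 \<Omega>" for v
  proof (cases "v = (\<lambda>_. 0)")
    case True
    then show ?thesis by (simp add: qform_def)
  next
    case False
    define s where "s = (\<Sum>x\<in>\<Omega>. \<mu> x * (v x)\<^sup>2)"
    have s: "s > 0" "(\<lambda>x. 1 / sqrt s * v x) \<in> K"
      using normalise[OF v False] unfolding s_def by blast+
    have "ev \<le> 1 / sqrt s * (1 / sqrt s * E v v)"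
      using u(2)[OF s(2)] unfolding ev_def qform_linear .
    then show ?thesis using s(1) by (simp add: s_def[symmetric] field_simps)
  qed
  have "(\<Sum>y\<in>\<Omega>. stiffness G x y * u y) = ev * (\<mu> x * u x)" if x: "x \<in> \<Omega>" for x
  proof -
    let ?e = "unit_at x"
    define \<phi> where "\<phi> r = E (\<lambda>y. u y + r * ?e y) (\<lambda>y. u y + r * ?e y)
        - ev * (\<Sum>y\<in>\<Omega>. \<mu> y * (u y + r * ?e y)\<^sup>2)" for r
    have sumx: "(\<Sum>y\<in>\<Omega>. \<mu> y * u y * ?e y) = \<mu> x * u x" "(\<Sum>y\<in>\<Omega>. \<mu> y * (?e y)\<^sup>2) = \<mu> x"
      using x finite_\<Omega> by (simp_all add: unit_at_def if_distrib[of "\<lambda>c. _ * c"]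
          if_distrib[of "\<lambda>c. c ^ 2"] cong: if_cong)
    have "(\<Sum>y\<in>\<Omega>. \<mu> y * (u y + r * ?e y)\<^sup>2) = (\<Sum>y\<in>\<Omega>. \<mu> y * (u y)\<^sup>2)
        + 2 * r * (\<Sum>y\<in>\<Omega>. \<mu> y * u y * ?e y) + r\<^sup>2 * (\<Sum>y\<in>\<Omega>. \<mu> y * (?e y)\<^sup>2)" for r
      by (simp add: sum.distrib[symmetric] sum_distrib_left power2_eq_square algebra_simps)
    moreover have "(\<Sum>y\<in>\<Omega>. \<mu> y * (u y)\<^sup>2) = 1" using u(1) by (simp add: K_def)
    moreover have "E ?e u = E u ?e" by (rule qform_commute) (rule stiffness_sym)
    ultimately have \<phi>: "\<phi> r = 2 * r * (E u ?e - ev * (\<mu> x * u x)) + r\<^sup>2 * (E ?e ?e - ev * \<mu> x)" for r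
      unfolding \<phi>_def qform_linear sumx
      by (simp add: ev_def power2_eq_square algebra_simps)
    have "(\<phi> has_real_derivative 2 * (E u ?e - ev * (\<mu> x * u x))) (at 0)"
      unfolding \<phi> by (auto intro!: derivative_eq_intros)
    moreover have "\<phi> 0 \<le> \<phi> r" for r
    proof -
      have "(\<lambda>y. u y + r * ?e y) \<in> H0 \<Omega>" using uH x by (auto simp: H0_def unit_at_def)
      from le[OF this] have "\<phi> r \<ge> 0" unfolding \<phi>_def by linarith
      moreover have "\<phi> 0 = 0" by (simp add: \<phi>[of 0])
      ultimately show ?thesis by linarith
    qed
    ultimately have "2 * (E u ?e - ev * (\<mu> x * u x)) = 0"
      by (intro DERIV_local_min[of \<phi> _ 0 1]) auto
    moreover have "E u ?e = (\<Sum>y\<in>\<Omega>. stiffness G x y * u y)"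
      unfolding qform_unit[OF finite_\<Omega> x]
      by (intro sum.cong refl arg_cong2[where f="(*)"] stiffness_sym)
    ultimately show ?thesis by simp
  qed
  moreover have "ev > 0" unfolding ev_def by (rule E_pos[OF uH])
  ultimately show ?thesis using uH le by blast
qed

text \<open>Testing an eigenvalue equation with its eigenfunction shows that every eigenvalue is a value of
  the Rayleigh quotient, hence the minimum of the quotient is the least eigenvalue.\<close>

lemma lambda1:
  "lambda1 G \<Omega> > 0" "v \<in> H0 \<Omega> \<Longrightarrow> lambda1 G \<Omega> * (\<Sum>x\<in>\<Omega>. \<mu> x * (v x)\<^sup>2) \<le> E v v"
proof -
  obtain ev u where ev: "ev > 0" and u: "u \<in> H0 \<Omega>" "u \<noteq> (\<lambda>_. 0)"
      "\<And>x. x \<in> \<Omega> \<Longrightarrow> (\<Sum>y\<in>\<Omega>. stiffness G x y * u y) = ev * (\<mu> x * u x)"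
    and le: "\<And>v. v \<in> H0 \<Omega> \<Longrightarrow> ev * (\<Sum>x\<in>\<Omega>. \<mu> x * (v x)\<^sup>2) \<le> E v v"
    using rayleigh_minimizer by blast
  have \<mu>p: "\<mu> x > 0" if "x \<in> \<Omega>" for x using meas_pos \<Omega>(1) that by auto
  have "lambda1 G \<Omega> = ev" unfolding lambda1_def
  proof (rule Least_equality)
    have "- lap G u x = ev * u x" if x: "x \<in> \<Omega>" for x
    proof -
      have "\<mu> x * - lap G u x = \<mu> x * (ev * u x)"
        using u(3)[OF x] sum_stiffness_lap[OF u(1) x] by simp
      then show ?thesis using \<mu>p[OF x] by (simp only: mult_cancel_left) simp
    qed
    then show "dirichlet_eigenvalue G \<Omega> ev"
      unfolding dirichlet_eigenvalue_def using u(1,2) by blast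
  next
    fix ev' assume "dirichlet_eigenvalue G \<Omega> ev'"
    then obtain w where w: "w \<in> H0 \<Omega>" "w \<noteq> (\<lambda>_. 0)" "\<And>x. x \<in> \<Omega> \<Longrightarrow> - lap G w x = ev' * w x"
      by (auto simp: dirichlet_eigenvalue_def)
    have "E w w = (\<Sum>x\<in>\<Omega>. w x * (\<Sum>y\<in>\<Omega>. stiffness G x y * w y))"
      by (simp add: qform_def sum_distrib_left mult_ac)
    also have "\<dots> = (\<Sum>x\<in>\<Omega>. w x * (\<mu> x * (ev' * w x)))"
      by (intro sum.cong refl) (simp add: sum_stiffness_lap[OF w(1)] w(3)[symmetric])
    also have "\<dots> = ev' * (\<Sum>x\<in>\<Omega>. \<mu> x * (w x)\<^sup>2)"
      by (simp add: sum_distrib_left power2_eq_square mult_ac)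
    finally have ineq: "ev * (\<Sum>x\<in>\<Omega>. \<mu> x * (w x)\<^sup>2) \<le> ev' * (\<Sum>x\<in>\<Omega>. \<mu> x * (w x)\<^sup>2)"
      using le[OF w(1)] by simp
    obtain x where "w x \<noteq> 0" using w(2) by auto
    moreover then have "x \<in> \<Omega>" using w by (auto simp: H0_def)
    ultimately have "(\<Sum>x\<in>\<Omega>. \<mu> x * (w x)\<^sup>2) > 0" using \<mu>p finite_\<Omega>
      by (intro sum_pos2[of _ x]) (auto simp: less_imp_le)
    with ineq show "ev \<le> ev'" by simp
  qed
  then show "lambda1 G \<Omega> > 0" "v \<in> H0 \<Omega> \<Longrightarrow> lambda1 G \<Omega> * (\<Sum>x\<in>\<Omega>. \<mu> x * (v x)\<^sup>2) \<le> E v v"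
    using ev le by auto
qed

text \<open>Follow a path inside the domain from a positive value to a zero: some edge crosses over.\<close>

lemma connected_crossing:
  assumes conn: "connected_in G \<Omega>" and U: "U \<in> H0 \<Omega>" "\<And>x. U x \<ge> (0::real)" "U \<noteq> (\<lambda>_. 0)"
    and x: "x \<in> \<Omega>" "U x = 0"
  shows "\<exists>x\<in>\<Omega>. \<exists>y\<in>\<Omega>. U x = 0 \<and> U y > 0 \<and> {x, y} \<in> edges G"
proof (rule ccontr)
  assume no: "\<not> ?thesis"
  obtain y where y: "U y \<noteq> 0" using U(3) by auto
  then have "y \<in> \<Omega>" "U y > 0" using U(1) U(2)[of y] by (auto simp: H0_def)
  have "(y, x) \<in> {(u, v). u \<in> \<Omega> \<and> v \<in> \<Omega> \<and> {u, v} \<in> edges G}\<^sup>*"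
    using conn \<open>y \<in> \<Omega>\<close> x by (auto simp: connected_in_def)
  then have "U x > 0"
  proof (induction rule: rtrancl_induct)
    case (step p q)
    then have "U q \<noteq> 0" using no by (auto simp: insert_commute)
    then show ?case using U(2)[of q] by simp
  qed (use \<open>U y > 0\<close> in simp)
  then show False using x by simp
qed

end

section \<open>The nonlinearity\<close>

lemma DERIV_prim:
  assumes "continuous_on UNIV f"
  shows "(prim f has_real_derivative f t) (at t)"
proof -
  define r where "r = \<bar>t\<bar> + 1"
  have "((\<lambda>s. LBINT y=ereal 0..ereal s. f y) has_vector_derivative f t) (at t within {-r..r})"
    by (rule interval_integral_FTC2)
      (use assms in \<open>auto simp: r_def intro: continuous_on_subset\<close>)
  moreover have "at t within {-r..r} = at t"
    by (rule at_within_interior) (auto simp: r_def interior_atLeastAtMost_real)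
  ultimately show ?thesis
    by (simp add: prim_def[abs_def] has_real_derivative_iff_has_vector_derivative)
qed

lemma prim_0: "prim f 0 = 0"
  by (simp add: prim_def)

text \<open>The admissible defect in the monotonicity hypothesis is exactly the one produced by a linear
  term. After subtracting \<open>K t\<close> with \<open>K = a * \<theta>0 * lambda1\<close> the quotient by the cube is
  genuinely monotone on each half-line.\<close>

locale shifted_nonlinearity =
  fixes f finf :: "real \<Rightarrow> real" and l K :: real
  assumes f_cont: "continuous_on UNIV f"
    and f_small: "f \<in> o[at 0](\<lambda>t. t)"
    and f_split: "\<forall>t. f t = l * t ^ 3 + finf t"
    and finf_large: "finf \<in> o[at_infinity](\<lambda>t. t ^ 3)"
    and K: "K \<ge> 0"
    and mono: "\<forall>t \<tau>. t > 0 \<and> \<tau> \<noteq> 0 \<longrightarrow>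
           (finf \<tau> / \<tau> ^ 3 - finf (t * \<tau>) / (t * \<tau>) ^ 3) * sgn (1 - t)
             + K * \<bar>1 - t\<^sup>2\<bar> / (t * \<tau>)\<^sup>2 \<ge> 0"
begin

definition g :: "real \<Rightarrow> real" where "g t = f t - K * t"
definition Gp :: "real \<Rightarrow> real" where "Gp t = prim f t - K / 2 * t\<^sup>2"

lemma f_le_near_zero:
  assumes "\<epsilon> > 0"
  shows "\<exists>\<delta>>0. \<forall>\<tau>. \<tau> \<noteq> 0 \<and> \<bar>\<tau>\<bar> \<le> \<delta> \<longrightarrow> \<bar>f \<tau>\<bar> \<le> \<epsilon> * \<bar>\<tau>\<bar>"
proof -
  have "eventually (\<lambda>\<tau>. norm (f \<tau>) \<le> \<epsilon> * norm \<tau>) (at 0)"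
    using landau_o.smallD[OF f_small assms] .
  then obtain d where d: "d > 0" "\<And>\<tau>. \<tau> \<noteq> 0 \<Longrightarrow> dist \<tau> 0 < d \<Longrightarrow> norm (f \<tau>) \<le> \<epsilon> * norm \<tau>"
    unfolding eventually_at by blast
  show ?thesis
    using d by (intro exI[of _ "d / 2"]) auto
qed

lemma f_0: "f 0 = 0"
proof -
  have "(f \<longlongrightarrow> f 0) (at 0)"
    using f_cont by (simp add: continuous_on_eq_continuous_at isCont_def)
  moreover have "(f \<longlongrightarrow> 0) (at 0)"
  proof (rule Lim_null_comparison)
    show "eventually (\<lambda>\<tau>. norm (f \<tau>) \<le> 1 * norm \<tau>) (at 0)"
      using landau_o.smallD[OF f_small, of 1] by simp
    show "((\<lambda>\<tau>::real. 1 * norm \<tau>) \<longlongrightarrow> 0) (at 0)"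
      by (auto intro!: tendsto_eq_intros)
  qed
  ultimately show ?thesis using LIM_unique by blast
qed

lemma g_cubic_mono:
  assumes "0 < t" "t \<le> 1"
  shows "g (t * \<tau>) * \<tau> \<le> t ^ 3 * (g \<tau> * \<tau>)"
proof (cases "t = 1 \<or> \<tau> = 0")
  case False
  then have t: "0 < t" "t < 1" "\<tau> \<noteq> 0" using assms by auto
  have "t\<^sup>2 < 1" using t by (simp add: power_less_one_iff)
  then have "(finf \<tau> / \<tau> ^ 3 - finf (t * \<tau>) / (t * \<tau>) ^ 3) + K * (1 - t\<^sup>2) / (t * \<tau>)\<^sup>2 \<ge> 0"
    using mono[rule_format, of t \<tau>] t by (simp add: sgn_if)
  then have "t ^ 3 * \<tau> ^ 4 * ((finf \<tau> / \<tau> ^ 3 - finf (t * \<tau>) / (t * \<tau>) ^ 3)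
      + K * (1 - t\<^sup>2) / (t * \<tau>)\<^sup>2) \<ge> 0"
    using t by (intro mult_nonneg_nonneg) auto
  also have "t ^ 3 * \<tau> ^ 4 * ((finf \<tau> / \<tau> ^ 3 - finf (t * \<tau>) / (t * \<tau>) ^ 3)
      + K * (1 - t\<^sup>2) / (t * \<tau>)\<^sup>2)
      = t ^ 3 * finf \<tau> * \<tau> - finf (t * \<tau>) * \<tau> + K * (1 - t\<^sup>2) * t * \<tau>\<^sup>2"
    using t by (simp add: field_simps power2_eq_square power3_eq_cube power4_eq_xxxx)
  finally have "finf (t * \<tau>) * \<tau> \<le> t ^ 3 * finf \<tau> * \<tau> + K * (1 - t\<^sup>2) * t * \<tau>\<^sup>2" by simp
  moreover have "g (t * \<tau>) * \<tau> = l * t ^ 3 * \<tau> ^ 4 + finf (t * \<tau>) * \<tau> - K * t * \<tau>\<^sup>2"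
    and "t ^ 3 * (g \<tau> * \<tau>) = l * t ^ 3 * \<tau> ^ 4 + t ^ 3 * finf \<tau> * \<tau> - K * t ^ 3 * \<tau>\<^sup>2"
    and "K * (1 - t\<^sup>2) * t * \<tau>\<^sup>2 = K * t * \<tau>\<^sup>2 - K * t ^ 3 * \<tau>\<^sup>2"
    using f_split by (simp_all add: g_def algebra_simps power2_eq_square power3_eq_cube power4_eq_xxxx)
  ultimately show ?thesis by linarith
qed auto

lemma g_small:
  assumes "\<epsilon> > 0"
  shows "\<exists>\<delta>>0. \<forall>\<tau>. \<bar>\<tau>\<bar> \<le> \<delta> \<longrightarrow> g \<tau> * \<tau> \<le> \<epsilon> * \<tau>\<^sup>2"
proof -
  obtain \<delta> where \<delta>: "\<delta> > 0" "\<And>\<tau>. \<tau> \<noteq> 0 \<Longrightarrow> \<bar>\<tau>\<bar> \<le> \<delta> \<Longrightarrow> \<bar>f \<tau>\<bar> \<le> \<epsilon> * \<bar>\<tau>\<bar>"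
    using f_le_near_zero[OF assms] by blast
  have "g \<tau> * \<tau> \<le> \<epsilon> * \<tau>\<^sup>2" if "\<bar>\<tau>\<bar> \<le> \<delta>" for \<tau>
  proof (cases "\<tau> = 0")
    case False
    have "f \<tau> * \<tau> \<le> \<bar>f \<tau>\<bar> * \<bar>\<tau>\<bar>" by (metis abs_ge_self abs_mult)
    also have "\<dots> \<le> \<epsilon> * \<bar>\<tau>\<bar> * \<bar>\<tau>\<bar>" using \<delta>(2)[OF False that] by (intro mult_right_mono) auto
    also have "\<dots> = \<epsilon> * \<tau>\<^sup>2" by (simp add: power2_eq_square mult.assoc)
    finally have "f \<tau> * \<tau> \<le> \<epsilon> * \<tau>\<^sup>2" .
    moreover have "K * \<tau>\<^sup>2 \<ge> 0" using K by simp
    ultimately show ?thesis by (simp add: g_def algebra_simps power2_eq_square)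
  qed simp
  then show ?thesis using \<delta>(1) by blast
qed

lemma g_large:
  assumes "\<epsilon> > 0"
  shows "\<exists>R>0. \<forall>\<tau>. \<bar>\<tau>\<bar> \<ge> R \<longrightarrow> \<bar>g \<tau> * \<tau> - l * \<tau> ^ 4\<bar> \<le> \<epsilon> * \<tau> ^ 4"
proof -
  have "eventually (\<lambda>\<tau>. norm (finf \<tau>) \<le> \<epsilon> / 2 * norm (\<tau> ^ 3)) at_infinity"
    using landau_o.smallD[OF finf_large, of "\<epsilon> / 2"] assms by simp
  then obtain B where B: "\<And>\<tau>. B \<le> norm \<tau> \<Longrightarrow> norm (finf \<tau>) \<le> \<epsilon> / 2 * norm (\<tau> ^ 3)"
    unfolding eventually_at_infinity by blast
  define R where "R = max 1 (max B (2 * K / \<epsilon>))"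
  have "\<bar>g \<tau> * \<tau> - l * \<tau> ^ 4\<bar> \<le> \<epsilon> * \<tau> ^ 4" if "\<bar>\<tau>\<bar> \<ge> R" for \<tau>
  proof -
    have \<tau>: "\<bar>\<tau>\<bar> \<ge> 1" "\<bar>\<tau>\<bar> \<ge> B" "\<bar>\<tau>\<bar> \<ge> 2 * K / \<epsilon>" using that by (auto simp: R_def)
    have "\<bar>finf \<tau>\<bar> * \<bar>\<tau>\<bar> \<le> \<epsilon> / 2 * \<bar>\<tau> ^ 3\<bar> * \<bar>\<tau>\<bar>"
      using B[of \<tau>] \<tau> by (intro mult_right_mono) auto
    also have "\<dots> = \<epsilon> / 2 * \<bar>\<tau> ^ 4\<bar>"
      by (simp add: abs_mult power3_eq_cube power4_eq_xxxx mult.assoc)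
    also have "\<bar>\<tau> ^ 4\<bar> = \<tau> ^ 4" by (rule abs_of_nonneg) (rule zero_le_even_power, simp)
    finally have 1: "\<bar>finf \<tau> * \<tau>\<bar> \<le> \<epsilon> / 2 * \<tau> ^ 4" by (simp add: abs_mult)
    have "2 * K / \<epsilon> \<le> \<bar>\<tau>\<bar> * 1" using \<tau> by simp
    also have "\<dots> \<le> \<bar>\<tau>\<bar> * \<bar>\<tau>\<bar>" using \<tau> by (intro mult_left_mono) auto
    finally have "K \<le> \<epsilon> / 2 * \<tau>\<^sup>2" using assms by (simp add: field_simps power2_eq_square)
    then have "K * \<tau>\<^sup>2 \<le> \<epsilon> / 2 * \<tau>\<^sup>2 * \<tau>\<^sup>2" by (intro mult_right_mono) auto
    also have "\<dots> = \<epsilon> / 2 * \<tau> ^ 4" by (simp add: power2_eq_square power4_eq_xxxx)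
    finally have 2: "K * \<tau>\<^sup>2 \<le> \<epsilon> / 2 * \<tau> ^ 4" .
    have "g \<tau> * \<tau> - l * \<tau> ^ 4 = finf \<tau> * \<tau> - K * \<tau>\<^sup>2"
      using f_split by (simp add: g_def algebra_simps power2_eq_square power3_eq_cube power4_eq_xxxx)
    moreover have "K * \<tau>\<^sup>2 \<ge> 0" using K by simp
    ultimately show ?thesis using 1 2 unfolding abs_le_iff by linarith
  qed
  moreover have "R > 0" by (simp add: R_def)
  ultimately show ?thesis by blast
qed

lemma g_cont: "continuous_on UNIV g"
  unfolding g_def by (intro continuous_intros f_cont)

lemma DERIV_Gp: "(Gp has_real_derivative g t) (at t)"
  unfolding Gp_def g_def by (auto intro!: derivative_eq_intros DERIV_prim[OF f_cont])

end

section \<open>Transfer to the Kirchhoff problem\<close>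

text \<open>The nodal set is nonempty as soon as \<open>b * mu0 < l\<close>, since the quotient defining \<open>mu0\<close> then
  admits an almost minimizing function satisfying both projection conditions; for \<open>b = 0\<close> they hold
  for every sign-changing function.\<close>

theorem theorem1p2:
  fixes G :: "'v wgraph" and \<Omega> :: "'v set"
    and a b l :: real and f finf :: "real \<Rightarrow> real"
  assumes graph: "locally_finite_wgraph G"
    and domain: "\<Omega> \<subseteq> verts G" "\<Omega> \<noteq> {}" "bdry G \<Omega> \<noteq> {}" "bounded_in G (\<Omega> \<union> bdry G \<Omega>)"
    and coeffs: "a > 0" "b \<ge> 0"
    and f1: "continuous_on UNIV f"
      "\<exists>C0>0. \<exists>p\<ge>4. \<forall>t. \<bar>f t\<bar> \<le> C0 * (1 + \<bar>t\<bar> powr (p - 1))"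
    and f2: "f \<in> o[at 0](\<lambda>t. t)"
    and f3: "l > 0" "\<forall>t. f t = l * t ^ 3 + finf t" "finf \<in> o[at_infinity](\<lambda>t. t ^ 3)"
      "\<exists>\<theta>0. 0 < \<theta>0 \<and> \<theta>0 < 1 \<and>
         (\<forall>t \<tau>. t > 0 \<and> \<tau> \<noteq> 0 \<longrightarrow>
           (finf \<tau> / \<tau> ^ 3 - finf (t * \<tau>) / (t * \<tau>) ^ 3) * sgn (1 - t)
             + a * \<theta>0 * lambda1 G \<Omega> * \<bar>1 - t\<^sup>2\<bar> / (t * \<tau>)\<^sup>2 \<ge> 0)"
    and f4: "mu0 G \<Omega> < \<infinity>" "ereal l > ereal b * mu0 G \<Omega>"
  shows "\<exists>u v.
      kirchhoff_solution G \<Omega> a b f u \<and> sign_changing u \<and> u \<in> nodal_nehari G \<Omega> a b f \<and>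
      kirchhoff_solution G \<Omega> a b f v \<and> constant_sign \<Omega> v \<and> v \<in> nehari G \<Omega> a b f \<and>
      ereal (energy G \<Omega> a b f u) = nodal_level G \<Omega> a b f \<and>
      ereal (energy G \<Omega> a b f v) = ground_level G \<Omega> a b f \<and>
      (b > 0 \<or> connected_in G \<Omega> \<longrightarrow> nodal_level G \<Omega> a b f > 2 * ground_level G \<Omega> a b f)"
proof -
  interpret gd: graph_domain G \<Omega> using graph domain by unfold_locales
  from f3(4) obtain \<theta> where \<theta>: "0 < \<theta>" "\<theta> < 1" "\<forall>t \<tau>. t > 0 \<and> \<tau> \<noteq> 0 \<longrightarrow>
           (finf \<tau> / \<tau> ^ 3 - finf (t * \<tau>) / (t * \<tau>) ^ 3) * sgn (1 - t)
             + a * \<theta> * lambda1 G \<Omega> * \<bar>1 - t\<^sup>2\<bar> / (t * \<tau>)\<^sup>2 \<ge> 0"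
    by (elim exE conjE) (rule that)
  define K where "K = a * \<theta> * lambda1 G \<Omega>"
  have K: "K \<ge> 0" using coeffs(1) \<theta>(1) gd.lambda1(1) by (simp add: K_def)
  interpret nl: shifted_nonlinearity f finf l K
    using f1(1) f2 f3(2,3) K \<theta>(3) unfolding K_def by unfold_locales
  define \<mu> where "\<mu> = meas G"
  define EM where "EM = stiffness G"
  define QM where "QM x y = a * EM x y - (if x = y then K * \<mu> x else 0)" for x y
  have \<mu>p: "\<mu> x > 0" if "x \<in> \<Omega>" for x using gd.meas_pos domain(1) that by (auto simp: \<mu>_def)
  have finite: "finite \<Omega>" by (rule gd.finite_\<Omega>)
  have Q_eq: "qform \<Omega> QM u v = a * qform \<Omega> EM u v - K * (\<Sum>x\<in>\<Omega>. \<mu> x * (u x * v x))" for u v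
  proof -
    have "(\<Sum>y\<in>\<Omega>. QM x y * u x * v y) = (\<Sum>y\<in>\<Omega>. a * (EM x y * u x * v y)) - K * (\<mu> x * (u x * v x))"
      if "x \<in> \<Omega>" for x
    proof -
      have "(\<Sum>y\<in>\<Omega>. QM x y * u x * v y)
          = (\<Sum>y\<in>\<Omega>. a * (EM x y * u x * v y) - (if x = y then K * (\<mu> x * (u x * v x)) else 0))"
        by (intro sum.cong refl) (simp add: QM_def algebra_simps)
      then show ?thesis using that finite by (simp add: sum_subtractf)
    qed
    then show ?thesis by (simp add: qform_def sum_subtractf sum_distrib_left)
  qed
  have coercive: "\<exists>\<kappa>>0. \<forall>u\<in>H0 \<Omega>. \<kappa> * (\<Sum>x\<in>\<Omega>. (u x)\<^sup>2) \<le> qform \<Omega> QM u u"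
  proof (intro exI conjI ballI)
    define m where "m = Min (\<mu> ` \<Omega>)"
    have m: "m > 0" using \<mu>p finite domain(2) by (simp add: m_def)
    show "a * (1 - \<theta>) * lambda1 G \<Omega> * m > 0" using coeffs(1) \<theta>(2) gd.lambda1(1) m by simp
    fix u assume u: "u \<in> H0 \<Omega>"
    define V where "V = (\<Sum>x\<in>\<Omega>. \<mu> x * (u x)\<^sup>2)"
    have "m * (\<Sum>x\<in>\<Omega>. (u x)\<^sup>2) \<le> V"
      unfolding V_def sum_distrib_left using finite
      by (intro sum_mono mult_right_mono) (auto simp: m_def)
    then have "a * (1 - \<theta>) * lambda1 G \<Omega> * (m * (\<Sum>x\<in>\<Omega>. (u x)\<^sup>2)) \<le> a * (1 - \<theta>) * lambda1 G \<Omega> * V"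
      using coeffs(1) \<theta>(2) gd.lambda1(1) by (intro mult_left_mono) auto
    also have "\<dots> = a * (lambda1 G \<Omega> * V) - K * V" by (simp add: K_def algebra_simps)
    also have "\<dots> \<le> a * qform \<Omega> EM u u - K * V"
      using gd.lambda1(2)[OF u] coeffs(1) by (simp add: V_def \<mu>_def EM_def)
    also have "\<dots> = qform \<Omega> QM u u" by (simp add: Q_eq V_def power2_eq_square)
    finally show "a * (1 - \<theta>) * lambda1 G \<Omega> * m * (\<Sum>x\<in>\<Omega>. (u x)\<^sup>2) \<le> qform \<Omega> QM u u"
      by (simp add: mult.assoc)
  qed
  interpret kf: kirchhoff_functional \<Omega> QM EM \<mu> b l nl.g nl.Gp
  proof unfold_locales
    show "qform \<Omega> EM u u > 0" if "u \<in> H0 \<Omega>" "u \<noteq> (\<lambda>_. 0)" for u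
      unfolding EM_def by (rule gd.E_pos[OF that])
    show "EM x y = EM y x" "QM x y = QM y x" for x y
      using gd.stiffness_sym[of x y] by (auto simp: EM_def QM_def)
    show "EM x y \<le> 0" "QM x y \<le> 0" if "x \<noteq> y" for x y
      using gd.stiffness_offdiag[OF that] coeffs(1) that
      by (auto simp: EM_def QM_def mult_nonneg_nonpos)
  qed (fact finite \<mu>p coeffs(2) coercive nl.g_cont nl.DERIV_Gp nl.g_cubic_mono nl.g_small nl.g_large
      | simp add: nl.g_def nl.f_0 nl.Gp_def prim_0)+
  have gint_E: "gint G (\<Omega> \<union> bdry G \<Omega>) (Gam G u v) = qform \<Omega> EM u v"
    if "u \<in> H0 \<Omega>" "v \<in> H0 \<Omega>" for u v
    using gd.gint_Gam_eq_qform[OF that] by (simp add: EM_def)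
  have norm2: "(Hnorm G \<Omega> u)\<^sup>2 = qform \<Omega> EM u u" if "u \<in> H0 \<Omega>" for u
    using kf.E_nonneg[OF that] by (simp add: Hnorm_def gint_E[OF that that])
  have norm4: "(Hnorm G \<Omega> u) ^ 4 = (qform \<Omega> EM u u)\<^sup>2" if "u \<in> H0 \<Omega>" for u
  proof -
    have "(Hnorm G \<Omega> u) ^ 4 = ((Hnorm G \<Omega> u)\<^sup>2)\<^sup>2" by (simp add: power_mult[symmetric])
    then show ?thesis by (simp only: norm2[OF that])
  qed
  have energy: "energy G \<Omega> a b f u = kf.J u" if "u \<in> H0 \<Omega>" for u
    unfolding energy_def kf.J_def norm2[OF that] norm4[OF that] Q_eq
    by (simp add: gint_def nl.Gp_def \<mu>_def power2_eq_square algebra_simps sum_subtractf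
        sum.distrib sum_distrib_left sum_divide_distrib diff_divide_distrib)
  have denergy: "denergy G \<Omega> a b f u v = kf.dJ u v" if "u \<in> H0 \<Omega>" "v \<in> H0 \<Omega>" for u v
    unfolding denergy_def kf.dJ_def norm2[OF that(1)] gint_E[OF that] Q_eq
    by (simp add: gint_def nl.g_def \<mu>_def algebra_simps sum_subtractf sum_distrib_left)
  have nodal: "nodal_nehari G \<Omega> a b f = kf.M"
    using denergy kf.H0_parts unfolding nodal_nehari_def kf.M_def by auto
  have nehari: "nehari G \<Omega> a b f = kf.N"
    using denergy unfolding nehari_def kf.N_def by auto
  have solution: "kirchhoff_solution G \<Omega> a b f u"
    if u: "u \<in> H0 \<Omega>" and crit: "\<forall>x\<in>\<Omega>. kf.dJ u (unit_at x) = 0" for u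
    unfolding kirchhoff_solution_def
  proof (intro conjI ballI u)
    fix x assume x: "x \<in> \<Omega>"
    have e: "unit_at x \<in> H0 \<Omega>" by (rule kf.H0_unit[OF x])
    have "qform \<Omega> EM u (unit_at x) = (\<Sum>y\<in>\<Omega>. EM x y * u y)"
      unfolding qform_unit[OF finite x] EM_def
      by (intro sum.cong refl arg_cong2[where f="(*)"] gd.stiffness_sym)
    then have "qform \<Omega> EM u (unit_at x) = \<mu> x * - lap G u x"
      using gd.sum_stiffness_lap[OF u x] by (simp only: EM_def \<mu>_def)
    moreover have "gint G \<Omega> (\<lambda>y. f (u y) * unit_at x y) = \<mu> x * f (u x)"
      using x finite by (simp add: gint_def unit_at_def \<mu>_def if_distrib[of "\<lambda>c. _ * c"] cong: if_cong)
    moreover have "denergy G \<Omega> a b f u (unit_at x) = 0" using denergy[OF u e] crit x by simp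
    ultimately have "\<mu> x * (- (a + b * qform \<Omega> EM u u) * lap G u x) = \<mu> x * f (u x)"
      unfolding denergy_def norm2[OF u] gint_E[OF u e] by (simp add: algebra_simps)
    then show "- (a + b * gint G (\<Omega> \<union> bdry G \<Omega>) (Gam G u u)) * lap G u x = f (u x)"
      using \<mu>p[OF x] unfolding gint_E[OF u u] by (simp only: mult_cancel_left) simp
  qed
  have "kf.M \<noteq> {}"
  proof -
    have "\<exists>u. u \<in> H0 \<Omega> \<and> sign_changing u \<and>
        b * kf.E u u * kf.E u (pos_part u) < l * (\<Sum>x\<in>\<Omega>. \<mu> x * (pos_part u x) ^ 4) \<and>
        b * kf.E u u * kf.E u (neg_part u) < l * (\<Sum>x\<in>\<Omega>. \<mu> x * (neg_part u x) ^ 4)"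
    proof -
      have fourth: "(\<Sum>x\<in>\<Omega>. \<mu> x * (pos_part u x) ^ 4) > 0" "(\<Sum>x\<in>\<Omega>. \<mu> x * (neg_part u x) ^ 4) > 0"
        if "u \<in> H0 \<Omega>" "sign_changing u" for u
        using kf.sum_fourth_pos[OF kf.H0_parts(1)[OF that(1)]]
          kf.sum_fourth_pos[OF kf.H0_parts(2)[OF that(1)]] that(2)
        by (simp_all add: sign_changing_def)
      show ?thesis
      proof (cases "b = 0")
        case True
        have "{u \<in> H0 \<Omega>. sign_changing u} \<noteq> {}"
        proof
          assume none: "{u \<in> H0 \<Omega>. sign_changing u} = {}"
          have "mu0 G \<Omega> = \<infinity>" unfolding mu0_def none by (simp add: top_ereal_def)
          with f4(1) show False by simp
        qed
        then obtain u where "u \<in> H0 \<Omega>" "sign_changing u" by blast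
        then show ?thesis using True f3(1) fourth[of u] by (intro exI[of _ u]) simp
      next
        case False
        then have b: "b > 0" using coeffs(2) by simp
        have "mu0 G \<Omega> < ereal (l / b)"
          using f4 b by (cases "mu0 G \<Omega>") (auto simp: field_simps)
        then obtain u where u: "u \<in> H0 \<Omega>" "sign_changing u" and
          q: "(Hnorm G \<Omega> u)\<^sup>2 * gint G (\<Omega> \<union> bdry G \<Omega>) (Gam G u (pos_part u))
             / gint G \<Omega> (\<lambda>x. \<bar>pos_part u x\<bar> ^ 4) < l / b"
            "(Hnorm G \<Omega> u)\<^sup>2 * gint G (\<Omega> \<union> bdry G \<Omega>) (Gam G u (neg_part u))
             / gint G \<Omega> (\<lambda>x. \<bar>neg_part u x\<bar> ^ 4) < l / b"
          unfolding mu0_def INF_less_iff by auto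
        have four: "gint G \<Omega> (\<lambda>x. \<bar>v x\<bar> ^ 4) = (\<Sum>x\<in>\<Omega>. \<mu> x * (v x) ^ 4)" for v
          by (simp add: gint_def \<mu>_def power_even_abs)
        show ?thesis
          using q b fourth[OF u] u
          unfolding norm2[OF u(1)] gint_E[OF u(1) kf.H0_parts(1)[OF u(1)]]
            gint_E[OF u(1) kf.H0_parts(2)[OF u(1)]] four
          by (intro exI[of _ u]) (simp add: field_simps)
      qed
    qed
    then show ?thesis using kf.nodal_projection unfolding sign_changing_def by blast
  qed
  from kf.minimizers_exist[OF this]
  obtain u v where u: "u \<in> kf.M" "\<And>w. w \<in> kf.M \<Longrightarrow> kf.J u \<le> kf.J w"
      "\<forall>x\<in>\<Omega>. kf.dJ u (unit_at x) = 0"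
    and v: "v \<in> kf.N" "\<And>w. w \<in> kf.N \<Longrightarrow> kf.J v \<le> kf.J w"
      "\<forall>x\<in>\<Omega>. kf.dJ v (unit_at x) = 0" "constant_sign \<Omega> v"
    and strict: "b > 0 \<or> (\<forall>U\<in>H0 \<Omega>. (\<forall>x. U x \<ge> 0) \<longrightarrow> U \<noteq> (\<lambda>_. 0) \<longrightarrow> (\<exists>x\<in>\<Omega>. U x = 0) \<longrightarrow>
          (\<exists>x\<in>\<Omega>. \<exists>y\<in>\<Omega>. U x = 0 \<and> U y > 0 \<and> QM y x < 0)) \<Longrightarrow> 2 * kf.J v < kf.J u"
    by blast
  have H: "u \<in> H0 \<Omega>" "v \<in> H0 \<Omega>" using u(1) v(1) by (auto simp: kf.M_def kf.N_def)
  have MH: "w \<in> kf.M \<Longrightarrow> w \<in> H0 \<Omega>" and NH: "w \<in> kf.N \<Longrightarrow> w \<in> H0 \<Omega>" for w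
    by (auto simp: kf.M_def kf.N_def)
  have nodal_lv: "nodal_level G \<Omega> a b f = ereal (energy G \<Omega> a b f u)"
    unfolding nodal_level_def nodal
    by (intro antisym INF_lower INF_greatest u(1)) (use u MH energy in auto)
  have ground_lv: "ground_level G \<Omega> a b f = ereal (energy G \<Omega> a b f v)"
    unfolding ground_level_def nehari
    by (intro antisym INF_lower INF_greatest v(1)) (use v NH energy in auto)
  have gap: "2 * kf.J v < kf.J u" if "b > 0 \<or> connected_in G \<Omega>"
    using that
  proof
    assume conn: "connected_in G \<Omega>"
    show ?thesis
    proof (rule strict, rule disjI2, intro ballI impI)
      fix U assume U: "U \<in> H0 \<Omega>" "\<forall>x. U x \<ge> (0::real)" "U \<noteq> (\<lambda>_. 0)" "\<exists>x\<in>\<Omega>. U x = 0"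
      then obtain x y where xy: "x \<in> \<Omega>" "y \<in> \<Omega>" "U x = 0" "U y > 0" "{x, y} \<in> edges G"
        using gd.connected_crossing[OF conn] by blast
      then have "x \<in> nbrs G y" "x \<noteq> y" by (auto simp: nbrs_def insert_commute)
      then have "QM y x < 0"
        using gd.weight_nbrs[of x y] coeffs(1)
        by (auto simp: QM_def EM_def stiffness_def)
      then show "\<exists>x\<in>\<Omega>. \<exists>y\<in>\<Omega>. U x = 0 \<and> U y > 0 \<and> QM y x < 0" using xy by blast
    qed
  qed (use strict in blast)
  have "sign_changing u" using u(1) by (simp add: sign_changing_def kf.M_def)
  moreover have "2 * ground_level G \<Omega> a b f < nodal_level G \<Omega> a b f"
    if "b > 0 \<or> connected_in G \<Omega>"
    using gap[OF that] by (simp add: ground_lv nodal_lv energy H)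
  ultimately show ?thesis
    using solution[OF H(1) u(3)] solution[OF H(2) v(3)] u(1) v(1,4) nodal_lv ground_lv
    unfolding nodal nehari by (intro exI[of _ u] exI[of _ v]) auto
qed

end
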